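(* Assume $X$ is metrizable and countable at infinity, while the kernel $\kappa(x,y)$ is continuous for $x\ne y$ and possesses the property $(\infty_X)$. Let at least one of $I^+$, $I^-$ be finite, let the $A_i$, $i\in I$, be nearly compact, and let $$\breve A^+\cap\breve A^-=\varnothing.$$ If, moreover, Case I takes place and $\sum_{i\in I}a_i\,g_{i,\inf}^{-1}<\infty$, where $g_{i,\inf}:=\inf_{x\in A_i}g_i(x)$, then for any $I_0$ and $\boldsymbol\sigma$ the class $\mathfrak S^{\boldsymbol\sigma}_{\kappa,\mathbf f}(\mathbf A,\mathbf a,\mathbf g)$ of solutions of the constrained problem is nonempty, vaguely compact, and given by $$\mathfrak S^{\boldsymbol\sigma}_{\kappa,\mathbf f}(\mathbf A,\mathbf a,\mathbf g)=\bigcup_{(\boldsymbol\nu_t)_{t\in T}\in\mathbb M^{\boldsymbol\sigma}_{\kappa,\mathbf f}(\mathbf A,\mathbf a,\mathbf g)}(\boldsymbol\nu_t)'_{t\in T}.$$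
   Context: **Measures and kernels.** $X$ is a locally compact Hausdorff space, $\mathfrak M(X)$ the space of real-valued (signed) Radon measures on $X$ with the vague topology (pointwise convergence on the class $C_0(X)$ of continuous functions with compact support), $\mathfrak M^+(X)$ its positive elements. Continuous functions are finite-valued. $\nu\in\mathfrak M^+(X)$ is carried by $Q\subset X$ if $X\setminus Q$ is locally $\nu$-negligible (equivalently, $Q$ is $\nu$-measurable and $\nu=\nu|_Q$); $\mathfrak M^+(Q)$ is the set of such $\nu$. $\langle\psi,\nu\rangle:=\int\psi\,d\nu$. For a topological space $Y$, $\Psi(Y)$ is the set of l.s.c. functions $Y\to(-\infty,\infty]$, required to be nonnegative unless $Y$ is compact. A kernel is a symmetric $\kappa\in\Psi(X\times X)$. Write $\kappa(\mu,\nu):=\int\kappa\,d(\mu\otimes\nu)$. The kernel is assumed positive definite: $\kappa(\nu,\nu)\geqslant0$ for every $\nu\in\mathfrak M(X)$ for which it is defined (i.e. $\kappa(\nu^+,\nu^+)+\kappa(\nu^-,\nu^-)$ or $\kappa(\nu^+,\nu^-)$ is finite). $\mathcal E_\kappa(X):=\{\nu\in\mathfrak M(X):\kappa(\nu,\nu)\text{ finite}\}$ and $\mathcal E^+_\kappa(Q):=\mathcal E_\kappa(X)\cap\mathfrak M^+(Q)$. The inner capacity is $c_\kappa(Q):=\bigl[\inf\{\kappa(\nu,\nu):\nu\in\mathcal E_\kappa^+(Q),\ \nu(Q)=1\}\bigr]^{-1}$ ($\inf\varnothing=+\infty$, $1/(+\infty)=0$, $1/0=+\infty$). The kernel possesses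 the property $(\infty_X)$ if $\kappa(\cdot,y)\to0$ as $y\to\infty_X$ uniformly over compact sets in $X$, $\infty_X$ being the Alexandroff point of $X$. Countable at infinity means being a countable union of compact sets. **Condenser.** $I=I^+\cup I^-$ is a countable index set, $I^+\cap I^-=\varnothing$ ($I^-$ may be empty), $s_i:=+1$ for $i\in I^+$, $s_i:=-1$ for $i\in I^-$. $\mathbf A=(A_i)_{i\in I}$ is a generalized condenser: nonempty Borel sets $A_i\subset X$ such that every compact set meets at most finitely many $A_i$, and $A_i\cap A_j=\varnothing$ for $i\in I^+$, $j\in I^-$. A set $Q\subset X$ is nearly compact if there is a compact set $\breve Q$ with $c_\kappa(Q\bigtriangleup\breve Q)=0$. For nearly compact $A_i$, $\breve A_i$ denotes such a compact set, with $(\breve A_i)_{i\in I}$ locally finite, and $\breve A^{\pm}:=\bigcup_{i\in I^\pm}\breve A_i$. **Vector measures.** $\mathfrak M^+(\mathbf A):=\prod_{i\in I}\mathfrak M^+(A_i)$ carries the vague topology induced by the product of vague topologies on $\mathfrak M^+(X)^{\mathrm{Card}\,I}$. A numerical series over $I$ is finite iff it has finite terms and converges absolutely. The energy of $\boldsymbol\mu=(\mu^i)_{i\in I}\in\mathfrak M^+(\mathbf A)$ is $\kappa(\boldsymbol\mu,\boldsymbol\mu):=\sum_{i,j\in I}s_is_j\kappa(\mu^i,\mu^j)$; $\mathcal E^+_\kappa(\mathbf A)$ is the set of $\boldsymbol\mu$ with finite energy. **The problem.** Given: $\mathbf a=(a_i)_{i\in I}$, $a_i>0$; $\mathbf g=(g_i)_{i\in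 I}$ with continuous $g_i:X\to(0,\infty)$; an external field $\mathbf f=(f_i)_{i\in I}$, $f_i:X\to[-\infty,\infty]$ universally measurable; $I_0\subset I$ (possibly empty); constraints $\xi^i\in\mathfrak M^+(A_i)$, $i\in I_0$, with $\langle g_i,\xi^i\rangle>a_i$. Put $\sigma^i=\xi^i$ for $i\in I_0$, $\sigma^i=\infty$ (no constraint) for $i\in I\setminus I_0$, $\boldsymbol\sigma=(\sigma^i)_{i\in I}$. $\mathcal E^{\boldsymbol\sigma}_{\kappa,\mathbf f}(\mathbf A,\mathbf a,\mathbf g)$ is the set of $\boldsymbol\mu\in\mathcal E_\kappa^+(\mathbf A)$ with $\langle g_i,\mu^i\rangle=a_i$ for all $i\in I$, $\mu^i\leqslant\xi^i$ for all $i\in I_0$, and $\langle\mathbf f,\boldsymbol\mu\rangle:=\sum_{i\in I}\langle f_i,\mu^i\rangle$ finite. $G_{\kappa,\mathbf f}(\boldsymbol\mu):=\kappa(\boldsymbol\mu,\boldsymbol\mu)+2\langle\mathbf f,\boldsymbol\mu\rangle$; $G^{\boldsymbol\sigma}_{\kappa,\mathbf f}(\mathbf A,\mathbf a,\mathbf g):=\inf G_{\kappa,\mathbf f}$ over $\mathcal E^{\boldsymbol\sigma}_{\kappa,\mathbf f}(\mathbf A,\mathbf a,\mathbf g)$. The constrained problem asks for $\boldsymbol\lambda\in\mathcal E^{\boldsymbol\sigma}_{\kappa,\mathbf f}(\mathbf A,\mathbf a,\mathbf g)$ attaining this infimum; $\mathfrak S^{\boldsymbol\sigma}_{\kappa,\mathbf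 f}(\mathbf A,\mathbf a,\mathbf g)$ is the class of all such $\boldsymbol\lambda$. $\mathbb M^{\boldsymbol\sigma}_{\kappa,\mathbf f}(\mathbf A,\mathbf a,\mathbf g)$ is the class of minimizing nets: nets $(\boldsymbol\mu_s)_{s\in S}\subset\mathcal E^{\boldsymbol\sigma}_{\kappa,\mathbf f}(\mathbf A,\mathbf a,\mathbf g)$ with $\lim_{s\in S}G_{\kappa,\mathbf f}(\boldsymbol\mu_s)=G^{\boldsymbol\sigma}_{\kappa,\mathbf f}(\mathbf A,\mathbf a,\mathbf g)$. $(\boldsymbol\mu_s)'_{s\in S}$ is the set of vague cluster points of the net in $\mathfrak M^+(X)^{\mathrm{Card}\,I}$. **Permanent assumption.** $\mathcal E^{\boldsymbol\sigma}_{\kappa,\mathbf f}(\mathbf A,\mathbf a,\mathbf g)\ne\varnothing$, i.e. $G^{\boldsymbol\sigma}_{\kappa,\mathbf f}(\mathbf A,\mathbf a,\mathbf g)<\infty$. Case I means: $f_i\in\Psi(X)$ for all $i\in I$. *)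

theory Defs
  imports "HOL-Analysis.Analysis"
begin

subsection \<open>Radon measures and the vague topology\<close>

text \<open>
  Positive Radon measures on a locally compact Hausdorff space are represented by Borel measures.
\<close>

definition radon :: "'a::t2_space measure \<Rightarrow> bool" where
  "radon \<nu> \<longleftrightarrow> sets \<nu> = sets borel
     \<and> (\<forall>K. compact K \<longrightarrow> emeasure \<nu> K < \<infinity>)
     \<and> (\<forall>B\<in>sets borel. emeasure \<nu> B = (INF U\<in>{U. open U \<and> B \<subseteq> U}. emeasure \<nu> U))
     \<and> (\<forall>U. open U \<longrightarrow> emeasure \<nu> U = (SUP K\<in>{K. compact K \<and> K \<subseteq> U}. emeasure \<nu> K))"

text \<open>
  A signed Radon measure may have infinite positive and infinite negative total mass, so it is not
  a set function; it is represented by its Hahn--Jordan decomposition, i.e. by a pair of mutually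
  singular positive Radon measures.
\<close>

definition signed_radon :: "'a::t2_space measure \<times> 'a measure \<Rightarrow> bool" where
  "signed_radon = (\<lambda>(\<nu>p, \<nu>n). radon \<nu>p \<and> radon \<nu>n
     \<and> (\<exists>B\<in>sets borel. emeasure \<nu>p (- B) = 0 \<and> emeasure \<nu>n B = 0))"

definition test_functions :: "('a::topological_space \<Rightarrow> real) set" where
  "test_functions = {\<phi>. continuous_on UNIV \<phi> \<and> compact (closure {x. \<phi> x \<noteq> 0})}"

text \<open>The vague topology on the set of positive Radon measures (which is its \<open>topspace\<close>).\<close>

definition vague_topology :: "'a::t2_space measure topology" where
  "vague_topology = topology_generated_by
     {{\<nu>. radon \<nu> \<and> (\<integral>x. \<phi> x \<partial>\<nu>) \<in> U} | \<phi> U. \<phi> \<in> test_functions \<and> open U}"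

lemma topspace_vague_topology: "topspace vague_topology = {\<nu>. radon \<nu>}"
proof -
  let ?S = "{{\<nu>. radon \<nu> \<and> (\<integral>x. \<phi> x \<partial>\<nu>) \<in> U} | \<phi> U. \<phi> \<in> test_functions \<and> open U} :: 'a measure set set"
  have 0: "(\<lambda>_. 0) \<in> (test_functions :: ('a \<Rightarrow> real) set)"
    by (simp add: test_functions_def)
  have "{\<nu>. radon \<nu>} \<in> ?S"
    by (rule CollectI, rule exI[of _ "\<lambda>_. 0"], rule exI[of _ UNIV]) (simp add: 0)
  moreover have "X \<subseteq> {\<nu>. radon \<nu>}" if "X \<in> ?S" for X
    using that by blast
  ultimately have "\<Union>?S = {\<nu>. radon \<nu>}"
    by blast
  then show ?thesis
    unfolding vague_topology_def topology_generated_by_topspace .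
qed

definition carried_by :: "'a::t2_space measure \<Rightarrow> 'a set \<Rightarrow> bool" where
  "carried_by \<nu> Q \<longleftrightarrow> (\<forall>K. compact K \<longrightarrow> K - Q \<in> null_sets (completion \<nu>))"

definition radon_on :: "'a::t2_space set \<Rightarrow> 'a measure set" where
  "radon_on Q = {\<nu>. radon \<nu> \<and> carried_by \<nu> Q}"

text \<open>
  The integral of an extended real function. It is meaningful if the positive or the negative part
  has a finite integral; otherwise its value is \<open>\<infinity> - \<infinity> = \<infinity>\<close>, so that
  \<open>\<bar>pairing \<psi> \<nu>\<bar> \<noteq> \<infinity>\<close> always says that the integral exists and is finite.
\<close>

definition pairing :: "('b \<Rightarrow> ereal) \<Rightarrow> 'b measure \<Rightarrow> ereal" where
  "pairing \<psi> \<nu> = enn2ereal (\<integral>\<^sup>+x. e2ennreal (\<psi> x) \<partial>\<nu>)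
               - enn2ereal (\<integral>\<^sup>+x. e2ennreal (- \<psi> x) \<partial>\<nu>)"

subsection \<open>Kernels, energy and capacity\<close>

definition Psi :: "('b::topological_space \<Rightarrow> ereal) set" where
  "Psi = {\<psi>. (\<forall>c. open {x. c < \<psi> x}) \<and> (\<forall>x. \<psi> x \<noteq> -\<infinity>)
              \<and> (\<not> compact (UNIV :: 'b set) \<longrightarrow> (\<forall>x. 0 \<le> \<psi> x))}"

text \<open>
  Second countability ensures that the product \<open>\<sigma>\<close>-algebra is the Borel \<open>\<sigma>\<close>-algebra of the product
  space, so that l.s.c. kernels are measurable with respect to \<open>\<mu> \<Otimes>\<^sub>M \<nu>\<close>. It is automatic for a metrizable space that
  is a countable union of compact sets.
\<close>

definition mutual_energy ::
  "('a::{t2_space,second_countable_topology} \<times> 'a \<Rightarrow> ereal) \<Rightarrow> 'a measure \<Rightarrow> 'a measure \<Rightarrow> ereal" where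
  "mutual_energy \<kappa> \<mu> \<nu> = pairing \<kappa> (\<mu> \<Otimes>\<^sub>M \<nu>)"

definition positive_definite ::
  "('a::{t2_space,second_countable_topology} \<times> 'a \<Rightarrow> ereal) \<Rightarrow> bool" where
  "positive_definite \<kappa> \<longleftrightarrow>
    (\<forall>\<nu>p \<nu>n. signed_radon (\<nu>p, \<nu>n) \<longrightarrow>
       \<bar>mutual_energy \<kappa> \<nu>p \<nu>p + mutual_energy \<kappa> \<nu>n \<nu>n\<bar> \<noteq> \<infinity> \<or> \<bar>mutual_energy \<kappa> \<nu>p \<nu>n\<bar> \<noteq> \<infinity> \<longrightarrow>
       0 \<le> mutual_energy \<kappa> \<nu>p \<nu>p + mutual_energy \<kappa> \<nu>n \<nu>n - 2 * mutual_energy \<kappa> \<nu>p \<nu>n)"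

definition pd_kernel :: "('a::{t2_space,second_countable_topology} \<times> 'a \<Rightarrow> ereal) \<Rightarrow> bool" where
  "pd_kernel \<kappa> \<longleftrightarrow> \<kappa> \<in> Psi \<and> (\<forall>x y. \<kappa> (x, y) = \<kappa> (y, x)) \<and> positive_definite \<kappa>"

text \<open>Continuity off the diagonal; continuous functions are finite-valued.\<close>

definition off_diagonal_continuous :: "('a::topological_space \<times> 'a \<Rightarrow> ereal) \<Rightarrow> bool" where
  "off_diagonal_continuous \<kappa> \<longleftrightarrow>
     continuous_on {(x, y). x \<noteq> y} \<kappa> \<and> (\<forall>x y. x \<noteq> y \<longrightarrow> \<bar>\<kappa> (x, y)\<bar> \<noteq> \<infinity>)"

definition vanishes_at_infinity :: "('a::topological_space \<times> 'a \<Rightarrow> ereal) \<Rightarrow> bool" where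
  "vanishes_at_infinity \<kappa> \<longleftrightarrow>
     (\<forall>K. compact K \<longrightarrow> (\<forall>\<epsilon>>0::real. \<exists>L. compact L \<and> (\<forall>y. y \<notin> L \<longrightarrow> (\<forall>x\<in>K. \<bar>\<kappa> (x, y)\<bar> < ereal \<epsilon>))))"

definition finite_energy_on ::
  "('a::{t2_space,second_countable_topology} \<times> 'a \<Rightarrow> ereal) \<Rightarrow> 'a set \<Rightarrow> 'a measure set" where
  "finite_energy_on \<kappa> Q = {\<nu> \<in> radon_on Q. \<bar>mutual_energy \<kappa> \<nu> \<nu>\<bar> \<noteq> \<infinity>}"

text \<open>In \<open>ereal\<close>: \<open>Inf {} = \<infinity>\<close>, \<open>inverse \<infinity> = 0\<close> and \<open>inverse 0 = \<infinity>\<close>.\<close>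

definition inner_capacity ::
  "('a::{t2_space,second_countable_topology} \<times> 'a \<Rightarrow> ereal) \<Rightarrow> 'a set \<Rightarrow> ereal" where
  "inner_capacity \<kappa> Q =
     inverse (INF \<nu>\<in>{\<nu> \<in> finite_energy_on \<kappa> Q. emeasure (completion \<nu>) Q = 1}. mutual_energy \<kappa> \<nu> \<nu>)"

subsection \<open>Condensers and vector measures\<close>

text \<open>
  \<open>Ipos\<close> and \<open>Ineg\<close> are the sets of indices of positive and of negative plates; vector measures are the
  elements of a product \<open>Pi\<^sub>E (Ipos \<union> Ineg)\<close>.
\<close>

definition generalized_condenser :: "'i set \<Rightarrow> 'i set \<Rightarrow> ('i \<Rightarrow> 'a::t2_space set) \<Rightarrow> bool" where
  "generalized_condenser Ipos Ineg A \<longleftrightarrow>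
     countable (Ipos \<union> Ineg) \<and> Ipos \<inter> Ineg = {}
     \<and> (\<forall>i\<in>Ipos \<union> Ineg. A i \<noteq> {} \<and> A i \<in> sets borel)
     \<and> (\<forall>K. compact K \<longrightarrow> finite {i\<in>Ipos \<union> Ineg. A i \<inter> K \<noteq> {}})
     \<and> (\<forall>i\<in>Ipos. \<forall>j\<in>Ineg. A i \<inter> A j = {})"

definition charge_sign :: "'i set \<Rightarrow> 'i \<Rightarrow> real" where
  "charge_sign Ipos i = (if i \<in> Ipos then 1 else - 1)"

definition vague_product :: "'i set \<Rightarrow> ('i \<Rightarrow> 'a::t2_space measure) topology" where
  "vague_product I = product_topology (\<lambda>_. vague_topology) I"

definition vector_measures :: "'i set \<Rightarrow> ('i \<Rightarrow> 'a::t2_space set) \<Rightarrow> ('i \<Rightarrow> 'a measure) set" where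
  "vector_measures I A = (\<Pi>\<^sub>E i\<in>I. radon_on (A i))"

text \<open>A series is finite iff all its terms are finite and it converges absolutely.\<close>

definition finite_series :: "('k \<Rightarrow> ereal) \<Rightarrow> 'k set \<Rightarrow> bool" where
  "finite_series u J \<longleftrightarrow> (\<forall>k\<in>J. \<bar>u k\<bar> \<noteq> \<infinity>) \<and> (\<lambda>k. \<bar>real_of_ereal (u k)\<bar>) summable_on J"

definition energy_term ::
  "('a::{t2_space,second_countable_topology} \<times> 'a \<Rightarrow> ereal) \<Rightarrow> 'i set \<Rightarrow> ('i \<Rightarrow> 'a measure) \<Rightarrow> 'i \<times> 'i \<Rightarrow> ereal" where
  "energy_term \<kappa> Ipos \<mu> =
     (\<lambda>(i, j). ereal (charge_sign Ipos i * charge_sign Ipos j) * mutual_energy \<kappa> (\<mu> i) (\<mu> j))"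

definition finite_energy_vectors ::
  "('a::{t2_space,second_countable_topology} \<times> 'a \<Rightarrow> ereal) \<Rightarrow> 'i set \<Rightarrow> 'i set \<Rightarrow> ('i \<Rightarrow> 'a set)
   \<Rightarrow> ('i \<Rightarrow> 'a measure) set" where
  "finite_energy_vectors \<kappa> Ipos Ineg A =
     {\<mu> \<in> vector_measures (Ipos \<union> Ineg) A. finite_series (energy_term \<kappa> Ipos \<mu>) ((Ipos \<union> Ineg) \<times> (Ipos \<union> Ineg))}"

text \<open>
  The following three real numbers are the intended ones only when the series involved are finite,
  which is part of membership in \<open>admissible\<close> below.
\<close>

definition vector_energy ::
  "('a::{t2_space,second_countable_topology} \<times> 'a \<Rightarrow> ereal) \<Rightarrow> 'i set \<Rightarrow> 'i set \<Rightarrow> ('i \<Rightarrow> 'a measure) \<Rightarrow> real" where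
  "vector_energy \<kappa> Ipos Ineg \<mu> =
     (\<Sum>\<^sub>\<infinity>p\<in>(Ipos \<union> Ineg) \<times> (Ipos \<union> Ineg). real_of_ereal (energy_term \<kappa> Ipos \<mu> p))"

definition vector_pairing :: "'i set \<Rightarrow> ('i \<Rightarrow> 'a \<Rightarrow> ereal) \<Rightarrow> ('i \<Rightarrow> 'a measure) \<Rightarrow> real" where
  "vector_pairing I f \<mu> = (\<Sum>\<^sub>\<infinity>i\<in>I. real_of_ereal (pairing (f i) (\<mu> i)))"

definition gauss_functional ::
  "('a::{t2_space,second_countable_topology} \<times> 'a \<Rightarrow> ereal) \<Rightarrow> 'i set \<Rightarrow> 'i set \<Rightarrow> ('i \<Rightarrow> 'a \<Rightarrow> ereal)
   \<Rightarrow> ('i \<Rightarrow> 'a measure) \<Rightarrow> real" where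
  "gauss_functional \<kappa> Ipos Ineg f \<mu> = vector_energy \<kappa> Ipos Ineg \<mu> + 2 * vector_pairing (Ipos \<union> Ineg) f \<mu>"

subsection \<open>The constrained problem\<close>

text \<open>
  The constraint is given by the set \<open>I0\<close> of constrained indices and by measures \<open>\<xi> i\<close>, of which only
  those with \<open>i \<in> I0\<close> matter. For measures on the same \<open>\<sigma>\<close>-algebra, \<open>\<le>\<close> is the setwise order.
\<close>

definition is_constraint ::
  "('i \<Rightarrow> 'a::t2_space set) \<Rightarrow> ('i \<Rightarrow> real) \<Rightarrow> ('i \<Rightarrow> 'a \<Rightarrow> real) \<Rightarrow> 'i set \<Rightarrow> ('i \<Rightarrow> 'a measure) \<Rightarrow> bool" where
  "is_constraint A a g I0 \<xi> \<longleftrightarrow>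
     (\<forall>i\<in>I0. \<xi> i \<in> radon_on (A i) \<and> ereal (a i) < pairing (\<lambda>x. ereal (g i x)) (\<xi> i))"

definition admissible ::
  "('a::{t2_space,second_countable_topology} \<times> 'a \<Rightarrow> ereal) \<Rightarrow> 'i set \<Rightarrow> 'i set \<Rightarrow> ('i \<Rightarrow> 'a set) \<Rightarrow> ('i \<Rightarrow> real)
   \<Rightarrow> ('i \<Rightarrow> 'a \<Rightarrow> real) \<Rightarrow> ('i \<Rightarrow> 'a \<Rightarrow> ereal) \<Rightarrow> 'i set \<Rightarrow> ('i \<Rightarrow> 'a measure) \<Rightarrow> ('i \<Rightarrow> 'a measure) set" where
  "admissible \<kappa> Ipos Ineg A a g f I0 \<xi> =
     {\<mu> \<in> finite_energy_vectors \<kappa> Ipos Ineg A.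
        (\<forall>i\<in>Ipos \<union> Ineg. pairing (\<lambda>x. ereal (g i x)) (\<mu> i) = ereal (a i))
        \<and> (\<forall>i\<in>I0. \<mu> i \<le> \<xi> i)
        \<and> finite_series (\<lambda>i. pairing (f i) (\<mu> i)) (Ipos \<union> Ineg)}"

definition gauss_inf ::
  "('a::{t2_space,second_countable_topology} \<times> 'a \<Rightarrow> ereal) \<Rightarrow> 'i set \<Rightarrow> 'i set \<Rightarrow> ('i \<Rightarrow> 'a set) \<Rightarrow> ('i \<Rightarrow> real)
   \<Rightarrow> ('i \<Rightarrow> 'a \<Rightarrow> real) \<Rightarrow> ('i \<Rightarrow> 'a \<Rightarrow> ereal) \<Rightarrow> 'i set \<Rightarrow> ('i \<Rightarrow> 'a measure) \<Rightarrow> ereal" where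
  "gauss_inf \<kappa> Ipos Ineg A a g f I0 \<xi> =
     (INF \<mu>\<in>admissible \<kappa> Ipos Ineg A a g f I0 \<xi>. ereal (gauss_functional \<kappa> Ipos Ineg f \<mu>))"

definition solutions ::
  "('a::{t2_space,second_countable_topology} \<times> 'a \<Rightarrow> ereal) \<Rightarrow> 'i set \<Rightarrow> 'i set \<Rightarrow> ('i \<Rightarrow> 'a set) \<Rightarrow> ('i \<Rightarrow> real)
   \<Rightarrow> ('i \<Rightarrow> 'a \<Rightarrow> real) \<Rightarrow> ('i \<Rightarrow> 'a \<Rightarrow> ereal) \<Rightarrow> 'i set \<Rightarrow> ('i \<Rightarrow> 'a measure) \<Rightarrow> ('i \<Rightarrow> 'a measure) set" where
  "solutions \<kappa> Ipos Ineg A a g f I0 \<xi> =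
     {\<mu> \<in> admissible \<kappa> Ipos Ineg A a g f I0 \<xi>.
        ereal (gauss_functional \<kappa> Ipos Ineg f \<mu>) = gauss_inf \<kappa> Ipos Ineg A a g f I0 \<xi>}"

subsection \<open>Minimizing nets\<close>

text \<open>
  A net is a triple \<open>(T, le, \<nu>)\<close> of a nonempty set \<open>T\<close> directed by the preorder \<open>le\<close> and a family \<open>\<nu>\<close>
  indexed by \<open>T\<close>. Nets over arbitrary directed sets are covered by leaving the type \<open>'t\<close> of the
  indices arbitrary.
\<close>

definition directed_set :: "'t set \<Rightarrow> ('t \<Rightarrow> 't \<Rightarrow> bool) \<Rightarrow> bool" where
  "directed_set T le \<longleftrightarrow> T \<noteq> {} \<and> reflp_on T le \<and> transp_on T le
     \<and> (\<forall>s\<in>T. \<forall>t\<in>T. \<exists>u\<in>T. le s u \<and> le t u)"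

definition tails :: "'t set \<Rightarrow> ('t \<Rightarrow> 't \<Rightarrow> bool) \<Rightarrow> 't filter" where
  "tails T le = (INF t\<in>T. principal {s\<in>T. le t s})"

lemma eventually_tails:
  assumes "directed_set T le"
  shows "eventually P (tails T le) \<longleftrightarrow> (\<exists>t\<in>T. \<forall>s\<in>T. le t s \<longrightarrow> P s)"
proof -
  have "eventually P (tails T le) \<longleftrightarrow> (\<exists>t\<in>T. eventually P (principal {s\<in>T. le t s}))"
    unfolding tails_def
  proof (rule eventually_INF_base)
    show "T \<noteq> {}" using assms by (simp add: directed_set_def)
  next
    fix s t assume st: "s \<in> T" "t \<in> T"
    then obtain u where u: "u \<in> T" "le s u" "le t u"
      using assms by (auto simp: directed_set_def)
    have tr: "transp_on T le" using assms by (simp add: directed_set_def)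
    have "{v\<in>T. le u v} \<subseteq> {v\<in>T. le s v} \<inter> {v\<in>T. le t v}"
      using transp_onD[OF tr st(1) u(1) _ u(2)] transp_onD[OF tr st(2) u(1) _ u(3)] by auto
    then show "\<exists>x\<in>T. principal {v\<in>T. le x v} \<le> inf (principal {v\<in>T. le s v}) (principal {v\<in>T. le t v})"
      using u(1) by (auto simp: inf_principal)
  qed
  then show ?thesis by (auto simp: eventually_principal)
qed

lemma frequently_tails:
  assumes "directed_set T le"
  shows "frequently P (tails T le) \<longleftrightarrow> (\<forall>t\<in>T. \<exists>s\<in>T. le t s \<and> P s)"
  unfolding frequently_def eventually_tails[OF assms] by blast

definition minimizing_nets ::
  "('a::{t2_space,second_countable_topology} \<times> 'a \<Rightarrow> ereal) \<Rightarrow> 'i set \<Rightarrow> 'i set \<Rightarrow> ('i \<Rightarrow> 'a set) \<Rightarrow> ('i \<Rightarrow> real)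
   \<Rightarrow> ('i \<Rightarrow> 'a \<Rightarrow> real) \<Rightarrow> ('i \<Rightarrow> 'a \<Rightarrow> ereal) \<Rightarrow> 'i set \<Rightarrow> ('i \<Rightarrow> 'a measure)
   \<Rightarrow> ('t set \<times> ('t \<Rightarrow> 't \<Rightarrow> bool) \<times> ('t \<Rightarrow> 'i \<Rightarrow> 'a measure)) set" where
  "minimizing_nets \<kappa> Ipos Ineg A a g f I0 \<xi> =
     {(T, le, \<nu>). directed_set T le
        \<and> (\<forall>t\<in>T. \<nu> t \<in> admissible \<kappa> Ipos Ineg A a g f I0 \<xi>)
        \<and> ((\<lambda>t. ereal (gauss_functional \<kappa> Ipos Ineg f (\<nu> t))) \<longlongrightarrow> gauss_inf \<kappa> Ipos Ineg A a g f I0 \<xi>) (tails T le)}"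

definition vague_cluster_points ::
  "'i set \<Rightarrow> 't set \<Rightarrow> ('t \<Rightarrow> 't \<Rightarrow> bool) \<Rightarrow> ('t \<Rightarrow> 'i \<Rightarrow> 'a::t2_space measure) \<Rightarrow> ('i \<Rightarrow> 'a measure) set" where
  "vague_cluster_points I T le \<nu> =
     {\<mu> \<in> topspace (vague_product I).
        \<forall>U. openin (vague_product I) U \<and> \<mu> \<in> U \<longrightarrow> (\<exists>\<^sub>F t in tails T le. \<nu> t \<in> U)}"

end

theory Submission
  imports Defs
begin

text \<open>
  Since a measure of finite energy charges no set of inner capacity zero, an admissible vector measure
  lives on the compact sets \<open>Ac i\<close> and its components have masses at most \<open>a i / inf g i\<close>, a summable
  family. Hence all admissible vector measures lie in one vaguely compact product set; compactness of
  each factor comes from Tychonoff's theorem for functionals and the Riesz representation theorem.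

  On this set the Gauss functional is vaguely lower semicontinuous. The interaction of plates of equal
  sign and the field terms are integrals of l.s.c. functions bounded below. The interaction of plates
  of opposite sign is even continuous: there the kernel is continuous on products of disjoint compact
  sets, and it is bounded uniformly in the plates because one of the two families is finite and the
  kernel vanishes at infinity. The side conditions also pass to the limit, a limit of finite energy
  being carried by \<open>A i\<close> again. So every cluster point of a minimizing net is a solution, and the set of
  solutions is closed in the compact set.
\<close>

subsection \<open>Riesz representation on a compact metric space\<close>

text \<open>The obstacle is that the energy is a double series with terms of both signs, which for
  the limit may a priori diverge or have infinite terms, so it cannot be passed to the limit as a
  whole. Adding the vaguely continuous quantity \<open>rest\<close> to the Gauss functional leaves a
  series of nonnegative terms. Its finite partial sums are bounded by \<open>G + rest\<close>, this
  bound survives the limit, and the supremum over finite index sets then yields at once the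
  convergence of the series for the limit, hence finite energy, and the estimate of its Gauss
  functional by the infimum. Summability of the masses is what makes \<open>rest\<close> continuous:
  its energy terms are dominated by a constant times \<open>mass i * mass j\<close>. Compactness of
  \<open>Ac i\<close> prevents loss of mass: for measures living there, vague convergence is
  convergence against all continuous functions, in particular against \<open>g i\<close> and 1.
  Convergence is expressed by filters, so that one limit argument serves minimizing sequences, nets
  over any directed set, and the closure of the set of solutions.\<close>

lemma compact_continuous_bound:
  fixes h :: "'b::topological_space \<Rightarrow> real"
  assumes "compact S" "continuous_on S h"
  shows "\<exists>B>0. \<forall>x\<in>S. \<bar>h x\<bar> \<le> B"
  using compact_imp_bounded[OF compact_continuous_image[OF assms(2,1)]] unfolding bounded_pos by auto

text \<open>Pointwise convergence makes the relatively open sets where \<open>f n x < e\<close>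
  cover K. Finitely many of them suffice, and monotonicity keeps every later function below e as
  well.\<close>

lemma Dini_decreasing_to_zero:
  fixes f :: "nat \<Rightarrow> 'a::t2_space \<Rightarrow> real"
  assumes K: "compact K" and cont: "\<And>n. continuous_on K (f n)"
    and dec: "\<And>n x. x \<in> K \<Longrightarrow> f (Suc n) x \<le> f n x"
    and lim: "\<And>x. x \<in> K \<Longrightarrow> (\<lambda>n. f n x) \<longlonglongrightarrow> 0" and e: "0 < e"
  shows "\<exists>N. \<forall>n\<ge>N. \<forall>x\<in>K. f n x < e"
proof -
  have mono: "f n x \<le> f m x" if "x \<in> K" "m \<le> n" for m n x
    using lift_Suc_antimono_le[of "\<lambda>n. f n x", OF dec[OF that(1)] that(2)] .
  have "\<exists>U. open U \<and> U \<inter> K = {x\<in>K. f n x < e}" for n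
  proof -
    have "openin (top_of_set K) (K \<inter> f n -` {..<e})"
      by (rule continuous_openin_preimage_gen[OF cont]) auto
    then obtain U where "open U" "K \<inter> f n -` {..<e} = K \<inter> U"
      unfolding openin_open by blast
    then show ?thesis by (intro exI[of _ U]) auto
  qed
  then obtain U where U: "\<And>n. open (U n)" "\<And>n. U n \<inter> K = {x\<in>K. f n x < e}"
    by metis
  have cover: "K \<subseteq> (\<Union>n\<in>UNIV. U n)"
  proof
    fix x assume x: "x \<in> K"
    have "eventually (\<lambda>n. f n x < e) sequentially"
      using order_tendstoD(2)[OF lim[OF x] e] .
    then obtain n where "f n x < e" by (auto simp: eventually_sequentially)
    then show "x \<in> (\<Union>n\<in>UNIV. U n)" using U(2)[of n] x by blast
  qed
  obtain D where D: "finite D" "K \<subseteq> (\<Union>n\<in>D. U n)"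
    using compactE_image[OF K, of UNIV U] U(1) cover by metis
  define N where "N = Max (insert 0 D)"
  show ?thesis
  proof (intro exI[of _ N] allI impI ballI)
    fix n x assume n: "N \<le> n" and x: "x \<in> K"
    then obtain k where k: "k \<in> D" "x \<in> U k" using D by auto
    then have "k \<le> n" using n D(1) unfolding N_def by (auto intro: order_trans[OF Max_ge])
    moreover have "f k x < e" using U(2)[of k] k x by blast
    ultimately show "f n x < e" using mono[OF x, of k n] by linarith
  qed
qed

text \<open>The k-th summand is the length of the part of [0, y] between k and k + 1. This slices a
  function into layers with values in [0, 1].\<close>

lemma sum_clamp:
  fixes y :: real
  assumes "0 \<le> y" "y \<le> real N"
  shows "(\<Sum>k<N. min 1 (max 0 (y - real k))) = y"
  using assms
proof (induction N)
  case (Suc N)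
  show ?case
  proof (cases "y \<le> real N")
    case True
    then show ?thesis using Suc by simp
  next
    case False
    have "(\<Sum>k<N. min 1 (max 0 (y - real k))) = (\<Sum>k<N. 1)"
    proof (rule sum.cong[OF refl])
      fix k assume "k \<in> {..<N}"
      then have "real k + 1 \<le> real N" by (simp add: Suc_leI nat_less_real_le)
      then show "min 1 (max 0 (y - real k)) = 1" using False by simp
    qed
    then show ?thesis using False Suc(3) by simp
  qed
qed simp

text \<open>Positivity is tested on K only, so L depends only on values on K although its arguments
  are functions on the whole space; no continuous extension from K is ever required. L is a total
  function on all real functions and is unrestricted on the discontinuous ones, which makes it a
  point of a full product space.\<close>

locale positive_functional =
  fixes K :: "'a::metric_space set" and L :: "('a \<Rightarrow> real) \<Rightarrow> real"
  assumes compact_K: "compact K"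
    and L_add: "continuous_on UNIV \<phi> \<Longrightarrow> continuous_on UNIV \<psi> \<Longrightarrow> L (\<lambda>x. \<phi> x + \<psi> x) = L \<phi> + L \<psi>"
    and L_scale: "continuous_on UNIV \<phi> \<Longrightarrow> L (\<lambda>x. c * \<phi> x) = c * L \<phi>"
    and L_nonneg: "continuous_on UNIV \<phi> \<Longrightarrow> (\<And>x. x \<in> K \<Longrightarrow> 0 \<le> \<phi> x) \<Longrightarrow> 0 \<le> L \<phi>"
begin

lemma L_diff:
  assumes "continuous_on UNIV \<phi>" "continuous_on UNIV \<psi>"
  shows "L (\<lambda>x. \<phi> x - \<psi> x) = L \<phi> - L \<psi>"
  using L_add[of \<phi> "\<lambda>x. -1 * \<psi> x"] L_scale[of \<psi> "-1"] assms
  by (simp add: continuous_on_minus)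

lemma L_mono:
  assumes "continuous_on UNIV \<phi>" "continuous_on UNIV \<psi>" "\<And>x. x \<in> K \<Longrightarrow> \<phi> x \<le> \<psi> x"
  shows "L \<phi> \<le> L \<psi>"
  using L_nonneg[of "\<lambda>x. \<psi> x - \<phi> x"] L_diff[of \<psi> \<phi>] assms by (simp add: continuous_on_diff)

lemma L_cong:
  assumes "continuous_on UNIV \<phi>" "continuous_on UNIV \<psi>" "\<And>x. x \<in> K \<Longrightarrow> \<phi> x = \<psi> x"
  shows "L \<phi> = L \<psi>"
  using L_mono[of \<phi> \<psi>] L_mono[of \<psi> \<phi>] assms by force

lemma L_zero [simp]: "L (\<lambda>x. 0) = 0"
  using L_scale[of "\<lambda>x. 0" 0] by simp

lemma L_const: "L (\<lambda>x. c) = c * L (\<lambda>x. 1)"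
  using L_scale[of "\<lambda>x. 1" c] by simp

lemma L_sum:
  fixes n :: nat
  assumes "\<And>k. k < n \<Longrightarrow> continuous_on UNIV (f k)"
  shows "L (\<lambda>x. \<Sum>k<n. f k x) = (\<Sum>k<n. L (f k))"
  using assms
proof (induction n)
  case (Suc n)
  have "continuous_on UNIV (\<lambda>x. \<Sum>k<n. f k x)" "continuous_on UNIV (f n)"
    using Suc.prems by (auto intro!: continuous_on_sum)
  then show ?case
    using L_add[of "\<lambda>x. \<Sum>k<n. f k x" "f n"] Suc by simp
qed simp

text \<open>The remainders \<open>g - ?S n\<close> are continuous and decrease to 0, hence uniformly
  on K by Dini, and positivity bounds L of a remainder below e by \<open>e * L 1\<close>.\<close>

lemma L_sums:
  assumes f: "\<And>n. continuous_on UNIV (f n)" "\<And>n x. 0 \<le> f n x"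
    and g: "continuous_on UNIV g" and s: "\<And>x. (\<lambda>n. f n x) sums g x"
  shows "(\<lambda>n. L (f n)) sums L g"
proof -
  let ?S = "\<lambda>n x. \<Sum>k<n. f k x"
  have S: "continuous_on UNIV (?S n)" for n using f(1) by (simp add: continuous_on_sum)
  have c: "continuous_on UNIV (\<lambda>x. g x - ?S n x)" for n using S g by (simp add: continuous_on_diff)
  have pos: "0 \<le> g x - ?S n x" for n x
    using sum_le_suminf[of "\<lambda>k. f k x" "{..<n}"] s[of x] f(2) by (simp add: sums_iff)
  have L1: "0 \<le> L (\<lambda>x. 1)" by (rule L_nonneg) auto
  have "(\<lambda>n. L g - L (?S n)) \<longlonglongrightarrow> 0"
  proof (rule LIMSEQ_I)
    fix r :: real assume r: "0 < r"
    \<comment> \<open>Chosen so that \<open>e * L 1\<close> is at most r / 2; the summand 1 covers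
      the case \<open>L 1 = 0\<close>.\<close>
    define e where "e = r / (2 * (1 + L (\<lambda>x. 1)))"
    have e: "0 < e" using r L1 by (simp add: e_def)
    have "\<exists>N. \<forall>n\<ge>N. \<forall>x\<in>K. g x - ?S n x < e"
    proof (rule Dini_decreasing_to_zero[OF compact_K _ _ _ e])
      show "continuous_on K (\<lambda>x. g x - ?S n x)" for n
        using continuous_on_subset[OF c] by blast
      show "g x - ?S (Suc n) x \<le> g x - ?S n x" for n x using f(2) by simp
      have "(\<lambda>n. g x - ?S n x) \<longlonglongrightarrow> g x - g x" for x
        by (intro tendsto_intros) (use s[of x] in \<open>simp add: sums_def\<close>)
      then show "(\<lambda>n. g x - ?S n x) \<longlonglongrightarrow> 0" for x by simp
    qed
    then obtain N where N: "\<And>n x. N \<le> n \<Longrightarrow> x \<in> K \<Longrightarrow> g x - ?S n x < e" by blast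
    show "\<exists>N. \<forall>n\<ge>N. norm (L g - L (?S n) - 0) < r"
    proof (intro exI[of _ N] allI impI)
      fix n assume n: "N \<le> n"
      have "L (\<lambda>x. g x - ?S n x) \<le> L (\<lambda>x. e)"
        by (rule L_mono) (use c N[OF n] in \<open>auto intro: less_imp_le\<close>)
      also have "\<dots> = e * L (\<lambda>x. 1)" by (rule L_const)
      also have "\<dots> \<le> r / 2" using L1 r by (simp add: e_def field_simps)
      finally have "L (\<lambda>x. g x - ?S n x) < r" using r by simp
      moreover have "0 \<le> L (\<lambda>x. g x - ?S n x)" using pos c by (intro L_nonneg) auto
      ultimately show "norm (L g - L (?S n) - 0) < r" using L_diff[OF g S] by simp
    qed
  qed
  then have "(\<lambda>n. L g - (L g - L (?S n))) \<longlonglongrightarrow> L g - 0" by (intro tendsto_intros)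
  then show ?thesis using L_sum[of _ f] f(1) by (simp add: sums_def)
qed

text \<open>
  The functional is extended to a measure on the product with the real line: the half-open region
  between two continuous graphs gets the value of \<open>L\<close> on the length of its vertical sections. Countable
  additivity of length holds on every section, and Dini's theorem lifts it through \<open>L\<close>. The
  representing measure is the trace on the strip \<open>[0, 1)\<close>.
\<close>

definition slab :: "('a \<Rightarrow> real) \<times> ('a \<Rightarrow> real) \<Rightarrow> ('a \<times> real) set" where
  "slab = (\<lambda>(\<phi>, \<psi>). {(x, t). \<phi> x \<le> t \<and> t < \<psi> x})"

definition slabs :: "(('a \<Rightarrow> real) \<times> ('a \<Rightarrow> real)) set" where
  "slabs = {(\<phi>, \<psi>). continuous_on UNIV \<phi> \<and> continuous_on UNIV \<psi>}"

definition slab_measure :: "('a \<times> real) measure" where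
  "slab_measure = extend_measure UNIV slabs slab (\<lambda>(\<phi>, \<psi>). ennreal (L (\<lambda>x. max 0 (\<psi> x - \<phi> x))))"

lemma slab_semiring: "semiring_of_sets UNIV (slab ` slabs)"
proof
  show "{} \<in> slab ` slabs"
    by (rule image_eqI[of _ _ "(\<lambda>x. 0, \<lambda>x. 0)"]) (auto simp: slab_def slabs_def)
next
  fix a b assume "a \<in> slab ` slabs" "b \<in> slab ` slabs"
  then obtain \<phi> \<psi> \<phi>' \<psi>' where a: "a = slab (\<phi>, \<psi>)" and b: "b = slab (\<phi>', \<psi>')"
    and c: "continuous_on UNIV \<phi>" "continuous_on UNIV \<psi>" "continuous_on UNIV \<phi>'" "continuous_on UNIV \<psi>'"
    by (auto simp: slabs_def)
  show "a \<inter> b \<in> slab ` slabs"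
    by (rule image_eqI[of _ _ "(\<lambda>x. max (\<phi> x) (\<phi>' x), \<lambda>x. min (\<psi> x) (\<psi>' x))"])
      (auto simp: slab_def slabs_def a b intro!: continuous_intros c)
  \<comment> \<open>The part of a below b and the part of a above b. Where b has an empty section
    the upper graph of b may lie below the lower one; the inner \<open>max\<close> keeps the two
    parts disjoint there.\<close>
  let ?C = "{slab (\<phi>, \<lambda>x. min (\<psi> x) (\<phi>' x)), slab (\<lambda>x. max (\<phi> x) (max (\<psi>' x) (\<phi>' x)), \<psi>)}"
  have "slab (\<phi>, \<lambda>x. min (\<psi> x) (\<phi>' x)) \<in> slab ` slabs"
    "slab (\<lambda>x. max (\<phi> x) (max (\<psi>' x) (\<phi>' x)), \<psi>) \<in> slab ` slabs"
    by (auto simp: slabs_def intro!: imageI continuous_intros c)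
  then have "?C \<subseteq> slab ` slabs" by simp
  moreover have "disjoint ?C" by (auto simp: disjoint_def slab_def)
  moreover have "a - b = \<Union>?C" by (auto simp: a b slab_def)
  ultimately show "\<exists>C\<subseteq>slab ` slabs. finite C \<and> disjoint C \<and> a - b = \<Union>C"
    by (intro exI[of _ ?C]) auto
qed auto

lemma section_slab: "emeasure lborel {t. (x, t) \<in> slab (\<phi>, \<psi>)} = ennreal (max 0 (\<psi> x - \<phi> x))"
proof -
  have "{t. (x, t) \<in> slab (\<phi>, \<psi>)} = {\<phi> x..<\<psi> x}" by (auto simp: slab_def)
  then show ?thesis by (simp add: max_def)
qed

lemma emeasure_slab:
  assumes "continuous_on UNIV \<phi>" "continuous_on UNIV \<psi>"
  shows "emeasure slab_measure (slab (\<phi>, \<psi>)) = ennreal (L (\<lambda>x. max 0 (\<psi> x - \<phi> x)))"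
proof -
  \<comment> \<open>A slab does not determine its two graphs where its section is empty. It does
    determine the length of each section, so the value assigned to it is well defined.\<close>
  have eq: "max 0 (\<psi> x - \<phi> x) = max 0 (\<psi>' x - \<phi>' x)" if "slab (\<phi>, \<psi>) = slab (\<phi>', \<psi>')" for \<phi> \<psi> \<phi>' \<psi>' :: "'a \<Rightarrow> real" and x
    using section_slab[of x \<phi> \<psi>] section_slab[of x \<phi>' \<psi>'] that
    by (simp add: ennreal_inj)
  have "emeasure slab_measure (slab (\<phi>, \<psi>)) = (\<lambda>(\<phi>, \<psi>). ennreal (L (\<lambda>x. max 0 (\<psi> x - \<phi> x)))) (\<phi>, \<psi>)"
  proof (rule extend_measure_caratheodory[OF slab_measure_def _ slab_semiring])
    show "(\<phi>, \<psi>) \<in> slabs" using assms by (simp add: slabs_def)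
  next
    fix i :: "('a \<Rightarrow> real) \<times> ('a \<Rightarrow> real)" assume "slab i = {}"
    then have "slab (fst i, snd i) = slab (\<lambda>x. 0, \<lambda>x. 0)" by (simp add: slab_def)
    from eq[OF this] show "(\<lambda>(\<phi>, \<psi>). ennreal (L (\<lambda>x. max 0 (\<psi> x - \<phi> x)))) i = 0"
      by (simp add: case_prod_beta)
  next
    fix i j :: "('a \<Rightarrow> real) \<times> ('a \<Rightarrow> real)" assume "slab i = slab j"
    then have "slab (fst i, snd i) = slab (fst j, snd j)" by simp
    from eq[OF this]
    show "(\<lambda>(\<phi>, \<psi>). ennreal (L (\<lambda>x. max 0 (\<psi> x - \<phi> x)))) i = (\<lambda>(\<phi>, \<psi>). ennreal (L (\<lambda>x. max 0 (\<psi> x - \<phi> x)))) j"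
      by (simp add: case_prod_beta)
  next
    fix A :: "nat \<Rightarrow> ('a \<Rightarrow> real) \<times> ('a \<Rightarrow> real)" and j
    assume A: "A \<in> UNIV \<rightarrow> slabs" and j: "j \<in> slabs" and disj: "disjoint_family (slab \<circ> A)"
      and un: "(\<Union>i. slab (A i)) = slab j"
    define p where "p n x = max 0 (snd (A n) x - fst (A n) x)" for n x
    define q where "q x = max 0 (snd j x - fst j x)" for x
    have Ac: "continuous_on UNIV (fst (A n))" "continuous_on UNIV (snd (A n))" for n
      using funcset_mem[OF A, of n] by (auto simp: slabs_def case_prod_beta)
    have pc: "continuous_on UNIV (p n)" for n
      unfolding p_def by (intro continuous_intros Ac)
    have qc: "continuous_on UNIV q"
      using j unfolding q_def by (auto simp: slabs_def case_prod_beta intro!: continuous_intros)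
    have "(\<lambda>n. ennreal (p n x)) sums ennreal (q x)" for x
    proof -
      let ?B = "\<lambda>n. {t. (x, t) \<in> slab (A n)}"
      have B: "?B n = {fst (A n) x..<snd (A n) x}" for n by (auto simp: slab_def case_prod_beta)
      have "disjoint_family ?B" using disj by (fastforce simp: disjoint_family_on_def)
      then have "(\<lambda>n. emeasure lborel (?B n)) sums emeasure lborel (\<Union>n. ?B n)"
        by (intro suminf_emeasure[THEN sums_iff[THEN iffD2, OF conjI[OF summableI]]]) (auto simp: B)
      moreover have "(\<Union>n. ?B n) = {t. (x, t) \<in> slab j}" using un by auto
      ultimately show ?thesis
        using section_slab[of x "fst (A n)" "snd (A n)" for n] section_slab[of x "fst j" "snd j"]
        by (simp add: p_def q_def)
    qed
    then have "(\<lambda>n. p n x) sums q x" for x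
      by (subst (asm) sums_ennreal) (auto simp: p_def q_def)
    then have "(\<lambda>n. L (p n)) sums L q"
      by (intro L_sums pc qc) (auto simp: p_def)
    then have "(\<lambda>n. ennreal (L (p n))) sums ennreal (L q)"
      by (subst sums_ennreal) (auto intro!: L_nonneg pc qc simp: p_def q_def)
    then show "(\<Sum>n. (\<lambda>(\<phi>, \<psi>). ennreal (L (\<lambda>x. max 0 (\<psi> x - \<phi> x)))) (A n)) =
        (\<lambda>(\<phi>, \<psi>). ennreal (L (\<lambda>x. max 0 (\<psi> x - \<phi> x)))) j"
      by (simp add: sums_iff p_def[abs_def] q_def[abs_def] case_prod_beta)
  qed simp
  then show ?thesis by simp
qed

section \<open>From the slab measure to a Borel measure on the base space\<close>

lemma space_slab_measure [simp]: "space slab_measure = UNIV"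
  unfolding slab_measure_def by (rule space_extend_measure) simp

lemma slab_in_sets:
  assumes "continuous_on UNIV \<phi>" "continuous_on UNIV \<psi>"
  shows "slab (\<phi>, \<psi>) \<in> sets slab_measure"
  using assms unfolding slab_measure_def
  by (subst sets_extend_measure) (auto simp: slabs_def intro!: sigma_sets.Basic imageI)

text \<open>A ramp of slope n, which increases to the indicator of an open U. The distance to the
  empty set is 0 by convention, so \<open>UNIV\<close> needs a case of its own.\<close>

definition bump :: "'a set \<Rightarrow> nat \<Rightarrow> 'a \<Rightarrow> real" where
  "bump U n x = (if U = UNIV then 1 else min 1 (real n * infdist x (- U)))"

lemma continuous_bump: "continuous_on UNIV (bump U n)"
  unfolding bump_def by (cases "U = UNIV") (auto intro!: continuous_intros)

lemma bump_bounds: "0 \<le> bump U n x" "bump U n x \<le> 1"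
  by (auto simp: bump_def infdist_nonneg)

lemma bump_zero: "x \<notin> U \<Longrightarrow> bump U n x = 0"
  by (auto simp: bump_def)

text \<open>A point of U has positive distance to the closed complement, so a steep enough ramp
  rises above any given t < 1. Hence cylinders over open sets are countable unions of slabs.\<close>

lemma open_times_unit:
  assumes "open U"
  shows "U \<times> {0..<1} = (\<Union>n. slab (\<lambda>x. 0, bump U n))"
proof (cases "U = UNIV")
  case False
  have "\<exists>n. t < bump U n x" if "x \<in> U" "t < 1" for x t
  proof -
    have "closed (- U)" "- U \<noteq> {}" using assms False by auto
    then have "infdist x (- U) > 0"
      using that in_closed_iff_infdist_zero[of "- U" x] infdist_nonneg[of x "- U"] by auto
    then obtain n where "1 < real n * infdist x (- U)" using reals_Archimedean3 by blast
    then show ?thesis using that False by (intro exI[of _ n]) (simp add: bump_def)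
  qed
  moreover have "x \<in> U" if "0 \<le> t" "t < bump U n x" for x t n
    using that bump_zero[of x U n] by (cases "x \<in> U") auto
  moreover have "t < 1" if "t < bump U n x" for x t n
    using that bump_bounds(2)[of U n x] by linarith
  ultimately show ?thesis by (auto simp: slab_def)
qed (auto simp: slab_def bump_def)

lemma open_times_unit_sets: "open U \<Longrightarrow> U \<times> {0..<1} \<in> sets slab_measure"
  unfolding open_times_unit
  by (intro sets.countable_UN) (auto intro!: slab_in_sets continuous_bump)

definition riesz_measure :: "'a measure" where
  "riesz_measure = distr (restrict_space slab_measure (UNIV \<times> {0..<1})) borel fst"

lemma sets_riesz_measure [simp]: "sets riesz_measure = sets borel"
  by (simp add: riesz_measure_def)

lemma borel_measurable_riesz_measure [simp]:
  "f \<in> borel_measurable riesz_measure \<longleftrightarrow> f \<in> borel_measurable borel"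
  by (simp add: measurable_cong_sets[OF sets_riesz_measure refl])

lemma space_riesz_measure [simp]: "space riesz_measure = UNIV"
  by (simp add: riesz_measure_def)

lemma measurable_fst_slab:
  "fst \<in> measurable (restrict_space slab_measure (UNIV \<times> {0..<1})) borel"
proof (rule borel_measurableI)
  fix U :: "'a set" assume U: "open U"
  have "fst -` U \<inter> space (restrict_space slab_measure (UNIV \<times> {0..<1})) = U \<times> {0..<1::real}"
    by (auto simp: space_restrict_space)
  then show "fst -` U \<inter> space (restrict_space slab_measure (UNIV \<times> {0..<1}))
      \<in> sets (restrict_space slab_measure (UNIV \<times> {0..<1}))"
    using open_times_unit_sets[OF U] open_times_unit_sets[OF open_UNIV]
    by (simp add: sets_restrict_space_iff) blast
qed

lemma emeasure_riesz_measure: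
  assumes "B \<in> sets borel"
  shows "emeasure riesz_measure B = emeasure slab_measure (B \<times> {0..<1})"
    and "B \<times> {0..<1} \<in> sets slab_measure"
proof -
  have *: "fst -` B \<inter> space (restrict_space slab_measure (UNIV \<times> {0..<1})) = B \<times> {0..<1::real}"
    by (auto simp: space_restrict_space)
  have u: "UNIV \<times> {0..<1} \<inter> space slab_measure \<in> sets slab_measure"
    using open_times_unit_sets[OF open_UNIV] by simp
  show "B \<times> {0..<1} \<in> sets slab_measure"
    using measurable_sets[OF measurable_fst_slab assms] unfolding *
    by (simp add: sets_restrict_space_iff[OF u])
  show "emeasure riesz_measure B = emeasure slab_measure (B \<times> {0..<1})"
    unfolding riesz_measure_def emeasure_distr[OF measurable_fst_slab assms] *
    by (rule emeasure_restrict_space[OF u]) auto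
qed

lemma emeasure_slab_zero:
  assumes "continuous_on UNIV \<phi>" "\<And>x. 0 \<le> \<phi> x"
  shows "emeasure slab_measure (slab (\<lambda>x. 0, \<phi>)) = ennreal (L \<phi>)"
  using emeasure_slab[of "\<lambda>x. 0" \<phi>] assms by (simp add: max_def)

lemma emeasure_riesz_UNIV: "emeasure riesz_measure UNIV = ennreal (L (\<lambda>x. 1))"
proof -
  have "UNIV \<times> {0..<1} = slab (\<lambda>x::'a. 0, \<lambda>x. 1)" by (auto simp: slab_def)
  then show ?thesis
    using emeasure_riesz_measure(1)[of UNIV] emeasure_slab_zero[of "\<lambda>x. 1"] by simp
qed

lemma finite_riesz: "finite_measure riesz_measure"
  by (rule finite_measureI) (simp add: emeasure_riesz_UNIV)

lemma measure_riesz_UNIV: "measure riesz_measure UNIV = L (\<lambda>x. 1)"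
  by (simp add: measure_def emeasure_riesz_UNIV L_nonneg)

text \<open>The ramps that exhaust the open set \<open>- K\<close> vanish on K, and L sees nothing
  outside K.\<close>

lemma emeasure_riesz_outside: "emeasure riesz_measure (- K) = 0"
proof -
  have oK: "open (- K)" using compact_imp_closed[OF compact_K] by (simp add: open_Compl)
  have "L (bump (- K) n) = 0" for n
    using L_cong[of "bump (- K) n" "\<lambda>x. 0"] continuous_bump[of "- K" n] bump_zero[of _ "- K" n]
    by simp
  then have "emeasure slab_measure (slab (\<lambda>x. 0, bump (- K) n)) = 0" for n
    using emeasure_slab_zero[OF continuous_bump bump_bounds(1)] by simp
  then have "emeasure slab_measure (\<Union>n. slab (\<lambda>x. 0, bump (- K) n)) = 0"
    by (intro emeasure_UN_eq_0) (auto intro!: slab_in_sets continuous_bump)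
  moreover have "- K \<in> sets borel" using oK by simp
  ultimately show ?thesis
    using emeasure_riesz_measure(1)[of "- K"] open_times_unit[OF oK] by metis
qed

text \<open>The region under the graph of u has slab measure \<open>L u\<close>; it contains the
  unit cylinder over R and lies in the unit cylinder over S.\<close>

lemma L_between_measures:
  assumes c: "continuous_on UNIV u" and b: "\<And>x. 0 \<le> u x" "\<And>x. u x \<le> 1"
    and S: "S \<in> sets borel" "\<And>x. u x \<noteq> 0 \<Longrightarrow> x \<in> S"
    and R: "R \<in> sets borel" "\<And>x. x \<in> R \<Longrightarrow> u x = 1"
  shows "measure riesz_measure R \<le> L u" "L u \<le> measure riesz_measure S"
proof -
  interpret finite_measure riesz_measure by (rule finite_riesz)
  have Lu: "emeasure slab_measure (slab (\<lambda>x. 0, u)) = ennreal (L u)"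
    by (rule emeasure_slab_zero[OF c b(1)])
  have L0: "0 \<le> L u" using b by (intro L_nonneg c) auto
  have "x \<in> S \<and> t < 1" if "0 \<le> t" "t < u x" for x t
    using S(2)[of x] b(2)[of x] that by auto
  then have "slab (\<lambda>x. 0, u) \<subseteq> S \<times> {0..<1}"
    by (auto simp: slab_def)
  then have "ennreal (L u) \<le> emeasure riesz_measure S"
    unfolding emeasure_riesz_measure(1)[OF S(1)] Lu[symmetric]
    by (intro emeasure_mono emeasure_riesz_measure(2) S)
  then show "L u \<le> measure riesz_measure S"
    by (simp add: emeasure_eq_measure)
  have "R \<times> {0..<1} \<subseteq> slab (\<lambda>x. 0, u)" using R(2) by (auto simp: slab_def)
  then have "emeasure riesz_measure R \<le> ennreal (L u)"
    unfolding emeasure_riesz_measure(1)[OF R(1)] Lu[symmetric]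
    by (intro emeasure_mono slab_in_sets c) auto
  then show "measure riesz_measure R \<le> L u"
    using L0 by (simp add: emeasure_eq_measure)
qed

text \<open>The same two bounds as for \<open>L u\<close>, so that for R contained in S the integral
  and \<open>L u\<close> differ by at most the measure of \<open>S - R\<close>.\<close>

lemma integral_between_measures:
  assumes c: "u \<in> borel_measurable borel" and b: "\<And>x. 0 \<le> u x" "\<And>x. u x \<le> (1::real)"
    and S: "S \<in> sets borel" "\<And>x. u x \<noteq> 0 \<Longrightarrow> x \<in> S"
    and R: "R \<in> sets borel" "\<And>x. x \<in> R \<Longrightarrow> u x = 1"
  shows "measure riesz_measure R \<le> (\<integral>x. u x \<partial>riesz_measure)"
    "(\<integral>x. u x \<partial>riesz_measure) \<le> measure riesz_measure S"
proof -
  interpret finite_measure riesz_measure by (rule finite_riesz)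
  have iu: "integrable riesz_measure u"
    by (rule integrable_const_bound[of _ 1]) (use b c in auto)
  have iS: "integrable riesz_measure (indicator S :: 'a \<Rightarrow> real)"
    "integrable riesz_measure (indicator R :: 'a \<Rightarrow> real)"
    using S R by (auto simp: emeasure_eq_measure)
  have "(\<integral>x. indicator R x \<partial>riesz_measure) \<le> (\<integral>x. u x \<partial>riesz_measure)"
    by (rule integral_mono[OF iS(2) iu]) (use b R in \<open>auto simp: indicator_def\<close>)
  then show "measure riesz_measure R \<le> (\<integral>x. u x \<partial>riesz_measure)" by simp
  have "(\<integral>x. u x \<partial>riesz_measure) \<le> (\<integral>x. indicator S x \<partial>riesz_measure)"
  proof (rule integral_mono[OF iu iS(1)])
    show "u x \<le> indicator S x" for x
      using b(2)[of x] S(2)[of x] by (cases "u x = 0") auto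
  qed
  then show "(\<integral>x. u x \<partial>riesz_measure) \<le> measure riesz_measure S" by simp
qed

text \<open>Slice \<open>N * \<phi>\<close> into N unit layers. On layer k the functional and the
  integral differ by at most the measure of the set where \<open>N * \<phi>\<close> lies strictly
  between k and k + 1. These sets are disjoint, so N times the error never exceeds the total mass,
  whatever N is.\<close>

lemma integral_riesz_unit:
  assumes c: "continuous_on UNIV \<phi>" and b: "\<And>x. 0 \<le> \<phi> x" "\<And>x. \<phi> x \<le> 1"
  shows "(\<integral>x. \<phi> x \<partial>riesz_measure) = L \<phi>"
proof -
  interpret finite_measure riesz_measure by (rule finite_riesz)
  let ?D = "\<bar>L \<phi> - (\<integral>x. \<phi> x \<partial>riesz_measure)\<bar>"
  have m: "\<phi> \<in> borel_measurable borel" by (rule borel_measurable_continuous_onI[OF c])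
  have bound: "real N * ?D \<le> measure riesz_measure UNIV" for N :: nat
  proof -
    define u where "u k x = min 1 (max 0 (real N * \<phi> x - real k))" for k :: nat and x
    define S where "S k = {x. real k < real N * \<phi> x}" for k :: nat
    define R where "R k = {x. real k + 1 \<le> real N * \<phi> x}" for k :: nat
    have uc: "continuous_on UNIV (u k)" for k unfolding u_def by (intro continuous_intros c)
    have um: "u k \<in> borel_measurable borel" for k by (rule borel_measurable_continuous_onI[OF uc])
    have ub: "0 \<le> u k x" "u k x \<le> 1" for k x by (auto simp: u_def)
    have Sm: "S k \<in> sets borel" and Rm: "R k \<in> sets borel" for k
      unfolding S_def R_def by (use m in measurable)
    have Su: "u k x \<noteq> 0 \<Longrightarrow> x \<in> S k" and Ru: "x \<in> R k \<Longrightarrow> u k x = 1" for k x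
      by (auto simp: u_def S_def R_def min_def max_def split: if_splits)
    have sum_u: "(\<Sum>k<N. u k x) = real N * \<phi> x" for x
      unfolding u_def by (rule sum_clamp) (use b[of x] in \<open>auto intro: mult_left_le\<close>)
    have iu: "integrable riesz_measure (u k)" for k
      by (rule integrable_const_bound[of _ 1]) (use ub um in auto)
    have "L (\<lambda>x. \<Sum>k<N. u k x) = real N * L \<phi>" using L_scale[OF c] by (simp add: sum_u)
    then have 1: "real N * L \<phi> = (\<Sum>k<N. L (u k))" using L_sum[of N u] uc by simp
    have 2: "real N * (\<integral>x. \<phi> x \<partial>riesz_measure) = (\<Sum>k<N. \<integral>x. u k x \<partial>riesz_measure)"
      using iu by (simp add: sum_u flip: Bochner_Integration.integral_sum)
    have "real N * ?D = \<bar>\<Sum>k<N. L (u k) - (\<integral>x. u k x \<partial>riesz_measure)\<bar>"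
      by (simp add: sum_subtractf 1[symmetric] 2[symmetric] abs_mult flip: right_diff_distrib)
    also have "\<dots> \<le> (\<Sum>k<N. \<bar>L (u k) - (\<integral>x. u k x \<partial>riesz_measure)\<bar>)" by (rule sum_abs)
    also have "\<dots> \<le> (\<Sum>k<N. measure riesz_measure (S k - R k))"
    proof (rule sum_mono)
      fix k
      have "R k \<subseteq> S k" by (auto simp: R_def S_def)
      then have "measure riesz_measure (S k - R k) = measure riesz_measure (S k) - measure riesz_measure (R k)"
        using Sm[of k] Rm[of k] by (intro finite_measure_Diff) auto
      then show "\<bar>L (u k) - (\<integral>x. u k x \<partial>riesz_measure)\<bar> \<le> measure riesz_measure (S k - R k)"
        using L_between_measures[of "u k" "S k" "R k", OF uc ub Sm Su Rm Ru]
          integral_between_measures[of "u k" "S k" "R k", OF um ub Sm Su Rm Ru]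
        by (simp add: abs_le_iff)
    qed
    also have "\<dots> = measure riesz_measure (\<Union>k<N. S k - R k)"
    proof (rule finite_measure_finite_Union[symmetric])
      show "disjoint_family_on (\<lambda>k. S k - R k) {..<N}"
      proof -
        have "(S k - R k) \<inter> (S l - R l) = {}" if "k < l" for k l
          using that by (force simp: S_def R_def nat_less_real_le)
        then show ?thesis unfolding disjoint_family_on_def by (metis Int_commute linorder_neqE_nat)
      qed
    qed (use Sm Rm in auto)
    also have "\<dots> \<le> measure riesz_measure UNIV"
      by (rule finite_measure_mono) auto
    finally show ?thesis .
  qed
  have "?D = 0"
  proof (rule ccontr)
    assume "?D \<noteq> 0"
    then have "0 < ?D" by simp
    then obtain N where "measure riesz_measure UNIV < real N * ?D" using reals_Archimedean3 by blast
    then show False using bound[of N] by simp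
  qed
  then show ?thesis by simp
qed

text \<open>An affine change of values maps \<phi> into [0, 1] on K. Clamping destroys the relation
  only off K, which neither L nor the measure notices.\<close>

lemma integral_riesz:
  assumes c: "continuous_on UNIV \<phi>"
  shows "(\<integral>x. \<phi> x \<partial>riesz_measure) = L \<phi>"
proof -
  interpret finite_measure riesz_measure by (rule finite_riesz)
  obtain B where B: "0 < B" "\<And>x. x \<in> K \<Longrightarrow> \<bar>\<phi> x\<bar> \<le> B"
    using compact_continuous_bound[OF compact_K continuous_on_subset[OF c subset_UNIV]] by blast
  define \<psi> where "\<psi> x = min 1 (max 0 ((\<phi> x + B) / (2 * B)))" for x
  have pc: "continuous_on UNIV \<psi>" unfolding \<psi>_def using B(1) by (intro continuous_intros c) auto
  have pb: "0 \<le> \<psi> x" "\<psi> x \<le> 1" for x by (auto simp: \<psi>_def)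
  have eq: "\<phi> x = 2 * B * \<psi> x - B" if "x \<in> K" for x
    using B(1) B(2)[OF that] by (auto simp: \<psi>_def min_def max_def field_simps)
  have i: "integrable riesz_measure \<psi>"
    by (rule integrable_const_bound[of _ 1]) (use pb borel_measurable_continuous_onI[OF pc] in auto)
  have "AE x in riesz_measure. x \<in> K"
    using emeasure_riesz_outside compact_imp_closed[OF compact_K]
    by (intro AE_I[of _ _ "- K"]) auto
  then have "AE x in riesz_measure. \<phi> x = 2 * B * \<psi> x - B"
    by eventually_elim (rule eq)
  then have "(\<integral>x. \<phi> x \<partial>riesz_measure) = (\<integral>x. 2 * B * \<psi> x - B \<partial>riesz_measure)"
    using borel_measurable_continuous_onI[OF c] borel_measurable_continuous_onI[OF pc]
    by (intro integral_cong_AE) auto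
  also have "\<dots> = 2 * B * L \<psi> - B * L (\<lambda>x. 1)"
    using i integral_riesz_unit[OF pc pb] by (simp add: measure_riesz_UNIV)
  also have "\<dots> = L (\<lambda>x. 2 * B * \<psi> x - B)"
    using L_diff[of "\<lambda>x. 2 * B * \<psi> x" "\<lambda>x. B"] L_scale[OF pc, of "2 * B"] L_const[of B] pc
    by (simp add: continuous_on_mult_left)
  also have "\<dots> = L \<phi>"
    by (rule L_cong) (use eq pc c in \<open>auto intro!: continuous_intros\<close>)
  finally show ?thesis .
qed

end

subsection \<open>Radon measures on metric spaces\<close>

lemma radon_sets: "radon \<nu> \<Longrightarrow> sets \<nu> = sets borel"
  unfolding radon_def by (elim conjE)

lemma radon_space: "radon \<nu> \<Longrightarrow> space \<nu> = UNIV"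
  using sets_eq_imp_space_eq[of \<nu> borel] radon_sets[of \<nu>] by simp

lemma radon_compact_finite: "radon \<nu> \<Longrightarrow> compact K \<Longrightarrow> emeasure \<nu> K < \<infinity>"
  unfolding radon_def by (elim conjE) (erule allE, erule (1) mp)

lemma radon_outer:
  "radon \<nu> \<Longrightarrow> B \<in> sets borel \<Longrightarrow> emeasure \<nu> B = (INF U\<in>{U. open U \<and> B \<subseteq> U}. emeasure \<nu> U)"
  unfolding radon_def by (elim conjE) (erule (1) bspec)

lemma radon_inner:
  "radon \<nu> \<Longrightarrow> open U \<Longrightarrow> emeasure \<nu> U = (SUP K\<in>{K. compact K \<and> K \<subseteq> U}. emeasure \<nu> K)"
  unfolding radon_def by (elim conjE) (erule allE, erule (1) mp)

lemma radon_measurable: "radon \<nu> \<Longrightarrow> f \<in> borel_measurable borel \<Longrightarrow> f \<in> borel_measurable \<nu>"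
  by (simp add: measurable_cong_sets[OF radon_sets refl])

lemma emeasure_compact_complement:
  fixes \<nu> :: "'a::t2_space measure"
  assumes "radon \<nu>" "compact K" "emeasure \<nu> (- K) = 0"
  shows "emeasure \<nu> UNIV = emeasure \<nu> K" "finite_measure \<nu>" "AE x in \<nu>. x \<in> K"
proof -
  have s: "sets \<nu> = sets borel" and sp: "space \<nu> = UNIV"
    by (rule radon_sets[OF assms(1)], rule radon_space[OF assms(1)])
  have K: "K \<in> sets \<nu>" "- K \<in> sets \<nu>"
    using compact_imp_closed[OF assms(2)] by (simp_all add: s)
  have "emeasure \<nu> (K \<union> - K) = emeasure \<nu> K"
    by (rule emeasure_Un_null_set) (use K assms(3) in auto)
  then show *: "emeasure \<nu> UNIV = emeasure \<nu> K" by simp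
  show "finite_measure \<nu>"
    using radon_compact_finite[OF assms(1,2)] * by (intro finite_measureI) (auto simp: sp)
  show "AE x in \<nu>. x \<in> K" using K assms(3) by (intro AE_I[of _ _ "- K"]) auto
qed

text \<open>The sets that can be approximated in this way include the closed sets, which are
  intersections of shrinking open neighbourhoods, and are stable under complements and countable
  unions.\<close>

lemma finite_borel_closed_regular:
  fixes \<mu> :: "'a::metric_space measure"
  assumes fin: "finite_measure \<mu>" and s: "sets \<mu> = sets borel" and B: "B \<in> sets borel" and e: "0 < e"
  shows "\<exists>F U. closed F \<and> open U \<and> F \<subseteq> B \<and> B \<subseteq> U \<and> measure \<mu> (U - F) < e"
proof -
  interpret finite_measure \<mu> by fact
  have [measurable_cong]: "sets \<mu> = sets borel" by fact
  have "B \<in> sigma_sets UNIV (Collect closed)"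
    using B by (simp add: borel_eq_closed)
  then show ?thesis using e
  proof (induction arbitrary: e rule: sigma_sets.induct)
    case (Basic F)
    then have F: "closed F" by simp
    show ?case
    \<comment> \<open>The distance to the empty set is 0 by convention, which would make every
      neighbourhood \<open>U n\<close> the whole space.\<close>
    proof (cases "F = {}")
      case True
      then show ?thesis using Basic(2) by (intro exI[of _ "{}"]) simp
    next
      case False
      define U where "U n = {x. infdist x F < 1 / real (Suc n)}" for n
      have oU: "open (U n)" for n
        unfolding U_def by (intro open_Collect_less continuous_intros)
      have FU: "F \<subseteq> U n" for n using False by (auto simp: U_def)
      have em: "(\<Inter>n. U n - F) = {}"
      proof -
        have "x \<in> F" if "\<And>n. x \<in> U n" for x
        proof -
          have "infdist x F \<le> 0"
          proof (rule field_le_epsilon)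
            fix d :: real assume "0 < d"
            then obtain n where "1 / real (Suc n) < d" using nat_approx_posE by blast
            then show "infdist x F \<le> 0 + d" using that[of n] by (simp add: U_def)
          qed
          then show ?thesis
            using in_closed_iff_infdist_zero[OF F False] infdist_nonneg[of x F] by simp
        qed
        then show ?thesis by auto
      qed
      have de: "decseq (\<lambda>n. U n - F)"
      proof (rule decseq_SucI)
        fix n
        have "1 / real (Suc (Suc n)) \<le> 1 / real (Suc n)" by (simp add: field_simps)
        then show "U (Suc n) - F \<subseteq> U n - F" unfolding U_def by (auto intro: order.strict_trans2)
      qed
      have m: "U n - F \<in> sets \<mu>" for n using oU F by (simp add: s)
      have "(\<lambda>n. measure \<mu> (U n - F)) \<longlonglongrightarrow> measure \<mu> (\<Inter>n. U n - F)"
        by (rule finite_Lim_measure_decseq) (use de m in auto)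
      then have "(\<lambda>n. measure \<mu> (U n - F)) \<longlonglongrightarrow> 0"
        unfolding em by simp
      then have "eventually (\<lambda>n. measure \<mu> (U n - F) < e) sequentially"
        using order_tendstoD(2)[OF _ Basic(2)] by blast
      then obtain n where "measure \<mu> (U n - F) < e" by (auto simp: eventually_sequentially)
      then show ?thesis using F oU FU by blast
    qed
  next
    case Empty
    then show ?case by (intro exI[of _ "{}"]) simp
  next
    case (Compl B)
    obtain F U where "closed F" "open U" "F \<subseteq> B" "B \<subseteq> U" "measure \<mu> (U - F) < e"
      using Compl.IH[OF Compl.prems] by blast
    then have "closed (- U)" "open (- F)" "- U \<subseteq> UNIV - B" "UNIV - B \<subseteq> - F" "measure \<mu> (- F - - U) < e"
      by (auto simp: closed_Compl open_Compl Diff_eq Int_commute)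
    then show ?case by blast
  next
    case (Union B)
    \<comment> \<open>The errors add up to e / 2; the other half is spent on truncating the union of
      the closed sets.\<close>
    have "\<forall>n. \<exists>F U. closed F \<and> open U \<and> F \<subseteq> B n \<and> B n \<subseteq> U \<and> measure \<mu> (U - F) < e / 2 * (1/2) ^ Suc n"
    proof
      fix n
      show "\<exists>F U. closed F \<and> open U \<and> F \<subseteq> B n \<and> B n \<subseteq> U \<and> measure \<mu> (U - F) < e / 2 * (1/2) ^ Suc n"
        by (rule Union.IH) (use Union.prems in simp)
    qed
    then obtain F U where FU: "\<And>n. closed (F n)" "\<And>n. open (U n)" "\<And>n. F n \<subseteq> B n" "\<And>n. B n \<subseteq> U n"
      "\<And>n. measure \<mu> (U n - F n) < e / 2 * (1/2) ^ Suc n" by metis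
    let ?U = "\<Union>n. U n"
    have Fm: "F n \<in> sets \<mu>" "U n \<in> sets \<mu>" for n using FU by (auto simp: s)
    have sm: "(\<lambda>n. e / 2 * (1/2) ^ Suc n) sums (e / 2 * 1)"
      by (intro sums_mult power_half_series)
    have "summable (\<lambda>n. measure \<mu> (U n - F n))"
      by (rule summable_comparison_test'[OF sums_summable[OF sm], of 0]) (use FU(5) in \<open>auto intro: less_imp_le\<close>)
    note sU = this
    have "measure \<mu> (\<Union>n. U n - F n) \<le> (\<Sum>n. measure \<mu> (U n - F n))"
      by (intro finite_measure_subadditive_countably sU) (use Fm in auto)
    also have "\<dots> \<le> e / 2"
      using suminf_le[OF less_imp_le[OF FU(5)] sU sums_summable[OF sm]] sm by (simp add: sums_iff)
    finally have 1: "measure \<mu> (\<Union>n. U n - F n) \<le> e / 2" .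
    \<comment> \<open>The full union of the sets \<open>F k\<close> need not be closed. Continuity
      from above allows it to be replaced by a finite one.\<close>
    have lim: "(\<lambda>n. measure \<mu> (?U - (\<Union>k<n. F k))) \<longlonglongrightarrow> measure \<mu> (\<Inter>n. ?U - (\<Union>k<n. F k))"
      by (rule finite_Lim_measure_decseq) (use Fm in \<open>auto simp: decseq_def\<close>)
    have "(\<Inter>n. ?U - (\<Union>k<n. F k)) \<subseteq> (\<Union>n. U n - F n)"
    proof
      fix x assume x: "x \<in> (\<Inter>n. ?U - (\<Union>k<n. F k))"
      then obtain m where "x \<in> U m" by blast
      moreover have "x \<notin> F m" using INT_D[OF x, of "Suc m"] by auto
      ultimately show "x \<in> (\<Union>n. U n - F n)" by blast
    qed
    then have "measure \<mu> (\<Inter>n. ?U - (\<Union>k<n. F k)) \<le> measure \<mu> (\<Union>n. U n - F n)"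
      by (rule finite_measure_mono) (use Fm in auto)
    then have "measure \<mu> (\<Inter>n. ?U - (\<Union>k<n. F k)) < e"
      using 1 Union.prems by linarith
    from order_tendstoD(2)[OF lim this]
    have "eventually (\<lambda>n. measure \<mu> (?U - (\<Union>k<n. F k)) < e) sequentially" .
    then obtain n where "measure \<mu> (?U - (\<Union>k<n. F k)) < e" by (auto simp: eventually_sequentially)
    moreover have "closed (\<Union>k<n. F k)" using FU(1) by (intro closed_UN) auto
    moreover have "open ?U" using FU(2) by (intro open_UN) auto
    moreover have "(\<Union>k<n. F k) \<subseteq> (\<Union>n. B n)" using FU(3) by blast
    moreover have "(\<Union>n. B n) \<subseteq> ?U" using FU(4) by blast
    ultimately show ?case by blast
  qed
qed

text \<open>Closed sets approximating from inside become compact after intersection with K, which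
  costs nothing because the complement of K is null.\<close>

lemma radon_if_compactly_concentrated:
  fixes \<mu> :: "'a::metric_space measure"
  assumes fin: "finite_measure \<mu>" and s: "sets \<mu> = sets borel" and K: "compact K" and z: "emeasure \<mu> (- K) = 0"
  shows "radon \<mu>"
proof -
  interpret finite_measure \<mu> by fact
  have K': "K \<in> sets \<mu>" "- K \<in> sets \<mu>" using compact_imp_closed[OF K] by (simp_all add: s)
  show ?thesis
    unfolding radon_def
  proof (intro conjI allI impI ballI)
    show "emeasure \<mu> C < \<infinity>" for C
      using emeasure_finite[of C] by (simp only: infinity_ennreal_def less_top not_False_eq_True)
  next
    fix B :: "'a set" assume B: "B \<in> sets borel"
    show "emeasure \<mu> B = (INF U\<in>{U. open U \<and> B \<subseteq> U}. emeasure \<mu> U)"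
    proof (rule antisym)
      show "emeasure \<mu> B \<le> (INF U\<in>{U. open U \<and> B \<subseteq> U}. emeasure \<mu> U)"
        by (auto intro!: INF_greatest emeasure_mono simp: s)
      show "(INF U\<in>{U. open U \<and> B \<subseteq> U}. emeasure \<mu> U) \<le> emeasure \<mu> B"
      proof (rule ennreal_le_epsilon)
        fix e :: real assume "0 < e"
        from finite_borel_closed_regular[OF fin s B this]
        obtain F U where FU: "closed F" "open U" "F \<subseteq> B" "B \<subseteq> U" "measure \<mu> (U - F) < e"
          by (elim exE conjE)
        have "(INF U\<in>{U. open U \<and> B \<subseteq> U}. emeasure \<mu> U) \<le> emeasure \<mu> U"
          using FU by (intro INF_lower) auto
        also have "\<dots> \<le> emeasure \<mu> B + emeasure \<mu> (U - F)"
          using FU B by (intro order_trans[OF _ emeasure_subadditive] emeasure_mono) (auto simp: s)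
        also have "\<dots> \<le> emeasure \<mu> B + ennreal e"
          using FU(5) by (intro add_left_mono) (auto simp: emeasure_eq_measure intro!: ennreal_leI)
        finally show "(INF U\<in>{U. open U \<and> B \<subseteq> U}. emeasure \<mu> U) \<le> emeasure \<mu> B + ennreal e" .
      qed
    qed
  next
    fix U :: "'a set" assume U: "open U"
    show "emeasure \<mu> U = (SUP C\<in>{C. compact C \<and> C \<subseteq> U}. emeasure \<mu> C)"
    proof (rule antisym)
      show "(SUP C\<in>{C. compact C \<and> C \<subseteq> U}. emeasure \<mu> C) \<le> emeasure \<mu> U"
        using U by (auto intro!: SUP_least emeasure_mono simp: s)
      show "emeasure \<mu> U \<le> (SUP C\<in>{C. compact C \<and> C \<subseteq> U}. emeasure \<mu> C)"
      proof (rule ennreal_le_epsilon)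
        fix e :: real assume "0 < e"
        from finite_borel_closed_regular[OF fin s borel_open[OF U] this]
        obtain F V where FU: "closed F" "open V" "F \<subseteq> U" "U \<subseteq> V" "measure \<mu> (V - F) < e"
          by (elim exE conjE)
        have "emeasure \<mu> U \<le> emeasure \<mu> ((K \<inter> F) \<union> ((V - F) \<union> - K))"
          using FU K' U by (intro emeasure_mono) (auto simp: s)
        also have "\<dots> \<le> emeasure \<mu> (K \<inter> F) + emeasure \<mu> ((V - F) \<union> - K)"
          using FU K' by (intro emeasure_subadditive) (auto simp: s)
        also have "emeasure \<mu> ((V - F) \<union> - K) = emeasure \<mu> (V - F)"
          using FU K' z by (intro emeasure_Un_null_set) (auto simp: s)
        also have "emeasure \<mu> (K \<inter> F) + emeasure \<mu> (V - F) \<le> (SUP C\<in>{C. compact C \<and> C \<subseteq> U}. emeasure \<mu> C) + ennreal e"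
          using FU K by (intro add_mono SUP_upper) (auto simp: emeasure_eq_measure intro!: ennreal_leI compact_Int_closed)
        finally show "emeasure \<mu> U \<le> (SUP C\<in>{C. compact C \<and> C \<subseteq> U}. emeasure \<mu> C) + ennreal e" .
      qed
    qed
  qed (fact s)
qed

text \<open>Local compactness puts between K and U an open W contained in a compact V. The function
  is the distance to the complement of W, divided by its minimum on K and cut off at 1; its support
  lies in V.\<close>

lemma test_function_bump:
  fixes K :: "'a::metric_space set"
  assumes lc: "locally compact (UNIV :: 'a set)" and K: "compact K" and U: "open U" "K \<subseteq> U"
  shows "\<exists>\<phi>\<in>test_functions. (\<forall>x. 0 \<le> \<phi> x \<and> \<phi> x \<le> 1) \<and> (\<forall>x\<in>K. \<phi> x = 1) \<and> (\<forall>x. x \<notin> U \<longrightarrow> \<phi> x = 0)"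
proof (cases "K = {}")
  case True
  then show ?thesis by (intro bexI[of _ "\<lambda>x. 0"]) (auto simp: test_functions_def)
next
  case False
  have "\<exists>u v. open u \<and> compact v \<and> x \<in> u \<and> u \<subseteq> v \<and> v \<subseteq> U" if "x \<in> K" for x
  proof -
    have "\<forall>w x::'a. open w \<and> x \<in> w \<longrightarrow> (\<exists>u v. open u \<and> compact v \<and> x \<in> u \<and> u \<subseteq> v \<and> v \<subseteq> w)"
      using lc unfolding locally_def by simp
    then show ?thesis using U that by (meson subsetD)
  qed
  then obtain u v where uv: "\<And>x. x \<in> K \<Longrightarrow> open (u x)" "\<And>x. x \<in> K \<Longrightarrow> compact (v x)"
    "\<And>x. x \<in> K \<Longrightarrow> x \<in> u x" "\<And>x. x \<in> K \<Longrightarrow> u x \<subseteq> v x" "\<And>x. x \<in> K \<Longrightarrow> v x \<subseteq> U" by metis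
  have "K \<subseteq> (\<Union>x\<in>K. u x)" using uv(3) by blast
  then obtain D where D: "D \<subseteq> K" "finite D" "K \<subseteq> (\<Union>x\<in>D. u x)"
    using compactE_image[OF K, of K u] uv(1) by metis
  have Dv: "u x \<subseteq> v x" "v x \<subseteq> U" "open (u x)" "compact (v x)" if "x \<in> D" for x
    using uv(4,5,1,2)[OF subsetD[OF D(1) that]] by auto
  define V where "V = (\<Union>x\<in>D. v x)"
  define W where "W = (\<Union>x\<in>D. u x)"
  have V: "compact V" "V \<subseteq> U"
    unfolding V_def using Dv by (auto intro!: compact_UN D(2))
  have W: "open W" "K \<subseteq> W"
    unfolding W_def using Dv D(3) by (auto intro!: open_UN)
  have WV: "W \<subseteq> V"
    unfolding W_def V_def by (intro UN_mono order_refl Dv)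
  have "\<exists>\<phi>. continuous_on UNIV \<phi> \<and> (\<forall>x. 0 \<le> \<phi> x \<and> \<phi> x \<le> 1) \<and> (\<forall>x\<in>K. \<phi> x = (1::real)) \<and> (\<forall>x. \<phi> x \<noteq> 0 \<longrightarrow> x \<in> W)"
  \<comment> \<open>Again the convention for the distance to the empty set; in this case the
    constant 1 has compact support because V is the whole space.\<close>
  proof (cases "W = UNIV")
    case True
    then show ?thesis by (intro exI[of _ "\<lambda>x. 1"]) auto
  next
    case False
    have "closed (- W)" "- W \<noteq> {}" using W(1) False by auto
    note cW = this
    have "continuous_on K (\<lambda>x. infdist x (- W))" by (intro continuous_intros)
    from continuous_attains_inf[OF K \<open>K \<noteq> {}\<close> this]
    obtain z where z: "z \<in> K" "\<And>x. x \<in> K \<Longrightarrow> infdist z (- W) \<le> infdist x (- W)" by blast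
    define d where "d = infdist z (- W)"
    have d: "0 < d"
      using in_closed_iff_infdist_zero[OF cW, of z] z(1) W(2) infdist_nonneg[of z "- W"]
      unfolding d_def by (auto simp: less_le)
    show ?thesis
    proof (intro exI[of _ "\<lambda>x. min 1 (infdist x (- W) / d)"] conjI allI ballI impI)
      show "continuous_on UNIV (\<lambda>x. min 1 (infdist x (- W) / d))"
        using d by (intro continuous_intros) auto
      show "min 1 (infdist x (- W) / d) = 1" if "x \<in> K" for x
        using z(2)[OF that] d by (simp add: d_def[symmetric])
      show "x \<in> W" if "min 1 (infdist x (- W) / d) \<noteq> 0" for x
        using that by (cases "x \<in> W") auto
    qed (use d in \<open>auto simp: infdist_nonneg\<close>)
  qed
  then obtain \<phi> where c: "continuous_on UNIV \<phi>" and p01: "\<And>x. 0 \<le> \<phi> x \<and> \<phi> x \<le> 1"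
    and pK: "\<And>x. x \<in> K \<Longrightarrow> \<phi> x = 1" and pW: "\<And>x. \<phi> x \<noteq> (0::real) \<Longrightarrow> x \<in> W" by blast
  have "closure {x. \<phi> x \<noteq> 0} \<subseteq> V"
    using pW WV compact_imp_closed[OF V(1)] by (intro closure_minimal) auto
  then have "compact (closure {x. \<phi> x \<noteq> 0})"
    using V(1) by (metis closed_closure compact_Int_closed inf.absorb2)
  with c have "\<phi> \<in> test_functions" by (simp add: test_functions_def)
  moreover have "\<phi> x = 0" if "x \<notin> U" for x using pW[of x] WV V(2) that by (cases "\<phi> x = 0") auto
  ultimately show ?thesis using p01 pK by blast
qed

section \<open>Comparing Radon measures by their integrals of test functions\<close>

lemma integrable_test_function:
  assumes \<nu>: "radon \<nu>" and \<phi>: "\<phi> \<in> test_functions"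
  shows "integrable \<nu> \<phi>"
proof -
  let ?C = "closure {x. \<phi> x \<noteq> 0}"
  have c: "continuous_on UNIV \<phi>" and C: "compact ?C" using \<phi> by (auto simp: test_functions_def)
  obtain B where B: "0 < B" "\<And>x. x \<in> ?C \<Longrightarrow> \<bar>\<phi> x\<bar> \<le> B"
    using compact_continuous_bound[OF C continuous_on_subset[OF c subset_UNIV]] by blast
  have "\<bar>\<phi> x\<bar> \<le> B * indicator ?C x" for x
    using B closure_subset[of "{x. \<phi> x \<noteq> 0}"] by (cases "\<phi> x = 0") (auto simp: indicator_def)
  moreover have "integrable \<nu> (\<lambda>x. B * indicator ?C x :: real)"
    using radon_compact_finite[OF \<nu> C] compact_imp_closed[OF C]
    by (intro integrable_mult_right integrable_real_indicator) (auto simp: radon_sets[OF \<nu>])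
  moreover have "\<phi> \<in> borel_measurable \<nu>"
    by (rule radon_measurable[OF \<nu> borel_measurable_continuous_onI[OF c]])
  moreover have "\<bar>B * indicator ?C x\<bar> = B * indicator ?C x" for x using B(1) by (simp add: indicator_def)
  ultimately show ?thesis by (elim Bochner_Integration.integrable_bound) (simp_all add: AE_I2)
qed

lemma emeasure_compact_le_integral:
  assumes \<mu>: "radon \<mu>" and K: "compact K"
    and \<phi>: "\<phi> \<in> test_functions" "\<And>x. 0 \<le> \<phi> x" "\<And>x. x \<in> K \<Longrightarrow> \<phi> x = 1"
  shows "emeasure \<mu> K \<le> ennreal (\<integral>x. \<phi> x \<partial>\<mu>)"
proof -
  have "emeasure \<mu> K = (\<integral>\<^sup>+x. indicator K x \<partial>\<mu>)"
    using compact_imp_closed[OF K] by (simp add: radon_sets[OF \<mu>])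
  also have "\<dots> \<le> (\<integral>\<^sup>+x. ennreal (\<phi> x) \<partial>\<mu>)"
    using \<phi> by (intro nn_integral_mono) (auto simp: indicator_def)
  also have "\<dots> = ennreal (\<integral>x. \<phi> x \<partial>\<mu>)"
    using \<phi> by (intro nn_integral_eq_integral integrable_test_function \<mu>) auto
  finally show ?thesis .
qed

text \<open>A test function squeezed between a compact set and an open set, with inner regularity,
  gives the inequality on open sets; outer regularity carries it to all Borel sets.\<close>

lemma radon_le_if_integrals_le:
  fixes \<mu> \<nu> :: "'a::metric_space measure"
  assumes lc: "locally compact (UNIV :: 'a set)" and \<mu>: "radon \<mu>" and \<nu>: "radon \<nu>"
    and le: "\<And>\<phi>. \<phi> \<in> test_functions \<Longrightarrow> (\<And>x. 0 \<le> \<phi> x) \<Longrightarrow> (\<integral>x. \<phi> x \<partial>\<mu>) \<le> (\<integral>x. \<phi> x \<partial>\<nu>)"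
  shows "\<mu> \<le> \<nu>"
proof -
  have U: "emeasure \<mu> U \<le> emeasure \<nu> U" if U: "open U" for U
  proof -
    have "emeasure \<mu> K \<le> emeasure \<nu> U" if K: "compact K" "K \<subseteq> U" for K
    proof -
      obtain \<phi> where p: "\<phi> \<in> test_functions" "\<And>x. 0 \<le> \<phi> x" "\<And>x. \<phi> x \<le> 1" "\<And>x. x \<in> K \<Longrightarrow> \<phi> x = 1"
        "\<And>x. x \<notin> U \<Longrightarrow> \<phi> x = 0"
        using test_function_bump[OF lc K(1) U K(2)] by blast
      have "emeasure \<mu> K \<le> ennreal (\<integral>x. \<phi> x \<partial>\<mu>)"
        by (rule emeasure_compact_le_integral[OF \<mu> K(1) p(1,2,4)])
      also have "\<dots> \<le> ennreal (\<integral>x. \<phi> x \<partial>\<nu>)" using le p by (intro ennreal_leI) auto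
      also have "\<dots> = (\<integral>\<^sup>+x. ennreal (\<phi> x) \<partial>\<nu>)"
        using p by (intro nn_integral_eq_integral[symmetric] integrable_test_function \<nu>) auto
      also have "\<dots> \<le> (\<integral>\<^sup>+x. indicator U x \<partial>\<nu>)"
        using p by (intro nn_integral_mono) (auto simp: indicator_def ennreal_le_1)
      also have "\<dots> = emeasure \<nu> U" using U by (simp add: radon_sets[OF \<nu>])
      finally show ?thesis .
    qed
    then have "(SUP K\<in>{K. compact K \<and> K \<subseteq> U}. emeasure \<mu> K) \<le> emeasure \<nu> U" by (intro SUP_least) auto
    then show ?thesis using radon_inner[OF \<mu> U] by simp
  qed
  have "emeasure \<mu> B \<le> emeasure \<nu> B" if B: "B \<in> sets borel" for B
  proof -
    have "(INF U\<in>{U. open U \<and> B \<subseteq> U}. emeasure \<mu> U) \<le> (INF U\<in>{U. open U \<and> B \<subseteq> U}. emeasure \<nu> U)"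
      by (rule INF_mono) (use U in auto)
    then show ?thesis
      using radon_outer[OF \<mu> B] radon_outer[OF \<nu> B] by simp
  qed
  then show ?thesis by (subst le_measure) (auto simp: radon_sets[OF \<mu>] radon_sets[OF \<nu>])
qed

lemma radon_eq_if_integrals_eq:
  fixes \<mu> \<nu> :: "'a::metric_space measure"
  assumes lc: "locally compact (UNIV :: 'a set)" and \<mu>: "radon \<mu>" and \<nu>: "radon \<nu>"
    and eq: "\<And>\<phi>. \<phi> \<in> test_functions \<Longrightarrow> (\<integral>x. \<phi> x \<partial>\<mu>) = (\<integral>x. \<phi> x \<partial>\<nu>)"
  shows "\<mu> = \<nu>"
  by (intro antisym radon_le_if_integrals_le[OF lc]) (use assms in auto)

subsection \<open>Vague compactness and vague limits\<close>

text \<open>A fixed compact carrier together with a mass bound excludes escape of mass. Both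
  conditions are preserved by vague limits, in contrast to being carried by a set that is not
  closed.\<close>

definition concentrated :: "'a::t2_space set \<Rightarrow> real \<Rightarrow> 'a measure set" where
  "concentrated K m = {\<nu>. radon \<nu> \<and> emeasure \<nu> (- K) = 0 \<and> emeasure \<nu> UNIV \<le> ennreal m}"

lemma integrable_on_compact:
  fixes \<nu> :: "'a::metric_space measure"
  assumes "radon \<nu>" "compact K" "emeasure \<nu> (- K) = 0" "continuous_on UNIV \<phi>"
  shows "integrable \<nu> (\<phi> :: 'a \<Rightarrow> real)"
proof -
  interpret finite_measure \<nu> by (rule emeasure_compact_complement(2)[OF assms(1-3)])
  obtain B where B: "\<And>x. x \<in> K \<Longrightarrow> \<bar>\<phi> x\<bar> \<le> B"
    using compact_continuous_bound[OF assms(2) continuous_on_subset[OF assms(4) subset_UNIV]] by blast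
  show ?thesis
  proof (rule integrable_const_bound[of _ B])
    show "AE x in \<nu>. norm (\<phi> x) \<le> B"
      using emeasure_compact_complement(3)[OF assms(1-3)] by eventually_elim (use B in simp)
  qed (rule radon_measurable[OF assms(1) borel_measurable_continuous_onI[OF assms(4)]])
qed

lemma positive_functional_integral:
  fixes \<nu> :: "'a::metric_space measure"
  assumes "radon \<nu>" "compact K" "emeasure \<nu> (- K) = 0"
    and L: "\<And>\<phi>. continuous_on UNIV \<phi> \<Longrightarrow> L \<phi> = (\<integral>x. \<phi> x \<partial>\<nu>)"
  shows "positive_functional K L"
proof
  note i = integrable_on_compact[OF assms(1-3)]
  show "L (\<lambda>x. \<phi> x + \<psi> x) = L \<phi> + L \<psi>" if "continuous_on UNIV \<phi>" "continuous_on UNIV \<psi>" for \<phi> \<psi>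
    using that i by (simp add: L continuous_on_add)
  show "L (\<lambda>x. c * \<phi> x) = c * L \<phi>" if "continuous_on UNIV \<phi>" for \<phi> c
    using that i by (simp add: L continuous_on_mult_left)
  show "0 \<le> L \<phi>" if "continuous_on UNIV \<phi>" "\<And>x. x \<in> K \<Longrightarrow> 0 \<le> \<phi> x" for \<phi>
  proof -
    have "AE x in \<nu>. 0 \<le> \<phi> x"
      using emeasure_compact_complement(3)[OF assms(1-3)] by eventually_elim (use that in simp)
    then show ?thesis using that by (simp add: L integral_nonneg_AE)
  qed
qed (fact assms(2))

lemma test_functions_continuous: "\<phi> \<in> test_functions \<Longrightarrow> continuous_on UNIV \<phi>"
  by (simp add: test_functions_def)

text \<open>The set is a continuous image of a compact one: positive functionals of norm at most m
  form a closed subset of a product of compact intervals, and \<open>rep\<close> sends each of them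
  to its representing measure. Every concentrated measure is reached because test functions
  determine a Radon measure.\<close>

theorem compactin_vague_concentrated:
  fixes K :: "'a::metric_space set"
  assumes lc: "locally compact (UNIV :: 'a set)" and K: "compact K" and m: "0 \<le> m"
  shows "compactin vague_topology (concentrated K m)"
proof -
  have "\<exists>B. \<forall>x\<in>K. \<bar>\<phi> x\<bar> \<le> B" if "continuous_on UNIV \<phi>" for \<phi> :: "'a \<Rightarrow> real"
    using compact_continuous_bound[OF K continuous_on_subset[OF that subset_UNIV]] by blast
  then obtain B :: "('a \<Rightarrow> real) \<Rightarrow> real"
    where B: "\<And>\<phi> x. continuous_on UNIV \<phi> \<Longrightarrow> x \<in> K \<Longrightarrow> \<bar>\<phi> x\<bar> \<le> B \<phi>" by metis
  \<comment> \<open>Discontinuous functions carry no information, so their coordinate is pinned to 0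
    to keep the product compact. The absolute value is there because \<open>B \<phi>\<close> may be
    negative when K is empty.\<close>
  define box where "box \<phi> = (if continuous_on UNIV \<phi> then {- (m * \<bar>B \<phi>\<bar>)..m * \<bar>B \<phi>\<bar>} else {0::real})"
    for \<phi> :: "'a \<Rightarrow> real"
  define \<Lambda> where "\<Lambda> = {L. L \<in> PiE UNIV box \<and> positive_functional K L \<and> L (\<lambda>x. 1) \<le> m}"
  have "compactin (product_topology (\<lambda>_. euclidean) UNIV) (PiE UNIV box)"
    by (subst compactin_PiE) (auto simp: box_def)
  then have cbox: "compact (PiE UNIV box)"
    by (simp add: euclidean_product_topology)
  \<comment> \<open>With the continuity conditions moved into the index sets, the predicate becomes
    an intersection of equations and inequalities between finitely many coordinates of L, each of
    them closed.\<close>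
  have pf: "positive_functional K L \<longleftrightarrow>
      (\<forall>\<phi>\<in>Collect (continuous_on UNIV). \<forall>\<psi>\<in>Collect (continuous_on UNIV). L (\<lambda>x. \<phi> x + \<psi> x) = L \<phi> + L \<psi>) \<and>
      (\<forall>\<phi>\<in>Collect (continuous_on UNIV). \<forall>c. L (\<lambda>x. c * \<phi> x) = c * L \<phi>) \<and>
      (\<forall>\<phi>\<in>{\<phi>. continuous_on UNIV \<phi> \<and> (\<forall>x\<in>K. 0 \<le> \<phi> x)}. 0 \<le> L \<phi>)" for L
    unfolding positive_functional_def using K by auto
  have coord: "continuous_on UNIV (\<lambda>L :: ('a \<Rightarrow> real) \<Rightarrow> real. L \<phi>)" for \<phi>
    by (rule continuous_on_product_coordinates)
  have "closed {L. positive_functional K L \<and> L (\<lambda>x. 1) \<le> m}"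
    unfolding pf Ball_def
    by (intro closed_Collect_conj closed_Collect_all closed_Collect_imp closed_Collect_eq closed_Collect_le
        continuous_intros coord open_Collect_const)
  then have "compact \<Lambda>"
    using compact_Int_closed[OF cbox] unfolding \<Lambda>_def by (simp add: Collect_conj_eq)
  then have c\<Lambda>: "compactin (top_of_set \<Lambda>) \<Lambda>"
    by (simp add: compactin_subtopology)
  define rep where "rep L = (SOME \<mu>. \<mu> \<in> concentrated K m \<and> (\<forall>\<phi>. continuous_on UNIV \<phi> \<longrightarrow> (\<integral>x. \<phi> x \<partial>\<mu>) = L \<phi>))"
    for L :: "('a \<Rightarrow> real) \<Rightarrow> real"
  have rep: "rep L \<in> concentrated K m" "\<And>\<phi>. continuous_on UNIV \<phi> \<Longrightarrow> (\<integral>x. \<phi> x \<partial>rep L) = L \<phi>"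
    if L: "L \<in> \<Lambda>" for L
  proof -
    interpret positive_functional K L using L by (simp add: \<Lambda>_def)
    have "radon riesz_measure"
      by (rule radon_if_compactly_concentrated[OF finite_riesz sets_riesz_measure K emeasure_riesz_outside])
    then have "riesz_measure \<in> concentrated K m"
      using L by (simp add: concentrated_def emeasure_riesz_outside emeasure_riesz_UNIV \<Lambda>_def ennreal_leI)
    then have "\<exists>\<mu>. \<mu> \<in> concentrated K m \<and> (\<forall>\<phi>. continuous_on UNIV \<phi> \<longrightarrow> (\<integral>x. \<phi> x \<partial>\<mu>) = L \<phi>)"
      using integral_riesz by auto
    from someI_ex[OF this] show "rep L \<in> concentrated K m"
      "\<And>\<phi>. continuous_on UNIV \<phi> \<Longrightarrow> (\<integral>x. \<phi> x \<partial>rep L) = L \<phi>"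
      unfolding rep_def by blast+
  qed
  have cont: "continuous_map (top_of_set \<Lambda>) vague_topology rep"
    unfolding vague_topology_def
  proof (rule continuous_on_generated_topo)
    fix V :: "'a measure set"
    assume "V \<in> {{\<nu>. radon \<nu> \<and> (\<integral>x. \<phi> x \<partial>\<nu>) \<in> U} | \<phi> U. \<phi> \<in> test_functions \<and> open U}"
    then obtain \<phi> U where V: "V = {\<nu>. radon \<nu> \<and> (\<integral>x. \<phi> x \<partial>\<nu>) \<in> U}" and \<phi>: "\<phi> \<in> test_functions" and U: "open U"
      by blast
    have "rep -` V \<inter> \<Lambda> = \<Lambda> \<inter> (\<lambda>L. L \<phi>) -` U"
      using rep test_functions_continuous[OF \<phi>] by (auto simp: V concentrated_def)
    moreover have "open ((\<lambda>L. L \<phi>) -` U)"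
      using open_vimage[OF U coord] .
    ultimately show "openin (top_of_set \<Lambda>) (rep -` V \<inter> topspace (top_of_set \<Lambda>))"
      by (simp add: openin_open_Int)
  next
    have "rep L \<in> topspace vague_topology" if "L \<in> \<Lambda>" for L
      using rep(1)[OF that] by (simp add: topspace_vague_topology concentrated_def)
    then show "rep ` topspace (top_of_set \<Lambda>) \<subseteq> \<Union>{{\<nu>. radon \<nu> \<and> (\<integral>x. \<phi> x \<partial>\<nu>) \<in> U} | \<phi> U. \<phi> \<in> test_functions \<and> open U}"
      unfolding vague_topology_def topology_generated_by_topspace by auto
  qed
  have "concentrated K m \<subseteq> rep ` \<Lambda>"
  proof
    fix \<nu> assume \<nu>: "\<nu> \<in> concentrated K m"
    then have r: "radon \<nu>" "emeasure \<nu> (- K) = 0" by (auto simp: concentrated_def)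
    interpret finite_measure \<nu> by (rule emeasure_compact_complement(2)[OF r(1) K r(2)])
    \<comment> \<open>Set to 0 off the continuous functions so that it lies in the pinned
      coordinates of the box.\<close>
    define L where "L \<phi> = (if continuous_on UNIV \<phi> then \<integral>x. \<phi> x \<partial>\<nu> else 0)" for \<phi> :: "'a \<Rightarrow> real"
    have mass: "measure \<nu> UNIV \<le> m"
      using \<nu> m by (simp add: concentrated_def emeasure_eq_measure)
    have "L \<phi> \<in> box \<phi>" for \<phi>
    proof (cases "continuous_on UNIV \<phi>")
      case True
      have "AE x in \<nu>. \<bar>\<phi> x\<bar> \<le> \<bar>B \<phi>\<bar>"
        using emeasure_compact_complement(3)[OF r(1) K r(2)] by eventually_elim (use B[OF True] in force)
      then have "(\<integral>x. \<bar>\<phi> x\<bar> \<partial>\<nu>) \<le> (\<integral>x. \<bar>B \<phi>\<bar> \<partial>\<nu>)"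
        using integrable_on_compact[OF r(1) K r(2) True] by (intro integral_mono_AE) auto
      also have "\<dots> = measure \<nu> UNIV * \<bar>B \<phi>\<bar>" by (simp add: radon_space[OF r(1)])
      also have "\<dots> \<le> m * \<bar>B \<phi>\<bar>" using mass by (intro mult_right_mono) auto
      finally have "\<bar>\<integral>x. \<phi> x \<partial>\<nu>\<bar> \<le> m * \<bar>B \<phi>\<bar>"
        using integral_abs_bound[of \<nu> \<phi>] by linarith
      then show ?thesis using True by (auto simp: box_def L_def)
    qed (simp add: box_def L_def)
    moreover have "positive_functional K L"
      by (rule positive_functional_integral[OF r(1) K r(2)]) (simp add: L_def)
    moreover have "L (\<lambda>x. 1) \<le> m" using mass by (simp add: L_def radon_space[OF r(1)])
    ultimately have L: "L \<in> \<Lambda>" by (auto simp: \<Lambda>_def PiE_iff extensional_def)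
    have "\<nu> = rep L"
    proof (rule radon_eq_if_integrals_eq[OF lc r(1)])
      show "radon (rep L)" using rep(1)[OF L] by (simp add: concentrated_def)
      show "(\<integral>x. \<phi> x \<partial>\<nu>) = (\<integral>x. \<phi> x \<partial>rep L)" if "\<phi> \<in> test_functions" for \<phi>
        using rep(2)[OF L test_functions_continuous[OF that]] test_functions_continuous[OF that] by (simp add: L_def)
    qed
    with L show "\<nu> \<in> rep ` \<Lambda>" by blast
  qed
  then have "rep ` \<Lambda> = concentrated K m" using rep(1) by blast
  with image_compactin[OF c\<Lambda> cont] show ?thesis by simp
qed

lemma concentratedD:
  assumes "\<nu> \<in> concentrated K m" and K: "compact K"
  shows "radon \<nu>" "emeasure \<nu> (- K) = 0" "finite_measure \<nu>" "AE x in \<nu>. x \<in> K"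
    "sets \<nu> = sets borel" "space \<nu> = UNIV"
proof -
  have r: "radon \<nu>" "emeasure \<nu> (- K) = 0" using assms(1) by (auto simp: concentrated_def)
  then show "radon \<nu>" "emeasure \<nu> (- K) = 0" "finite_measure \<nu>" "AE x in \<nu>. x \<in> K"
    "sets \<nu> = sets borel" "space \<nu> = UNIV"
    using emeasure_compact_complement(2,3)[OF r(1) K r(2)] radon_sets[OF r(1)] radon_space[OF r(1)] by auto
qed

lemma concentrated_measure_le:
  assumes "\<nu> \<in> concentrated K m" and K: "compact K" and m: "0 \<le> m"
  shows "measure \<nu> UNIV \<le> m"
proof -
  interpret finite_measure \<nu> by (rule concentratedD(3)[OF assms(1) K])
  show ?thesis using assms(1) m by (simp add: concentrated_def emeasure_eq_measure)
qed

lemma test_functions_mult: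
  assumes "\<theta> \<in> test_functions" "continuous_on UNIV \<phi>"
  shows "(\<lambda>x. \<phi> x * \<theta> x) \<in> test_functions"
proof -
  have "closure {x. \<phi> x * \<theta> x \<noteq> 0} \<subseteq> closure {x. \<theta> x \<noteq> 0}" by (rule closure_mono) auto
  then have "closure {x. \<theta> x \<noteq> 0} \<inter> closure {x. \<phi> x * \<theta> x \<noteq> 0} = closure {x. \<phi> x * \<theta> x \<noteq> 0}"
    by (rule Int_absorb1)
  moreover have t: "compact (closure {x. \<theta> x \<noteq> 0})" "continuous_on UNIV \<theta>"
    using assms by (auto simp: test_functions_def)
  moreover have "compact (closure {x. \<theta> x \<noteq> 0} \<inter> closure {x. \<phi> x * \<theta> x \<noteq> 0})"
    by (rule compact_Int_closed[OF t(1) closed_closure])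
  ultimately have "compact (closure {x. \<phi> x * \<theta> x \<noteq> 0})" by (simp only:)
  moreover have "continuous_on UNIV (\<lambda>x. \<phi> x * \<theta> x)" by (rule continuous_on_mult[OF assms(2) t(2)])
  ultimately show ?thesis unfolding test_functions_def by blast
qed

text \<open>Test functions supported off K show that the limit does not charge the complement of K.
  A cutoff \<open>\<theta>\<close> equal to 1 on K then turns any continuous function into a test
  function with the same integrals, so convergence extends to all continuous functions; the constant
  1 gives the mass bound.\<close>

lemma vague_limit_concentrated:
  fixes K :: "'a::metric_space set" and \<nu> :: "'t \<Rightarrow> 'a measure"
  assumes lc: "locally compact (UNIV :: 'a set)" and K: "compact K" and m: "0 \<le> m" and F: "F \<noteq> bot"
    and ev: "eventually (\<lambda>t. \<nu> t \<in> concentrated K m) F" and \<mu>: "radon \<mu>"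
    and lim: "\<And>\<phi>. \<phi> \<in> test_functions \<Longrightarrow> ((\<lambda>t. \<integral>x. \<phi> x \<partial>\<nu> t) \<longlongrightarrow> (\<integral>x. \<phi> x \<partial>\<mu>)) F"
  shows "\<mu> \<in> concentrated K m"
    and "\<And>\<phi> :: 'a \<Rightarrow> real. continuous_on UNIV \<phi> \<Longrightarrow> ((\<lambda>t. \<integral>x. \<phi> x \<partial>\<nu> t) \<longlongrightarrow> (\<integral>x. \<phi> x \<partial>\<mu>)) F"
proof -
  have oK: "open (- K)" using compact_imp_closed[OF K] by (simp add: open_Compl)
  have "emeasure \<mu> C = 0" if C: "compact C" "C \<subseteq> - K" for C
  proof -
    obtain \<phi> where p: "\<phi> \<in> test_functions" "\<And>x. 0 \<le> \<phi> x" "\<And>x. x \<in> C \<Longrightarrow> \<phi> x = 1"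
      "\<And>x. x \<notin> - K \<Longrightarrow> \<phi> x = 0"
      using test_function_bump[OF lc C(1) oK C(2)] by blast
    have "eventually (\<lambda>t. (\<integral>x. \<phi> x \<partial>\<nu> t) = 0) F"
      using ev
    proof eventually_elim
      case (elim t)
      have "AE x in \<nu> t. \<phi> x = 0"
        using concentratedD(4)[OF elim K] by eventually_elim (use p(4) in simp)
      then show ?case by (rule integral_eq_zero_AE)
    qed
    then have "((\<lambda>t. \<integral>x. \<phi> x \<partial>\<nu> t) \<longlongrightarrow> 0) F" by (simp add: tendsto_eventually)
    then have "(\<integral>x. \<phi> x \<partial>\<mu>) = 0" using tendsto_unique[OF F lim[OF p(1)]] by simp
    then show ?thesis using emeasure_compact_le_integral[OF \<mu> C(1) p(1-3)] by simp
  qed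
  then have "(SUP C\<in>{C. compact C \<and> C \<subseteq> - K}. emeasure \<mu> C) \<le> 0" by (intro SUP_least) auto
  then have z: "emeasure \<mu> (- K) = 0" using radon_inner[OF \<mu> oK] by simp
  obtain \<theta> where \<theta>: "\<theta> \<in> test_functions" "\<And>x. x \<in> K \<Longrightarrow> \<theta> x = 1"
    using test_function_bump[OF lc K open_UNIV subset_UNIV] by blast
  show conv: "((\<lambda>t. \<integral>x. \<phi> x \<partial>\<nu> t) \<longlongrightarrow> (\<integral>x. \<phi> x \<partial>\<mu>)) F" if c: "continuous_on UNIV \<phi>" for \<phi> :: "'a \<Rightarrow> real"
  proof -
    have eq: "(\<integral>x. \<phi> x * \<theta> x \<partial>\<eta>) = (\<integral>x. \<phi> x \<partial>\<eta>)" if "radon \<eta>" "emeasure \<eta> (- K) = 0" for \<eta>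
    proof (rule integral_cong_AE)
      have cc: "continuous_on UNIV (\<lambda>x. \<phi> x * \<theta> x)"
        using test_functions_continuous[OF test_functions_mult[OF \<theta>(1) c]] .
      show "(\<lambda>x. \<phi> x * \<theta> x) \<in> borel_measurable \<eta>" "\<phi> \<in> borel_measurable \<eta>"
        using radon_measurable[OF that(1)] borel_measurable_continuous_onI[OF cc] borel_measurable_continuous_onI[OF c]
        by auto
      show "AE x in \<eta>. \<phi> x * \<theta> x = \<phi> x"
        using emeasure_compact_complement(3)[OF that(1) K that(2)] by eventually_elim (use \<theta>(2) in simp)
    qed
    have "eventually (\<lambda>t. (\<integral>x. \<phi> x * \<theta> x \<partial>\<nu> t) = (\<integral>x. \<phi> x \<partial>\<nu> t)) F"
      using ev by eventually_elim (use eq concentratedD(1,2)[OF _ K] in blast)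
    moreover have "((\<lambda>t. \<integral>x. \<phi> x * \<theta> x \<partial>\<nu> t) \<longlongrightarrow> (\<integral>x. \<phi> x * \<theta> x \<partial>\<mu>)) F"
      by (rule lim[OF test_functions_mult[OF \<theta>(1) c]])
    ultimately show ?thesis using eq[OF \<mu> z] by (simp add: tendsto_cong)
  qed
  interpret finite_measure \<mu> by (rule emeasure_compact_complement(2)[OF \<mu> K z])
  have "((\<lambda>t. \<integral>x. (1::real) \<partial>\<nu> t) \<longlongrightarrow> (\<integral>x. 1 \<partial>\<mu>)) F" by (rule conv) simp
  moreover have "eventually (\<lambda>t. (\<integral>x. (1::real) \<partial>\<nu> t) \<le> m) F"
    using ev by eventually_elim (use concentrated_measure_le[OF _ K m] concentratedD(6)[OF _ K] in simp)
  ultimately have "(\<integral>x. (1::real) \<partial>\<mu>) \<le> m" by (rule tendsto_upperbound[OF _ _ F])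
  then have "measure \<mu> UNIV \<le> m" by (simp add: radon_space[OF \<mu>])
  then show "\<mu> \<in> concentrated K m"
    using \<mu> z by (simp add: concentrated_def emeasure_eq_measure ennreal_leI)
qed

text \<open>An interchange of limits with three errors of e / 4 each. It serves both the
  approximation of a kernel by tensors and the truncation of a series.\<close>

lemma tendsto_uniform_approx:
  fixes u :: "'t \<Rightarrow> real"
  assumes "\<And>e. 0 < e \<Longrightarrow> \<exists>q l'. (q \<longlongrightarrow> l') F \<and> \<bar>l - l'\<bar> \<le> e \<and> eventually (\<lambda>t. \<bar>u t - q t\<bar> \<le> e) F"
  shows "(u \<longlongrightarrow> l) F"
proof (rule tendstoI)
  fix e :: real assume "0 < e"
  then obtain q l' where q: "(q \<longlongrightarrow> l') F" "\<bar>l - l'\<bar> \<le> e/4" "eventually (\<lambda>t. \<bar>u t - q t\<bar> \<le> e/4) F"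
    using assms[of "e/4"] by auto
  have "eventually (\<lambda>t. dist (q t) l' < e/4) F" by (rule tendstoD[OF q(1)]) (use \<open>0 < e\<close> in simp)
  with q(3) show "eventually (\<lambda>t. dist (u t) l < e) F"
    by eventually_elim (use q(2) in \<open>unfold dist_real_def, linarith\<close>)
qed

text \<open>The algebraic tensor product of the two spaces of continuous functions. Constants and
  scalar multiples are already contained in the products.\<close>

inductive_set tensors :: "('a::topological_space \<times> 'b::topological_space \<Rightarrow> real) set" where
  tensor_prod: "continuous_on UNIV \<phi> \<Longrightarrow> continuous_on UNIV \<psi> \<Longrightarrow> (\<lambda>p. \<phi> (fst p) * \<psi> (snd p)) \<in> tensors"
| tensor_add: "q \<in> tensors \<Longrightarrow> r \<in> tensors \<Longrightarrow> (\<lambda>p. q p + r p) \<in> tensors"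

lemma tensors_mult:
  assumes "q \<in> tensors" "r \<in> tensors"
  shows "(\<lambda>p. q p * r p) \<in> tensors"
  using assms(1)
proof induction
  case outer: (tensor_prod \<phi> \<psi>)
  from assms(2) show ?case
  proof induction
    case (tensor_prod \<phi>' \<psi>')
    have "(\<lambda>p. (\<phi> (fst p) * \<phi>' (fst p)) * (\<psi> (snd p) * \<psi>' (snd p))) \<in> tensors"
      by (intro tensors.tensor_prod continuous_on_mult outer tensor_prod)
    moreover have "(\<lambda>p. (\<phi> (fst p) * \<phi>' (fst p)) * (\<psi> (snd p) * \<psi>' (snd p))) =
        (\<lambda>p. \<phi> (fst p) * \<psi> (snd p) * (\<phi>' (fst p) * \<psi>' (snd p)))"
      by (simp add: fun_eq_iff mult_ac)
    ultimately show ?case by (simp only:)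
  next
    case (tensor_add q r)
    from tensors.tensor_add[OF this(3,4)] show ?case by (simp add: distrib_left)
  qed
next
  case (tensor_add q r)
  from tensors.tensor_add[OF this(3,4)] show ?case by (simp add: distrib_right)
qed

lemma tensors_continuous: "q \<in> tensors \<Longrightarrow> continuous_on UNIV q"
proof (induction rule: tensors.induct)
  case (tensor_prod \<phi> \<psi>)
  have "continuous_on UNIV (\<lambda>p. \<phi> (fst p))" "continuous_on UNIV (\<lambda>p. \<psi> (snd p))"
    by (rule continuous_on_compose2[OF tensor_prod(1) continuous_on_fst[OF continuous_on_id] subset_UNIV],
        rule continuous_on_compose2[OF tensor_prod(2) continuous_on_snd[OF continuous_on_id] subset_UNIV])
  then show ?case by (rule continuous_on_mult)
qed (rule continuous_on_add)

text \<open>Stone-Weierstrass: two distinct points differ in one coordinate and are separated by the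
  distance in that coordinate, a tensor whose other factor is 1.\<close>

lemma tensors_dense:
  fixes K :: "'a::metric_space set" and K' :: "'b::metric_space set"
  assumes "compact K" "compact K'" "continuous_on (K \<times> K') h" "0 < e"
  shows "\<exists>q\<in>tensors. \<forall>p\<in>K \<times> K'. \<bar>h p - q p\<bar> < e"
proof -
  have "\<exists>q. q \<in> tensors \<and> (\<forall>p\<in>K \<times> K'. \<bar>h p - q p\<bar> < e)"
  proof (rule Stone_Weierstrass_HOL[of "K \<times> K'" "\<lambda>q. q \<in> tensors"])
    show "compact (K \<times> K')" using assms by (intro compact_Times)
    show "(\<lambda>p. c) \<in> tensors" for c using tensor_prod[of "\<lambda>x. c" "\<lambda>x. 1"] by simp
    show "continuous_on (K \<times> K') q" if "q \<in> tensors" for q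
      using tensors_continuous[OF that] by (rule continuous_on_subset) simp
    show "\<exists>q. q \<in> tensors \<and> q x \<noteq> q y" if "x \<in> K \<times> K' \<and> y \<in> K \<times> K' \<and> x \<noteq> y" for x y
    proof (cases "fst x = fst y")
      case True
      then have "snd x \<noteq> snd y" using that by (auto simp: prod_eq_iff)
      moreover have "(\<lambda>p. 1 * dist (snd x) (snd p)) \<in> tensors"
        by (rule tensor_prod) (auto intro!: continuous_intros)
      ultimately show ?thesis by (intro exI[of _ "\<lambda>p. 1 * dist (snd x) (snd p)"]) simp
    next
      case False
      moreover have "(\<lambda>p. dist (fst x) (fst p) * 1) \<in> tensors"
        by (rule tensor_prod[of "\<lambda>z. dist (fst x) z" "\<lambda>z. 1"]) (auto intro!: continuous_intros)
      ultimately show ?thesis by (intro exI[of _ "\<lambda>p. dist (fst x) (fst p) * 1"]) simp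
    qed
  qed (use assms tensor_add tensors_mult in auto)
  then show ?thesis by blast
qed

section \<open>Vague convergence of product measures\<close>

lemma concentrated_pair:
  fixes \<mu> \<nu> :: "'a::{metric_space,second_countable_topology} measure"
  assumes \<mu>: "\<mu> \<in> concentrated K m" and \<nu>: "\<nu> \<in> concentrated K' m'" and K: "compact K" "compact K'"
    and m: "0 \<le> m" "0 \<le> m'"
  shows "finite_measure (\<mu> \<Otimes>\<^sub>M \<nu>)" "sets (\<mu> \<Otimes>\<^sub>M \<nu>) = sets borel" "space (\<mu> \<Otimes>\<^sub>M \<nu>) = UNIV"
    "AE p in \<mu> \<Otimes>\<^sub>M \<nu>. p \<in> K \<times> K'" "measure (\<mu> \<Otimes>\<^sub>M \<nu>) UNIV = measure \<mu> UNIV * measure \<nu> UNIV"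
    "measure (\<mu> \<Otimes>\<^sub>M \<nu>) UNIV \<le> m * m'" "pair_sigma_finite \<mu> \<nu>"
proof -
  note c1 = concentratedD[OF \<mu> K(1)] and c2 = concentratedD[OF \<nu> K(2)]
  interpret M: finite_measure \<mu> by (rule c1)
  interpret N: finite_measure \<nu> by (rule c2)
  show psf: "pair_sigma_finite \<mu> \<nu>"
    unfolding pair_sigma_finite_def using M.sigma_finite_measure_axioms N.sigma_finite_measure_axioms by simp
  interpret pair_sigma_finite \<mu> \<nu> by (rule psf)
  show f: "finite_measure (\<mu> \<Otimes>\<^sub>M \<nu>)" by (rule finite_measure_pair_measure[OF c2(3) c1(3)])
  interpret P: finite_measure "\<mu> \<Otimes>\<^sub>M \<nu>" by (rule f)
  show s: "sets (\<mu> \<Otimes>\<^sub>M \<nu>) = sets borel"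
    using sets_pair_measure_cong[OF c1(5) c2(5)] by (simp only: borel_prod)
  show sp: "space (\<mu> \<Otimes>\<^sub>M \<nu>) = UNIV" by (simp add: space_pair_measure c1 c2)
  have "emeasure (\<mu> \<Otimes>\<^sub>M \<nu>) (UNIV \<times> UNIV) = emeasure \<mu> UNIV * emeasure \<nu> UNIV"
    by (rule N.emeasure_pair_measure_Times) (simp_all add: c1 c2)
  then show e: "measure (\<mu> \<Otimes>\<^sub>M \<nu>) UNIV = measure \<mu> UNIV * measure \<nu> UNIV"
    by (simp add: P.emeasure_eq_measure M.emeasure_eq_measure N.emeasure_eq_measure flip: ennreal_mult)
  show "measure (\<mu> \<Otimes>\<^sub>M \<nu>) UNIV \<le> m * m'"
    unfolding e by (intro mult_mono concentrated_measure_le[OF \<mu>] concentrated_measure_le[OF \<nu>] K m) auto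
  have KK: "K \<times> K' \<in> sets (\<mu> \<Otimes>\<^sub>M \<nu>)"
    using compact_imp_closed[OF K(1)] compact_imp_closed[OF K(2)] by (intro pair_measureI) (simp_all add: c1 c2)
  show "AE p in \<mu> \<Otimes>\<^sub>M \<nu>. p \<in> K \<times> K'"
  proof (rule AE_pair_measure)
    show "{p \<in> space (\<mu> \<Otimes>\<^sub>M \<nu>). p \<in> K \<times> K'} \<in> sets (\<mu> \<Otimes>\<^sub>M \<nu>)" using KK by (simp add: sp)
    show "AE x in \<mu>. AE y in \<nu>. (x, y) \<in> K \<times> K'"
      using c1(4) by eventually_elim (use c2(4) in simp)
  qed
qed

lemma integral_diff_bound:
  fixes u v :: "'b \<Rightarrow> real"
  assumes "finite_measure N" "integrable N u" "integrable N v" "AE p in N. \<bar>u p - v p\<bar> \<le> e"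
  shows "\<bar>(\<integral>p. u p \<partial>N) - (\<integral>p. v p \<partial>N)\<bar> \<le> e * measure N (space N)"
proof -
  interpret finite_measure N by fact
  have "\<bar>\<integral>p. u p - v p \<partial>N\<bar> \<le> (\<integral>p. \<bar>u p - v p\<bar> \<partial>N)" by (rule integral_abs_bound)
  also have "\<dots> \<le> (\<integral>p. e \<partial>N)"
    using assms by (intro integral_mono_AE) auto
  finally show ?thesis using assms by (simp add: mult.commute)
qed

lemma integrable_pair_concentrated:
  fixes \<mu> \<nu> :: "'a::{metric_space,second_countable_topology} measure" and h :: "'a \<times> 'a \<Rightarrow> real"
  assumes \<mu>: "\<mu> \<in> concentrated K m" and \<nu>: "\<nu> \<in> concentrated K' m'" and K: "compact K" "compact K'"
    and m: "0 \<le> m" "0 \<le> m'" and h: "h \<in> borel_measurable borel" "continuous_on (K \<times> K') h"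
  shows "integrable (\<mu> \<Otimes>\<^sub>M \<nu>) h"
proof -
  note c = concentrated_pair[OF \<mu> \<nu> K m]
  interpret finite_measure "\<mu> \<Otimes>\<^sub>M \<nu>" by (rule c)
  obtain B where B: "\<And>p. p \<in> K \<times> K' \<Longrightarrow> \<bar>h p\<bar> \<le> B"
    using compact_continuous_bound[OF compact_Times[OF K] h(2)] by blast
  show ?thesis
  proof (rule integrable_const_bound[of _ B])
    show "AE p in \<mu> \<Otimes>\<^sub>M \<nu>. norm (h p) \<le> B"
      using c(4) by eventually_elim (use B in simp)
    show "h \<in> borel_measurable (\<mu> \<Otimes>\<^sub>M \<nu>)"
      using h(1) by (simp add: measurable_cong_sets[OF c(2) refl])
  qed
qed

text \<open>For tensors this is Fubini and the product of two limits. A general h is uniformly close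
  to a tensor on \<open>K1 \<times> K2\<close>, where all measures live, and their masses are
  bounded by \<open>m1 * m2\<close>. Continuity on that product alone is what a kernel continuous
  off the diagonal can offer.\<close>

lemma tendsto_integral_pair:
  fixes \<mu>1 \<mu>2 :: "'a::{metric_space,second_countable_topology} measure" and \<nu>1 \<nu>2 :: "'t \<Rightarrow> 'a measure"
  assumes K: "compact K1" "compact K2" and m: "0 \<le> m1" "0 \<le> m2"
    and ev: "eventually (\<lambda>t. \<nu>1 t \<in> concentrated K1 m1) F" "eventually (\<lambda>t. \<nu>2 t \<in> concentrated K2 m2) F"
    and \<mu>: "\<mu>1 \<in> concentrated K1 m1" "\<mu>2 \<in> concentrated K2 m2"
    and lim1: "\<And>\<phi> :: 'a \<Rightarrow> real. continuous_on UNIV \<phi> \<Longrightarrow> ((\<lambda>t. \<integral>x. \<phi> x \<partial>\<nu>1 t) \<longlongrightarrow> (\<integral>x. \<phi> x \<partial>\<mu>1)) F"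
    and lim2: "\<And>\<phi> :: 'a \<Rightarrow> real. continuous_on UNIV \<phi> \<Longrightarrow> ((\<lambda>t. \<integral>x. \<phi> x \<partial>\<nu>2 t) \<longlongrightarrow> (\<integral>x. \<phi> x \<partial>\<mu>2)) F"
    and h: "h \<in> borel_measurable borel" "continuous_on (K1 \<times> K2) h"
  shows "((\<lambda>t. \<integral>p. h p \<partial>(\<nu>1 t \<Otimes>\<^sub>M \<nu>2 t)) \<longlongrightarrow> (\<integral>p. (h p :: real) \<partial>(\<mu>1 \<Otimes>\<^sub>M \<mu>2))) F"
proof -
  note int = integrable_pair_concentrated[OF _ _ K m]
  have qint: "integrable (\<eta>1 \<Otimes>\<^sub>M \<eta>2) q" if "q \<in> tensors" "\<eta>1 \<in> concentrated K1 m1" "\<eta>2 \<in> concentrated K2 m2" for q \<eta>1 \<eta>2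
    using int[OF that(2,3) borel_measurable_continuous_onI[OF tensors_continuous[OF that(1)]]]
      continuous_on_subset[OF tensors_continuous[OF that(1)]] by blast
  have q: "((\<lambda>t. \<integral>p. q p \<partial>(\<nu>1 t \<Otimes>\<^sub>M \<nu>2 t)) \<longlongrightarrow> (\<integral>p. q p \<partial>(\<mu>1 \<Otimes>\<^sub>M \<mu>2))) F" if "q \<in> tensors" for q
    using that
  proof induction
    case (tensor_prod \<phi> \<psi>)
    have *: "(\<integral>p. \<phi> (fst p) * \<psi> (snd p) \<partial>(\<eta>1 \<Otimes>\<^sub>M \<eta>2)) = (\<integral>x. \<phi> x \<partial>\<eta>1) * (\<integral>y. \<psi> y \<partial>\<eta>2)"
      if "\<eta>1 \<in> concentrated K1 m1" "\<eta>2 \<in> concentrated K2 m2" for \<eta>1 \<eta>2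
    proof -
      interpret pair_sigma_finite \<eta>1 \<eta>2 by (rule concentrated_pair(7)[OF that K m])
      have "(\<integral>x. (\<integral>y. \<phi> (fst (x, y)) * \<psi> (snd (x, y)) \<partial>\<eta>2) \<partial>\<eta>1) = (\<integral>p. \<phi> (fst p) * \<psi> (snd p) \<partial>(\<eta>1 \<Otimes>\<^sub>M \<eta>2))"
        by (rule integral_fst'[OF qint[OF tensors.tensor_prod[OF tensor_prod] that]])
      then show ?thesis by simp
    qed
    have "eventually (\<lambda>t. (\<integral>p. \<phi> (fst p) * \<psi> (snd p) \<partial>(\<nu>1 t \<Otimes>\<^sub>M \<nu>2 t)) = (\<integral>x. \<phi> x \<partial>\<nu>1 t) * (\<integral>y. \<psi> y \<partial>\<nu>2 t)) F"
      using ev by eventually_elim (rule *)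
    moreover have "((\<lambda>t. (\<integral>x. \<phi> x \<partial>\<nu>1 t) * (\<integral>y. \<psi> y \<partial>\<nu>2 t)) \<longlongrightarrow> (\<integral>x. \<phi> x \<partial>\<mu>1) * (\<integral>y. \<psi> y \<partial>\<mu>2)) F"
      by (intro tendsto_mult lim1 lim2 tensor_prod)
    ultimately show ?case using *[OF \<mu>] by (simp add: tendsto_cong)
  next
    case (tensor_add q r)
    have "eventually (\<lambda>t. (\<integral>p. q p + r p \<partial>(\<nu>1 t \<Otimes>\<^sub>M \<nu>2 t)) =
        (\<integral>p. q p \<partial>(\<nu>1 t \<Otimes>\<^sub>M \<nu>2 t)) + (\<integral>p. r p \<partial>(\<nu>1 t \<Otimes>\<^sub>M \<nu>2 t))) F"
      using ev by eventually_elim (intro Bochner_Integration.integral_add qint tensor_add)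
    moreover have "(\<integral>p. q p + r p \<partial>(\<mu>1 \<Otimes>\<^sub>M \<mu>2)) = (\<integral>p. q p \<partial>(\<mu>1 \<Otimes>\<^sub>M \<mu>2)) + (\<integral>p. r p \<partial>(\<mu>1 \<Otimes>\<^sub>M \<mu>2))"
      by (intro Bochner_Integration.integral_add qint tensor_add \<mu>)
    moreover have "((\<lambda>t. (\<integral>p. q p \<partial>(\<nu>1 t \<Otimes>\<^sub>M \<nu>2 t)) + (\<integral>p. r p \<partial>(\<nu>1 t \<Otimes>\<^sub>M \<nu>2 t))) \<longlongrightarrow>
        (\<integral>p. q p \<partial>(\<mu>1 \<Otimes>\<^sub>M \<mu>2)) + (\<integral>p. r p \<partial>(\<mu>1 \<Otimes>\<^sub>M \<mu>2))) F"
      by (intro tendsto_add tensor_add)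
    ultimately show ?case by (simp add: tendsto_cong)
  qed
  show ?thesis
  proof (rule tendsto_uniform_approx)
    fix e :: real assume e: "0 < e"
    \<comment> \<open>Makes \<open>d * (m1 * m2)\<close> at most e; the added 1 avoids division by
      zero.\<close>
    define d where "d = e / (1 + m1 * m2)"
    have d: "0 < d" "d * (m1 * m2) \<le> e" using e m by (auto simp: d_def field_simps add_pos_nonneg)
    obtain q where qt: "q \<in> tensors" "\<And>p. p \<in> K1 \<times> K2 \<Longrightarrow> \<bar>h p - q p\<bar> < d"
      using tensors_dense[OF K h(2) d(1)] by blast
    have bd: "\<bar>(\<integral>p. h p \<partial>(\<eta>1 \<Otimes>\<^sub>M \<eta>2)) - (\<integral>p. q p \<partial>(\<eta>1 \<Otimes>\<^sub>M \<eta>2))\<bar> \<le> e"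
      if "\<eta>1 \<in> concentrated K1 m1" "\<eta>2 \<in> concentrated K2 m2" for \<eta>1 \<eta>2
    proof -
      note c = concentrated_pair[OF that K m]
      have "AE p in \<eta>1 \<Otimes>\<^sub>M \<eta>2. \<bar>h p - q p\<bar> \<le> d"
        using c(4) by eventually_elim (use qt(2) in \<open>auto intro: less_imp_le\<close>)
      then have "\<bar>(\<integral>p. h p \<partial>(\<eta>1 \<Otimes>\<^sub>M \<eta>2)) - (\<integral>p. q p \<partial>(\<eta>1 \<Otimes>\<^sub>M \<eta>2))\<bar> \<le> d * measure (\<eta>1 \<Otimes>\<^sub>M \<eta>2) UNIV"
        using integral_diff_bound[OF c(1) int[OF that h] qint[OF qt(1) that]] by (simp add: c(3))
      also have "\<dots> \<le> d * (m1 * m2)" using c(6) d(1) by (intro mult_left_mono) auto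
      finally show ?thesis using d(2) by linarith
    qed
    show "\<exists>u l'. (u \<longlongrightarrow> l') F \<and> \<bar>(\<integral>p. h p \<partial>(\<mu>1 \<Otimes>\<^sub>M \<mu>2)) - l'\<bar> \<le> e \<and>
        eventually (\<lambda>t. \<bar>(\<integral>p. h p \<partial>(\<nu>1 t \<Otimes>\<^sub>M \<nu>2 t)) - u t\<bar> \<le> e) F"
    proof (intro exI conjI)
      show "((\<lambda>t. \<integral>p. q p \<partial>(\<nu>1 t \<Otimes>\<^sub>M \<nu>2 t)) \<longlongrightarrow> (\<integral>p. q p \<partial>(\<mu>1 \<Otimes>\<^sub>M \<mu>2))) F" by (rule q[OF qt(1)])
      show "\<bar>(\<integral>p. h p \<partial>(\<mu>1 \<Otimes>\<^sub>M \<mu>2)) - (\<integral>p. q p \<partial>(\<mu>1 \<Otimes>\<^sub>M \<mu>2))\<bar> \<le> e" by (rule bd[OF \<mu>])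
      show "eventually (\<lambda>t. \<bar>(\<integral>p. h p \<partial>(\<nu>1 t \<Otimes>\<^sub>M \<nu>2 t)) - (\<integral>p. q p \<partial>(\<nu>1 t \<Otimes>\<^sub>M \<nu>2 t))\<bar> \<le> e) F"
        using ev by eventually_elim (rule bd)
    qed
  qed
qed

subsection \<open>Lower semicontinuity of integrals\<close>

text \<open>Lipschitz regularization: the infimal convolution of the truncation
  \<open>min w n\<close> with n times the distance. It is n-Lipschitz and increases with n because
  both the truncation and the penalty do. The truncation keeps it finite and bounded, hence
  integrable for finite measures.\<close>

lemma lsc_increasing_approximation:
  fixes w :: "'b::metric_space \<Rightarrow> ennreal"
  assumes lsc: "\<And>c. open {x. c < w x}"
  shows "\<exists>h :: nat \<Rightarrow> 'b \<Rightarrow> real. (\<forall>n. continuous_on UNIV (h n)) \<and> (\<forall>n x. 0 \<le> h n x) \<and> (\<forall>n x. h n x \<le> real n)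
    \<and> (\<forall>x. incseq (\<lambda>n. h n x)) \<and> (\<forall>x. (SUP n. ennreal (h n x)) = w x)"
proof -
  define v where "v n x = enn2real (min (w x) (of_nat n))" for n :: nat and x
  have v0: "0 \<le> v n x" for n x by (simp add: v_def)
  have ev: "ennreal (v n x) = min (w x) (of_nat n)" for n x
    unfolding v_def by (rule ennreal_enn2real) (auto simp: min_less_iff_disj of_nat_less_top)
  have vn: "v n x \<le> real n" for n x
  proof -
    have "ennreal (v n x) \<le> ennreal (real n)" by (simp add: ev ennreal_of_nat_eq_real_of_nat)
    then show ?thesis by simp
  qed
  have vmono: "v n x \<le> v (Suc n) x" for n x
  proof -
    have "ennreal (v n x) \<le> ennreal (v (Suc n) x)"
      unfolding ev by (intro min.mono order_refl of_nat_mono) simp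
    then show ?thesis using v0 by simp
  qed
  define h where "h n x = (INF q. v n q + real n * dist x q)" for n x
  have bdd: "bdd_below (range (\<lambda>q. v n q + real n * dist x q))" for n x
    by (rule bdd_belowI[of _ 0]) (auto simp: v0)
  have h_le: "h n x \<le> v n q + real n * dist x q" for n x q
    unfolding h_def by (rule cINF_lower[OF bdd]) simp
  have h_ge: "b \<le> h n x" if "\<And>q. b \<le> v n q + real n * dist x q" for b n x
    unfolding h_def by (rule cINF_greatest) (use that in auto)
  have h0: "0 \<le> h n x" for n x by (rule h_ge) (simp add: v0)
  have hv: "h n x \<le> v n x" for n x using h_le[of n x x] by simp
  have lip: "h n x - real n * dist x y \<le> h n y" for n x y
  proof (rule h_ge)
    fix q
    have "real n * dist x q \<le> real n * (dist x y + dist y q)"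
      by (intro mult_left_mono dist_triangle) simp
    then show "h n x - real n * dist x y \<le> v n q + real n * dist y q"
      using h_le[of n x q] by (simp add: distrib_left)
  qed
  have cont: "continuous_on UNIV (h n)" for n
    unfolding continuous_on_iff
  proof (intro ballI allI impI)
    fix x and e :: real assume e: "0 < e"
    show "\<exists>d>0. \<forall>x'\<in>UNIV. dist x' x < d \<longrightarrow> dist (h n x') (h n x) < e"
    proof (intro exI[of _ "e / (real n + 1)"] conjI ballI impI)
      show "0 < e / (real n + 1)" using e by (simp add: add_nonneg_pos)
      fix y assume d: "dist y x < e / (real n + 1)"
      have "\<bar>h n y - h n x\<bar> \<le> real n * dist y x"
        using lip[of n x y] lip[of n y x] by (simp add: abs_le_iff dist_commute)
      also have "\<dots> \<le> (real n + 1) * dist y x" by (simp add: distrib_right)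
      also have "\<dots> < e" using d by (simp add: field_simps add_nonneg_pos)
      finally show "dist (h n y) (h n x) < e" by (simp add: dist_real_def)
    qed
  qed
  have inc: "incseq (\<lambda>n. h n x)" for x
  proof (rule incseq_SucI)
    fix n
    show "h n x \<le> h (Suc n) x"
    proof (rule h_ge)
      fix q
      have "real n * dist x q \<le> real (Suc n) * dist x q" by (intro mult_right_mono) auto
      then show "h n x \<le> v (Suc n) q + real (Suc n) * dist x q"
        using h_le[of n x q] vmono[of n q] by linarith
    qed
  qed
  have sup: "(SUP n. ennreal (h n x)) = w x" for x
  proof (rule antisym)
    have "ennreal (h n x) \<le> w x" for n
      using ennreal_leI[OF hv[of n x]] by (simp add: ev)
    then show "(SUP n. ennreal (h n x)) \<le> w x" by (rule SUP_least)
    show "w x \<le> (SUP n. ennreal (h n x))"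
    proof (rule dense_le)
      fix c assume c: "c < w x"
      have ct: "c < top" by (rule order_less_le_trans[OF c top_greatest])
      obtain r where r: "0 < r" "\<And>q. dist q x < r \<Longrightarrow> c < w q"
        using lsc[of c] c unfolding open_dist by auto
      define C where "C = enn2real c"
      have C: "c = ennreal C" "0 \<le> C" using ct by (simp_all add: C_def)
      \<comment> \<open>\<open>C \<le> n\<close> keeps the truncation harmless inside the ball where
        w exceeds c; \<open>C / r \<le> n\<close> makes the penalty alone reach C outside
        it.\<close>
      obtain n :: nat where n: "max C (C / r) \<le> real n" using real_arch_simple by blast
      have "C \<le> h n x"
      proof (rule h_ge)
        fix q
        show "C \<le> v n q + real n * dist x q"
        proof (cases "dist q x < r")
          case True
          have "ennreal C \<le> ennreal (v n q)"
            using r(2)[OF True] n C by (simp add: ev ennreal_of_nat_eq_real_of_nat min_le_iff_disj less_imp_le)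
          then have "C \<le> v n q" using v0 by simp
          then show ?thesis by (simp add: add_increasing2)
        next
          case False
          then have "C / r * r \<le> real n * dist x q"
            using n r(1) C(2) by (intro mult_mono) (auto simp: dist_commute)
          then show ?thesis using v0[of n q] r(1) by simp
        qed
      qed
      then have "c \<le> ennreal (h n x)" unfolding C(1) by (rule ennreal_leI)
      also have "\<dots> \<le> (SUP n. ennreal (h n x))" by (rule SUP_upper) simp
      finally show "c \<le> (SUP n. ennreal (h n x))" .
    qed
  qed
  have "h n x \<le> real n" for n x using hv[of n x] vn[of n x] by linarith
  then show ?thesis using cont h0 inc sup by blast
qed

text \<open>This says that l is at most the lower limit of u along F, in terms of strict lower
  bounds, so that no lower limit has to be computed.\<close>

definition lsc_along :: "'t filter \<Rightarrow> ('t \<Rightarrow> ennreal) \<Rightarrow> ennreal \<Rightarrow> bool" where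
  "lsc_along F u l \<longleftrightarrow> (\<forall>c<l. eventually (\<lambda>t. c < u t) F)"

lemma lsc_along_add:
  assumes u: "lsc_along F u l" and v: "lsc_along F v k"
  shows "lsc_along F (\<lambda>t. u t + v t) (l + k)"
  unfolding lsc_along_def
proof (intro allI impI)
  fix c assume c: "c < l + k"
  show "eventually (\<lambda>t. c < u t + v t) F"
  \<comment> \<open>Otherwise c is split between a value strictly below l and one strictly below k.
    If one of them is 0 nothing lies strictly below it, but then c is below the other one.\<close>
  proof (cases "l = 0 \<or> k = 0")
    case True
    then consider "c < l" | "c < k" using c by auto
    then show ?thesis
    proof cases
      case 1
      then have "eventually (\<lambda>t. c < u t) F" using u by (simp add: lsc_along_def)
      then show ?thesis by eventually_elim (erule order.strict_trans2, simp add: add_increasing2)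
    next
      case 2
      then have "eventually (\<lambda>t. c < v t) F" using v by (simp add: lsc_along_def)
      then show ?thesis by eventually_elim (erule order.strict_trans2, simp add: add_increasing)
    qed
  next
    case False
    then have "0 \<in> {..<l}" "0 \<in> {..<k}" by (auto simp: zero_less_iff_neq_zero)
    then have ne: "{..<l} \<noteq> {}" "{..<k} \<noteq> {}" by auto
    have "l + k = (SUP x\<in>{..<l}. x) + k" by simp
    also have "\<dots> = (SUP x\<in>{..<l}. x + k)" using ne by (intro ennreal_SUP_add_left[symmetric]) 
    finally obtain x where x: "x < l" "c < x + k" using c by (auto simp: less_SUP_iff)
    have "x + k = x + (SUP y\<in>{..<k}. y)" by simp
    also have "\<dots> = (SUP y\<in>{..<k}. x + y)" using ne by (intro ennreal_SUP_add_right)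
    finally obtain y where y: "y < k" "c < x + y" using x by (auto simp: less_SUP_iff)
    have "eventually (\<lambda>t. x < u t) F" "eventually (\<lambda>t. y < v t) F"
      using u v x y by (auto simp: lsc_along_def)
    then show ?thesis
      by eventually_elim (rule order.strict_trans2[OF y(2)], intro add_mono less_imp_le)
  qed
qed

lemma lsc_along_sum:
  assumes "finite J" "\<And>j. j \<in> J \<Longrightarrow> lsc_along F (u j) (l j)"
  shows "lsc_along F (\<lambda>t. \<Sum>j\<in>J. u j t) (\<Sum>j\<in>J. l j)"
  using assms
proof (induction rule: finite_induct)
  case empty
  then show ?case by (simp add: lsc_along_def)
next
  case (insert j J)
  then show ?case using lsc_along_add[of F "u j" "l j"] by simp
qed

lemma lsc_along_le:
  assumes u: "lsc_along F u l" and F: "F \<noteq> bot"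
    and le: "eventually (\<lambda>t. u t \<le> ennreal (b t)) F" and b: "(b \<longlongrightarrow> B) F"
  shows "l \<le> ennreal B"
proof (rule ccontr)
  assume "\<not> l \<le> ennreal B"
  then have "ennreal B < l" by (simp add: not_le)
  from dense[OF this] obtain c where c: "ennreal B < c" "c < l" by blast
  have "eventually (\<lambda>t. c < u t) F" using u c by (simp add: lsc_along_def)
  moreover have "eventually (\<lambda>t. ennreal (b t) < c) F"
    using order_tendstoD(2)[OF tendsto_ennrealI[OF b] c(1)] .
  ultimately have "eventually (\<lambda>t. False) F"
    using le
  proof eventually_elim
    case (elim t)
    have "c < c" by (rule order.strict_trans[OF order.strict_trans2[OF elim(1,3)] elim(2)])
    then show False by simp
  qed
  then show False using F by (simp add: trivial_limit_def)
qed

text \<open>By monotone convergence some bounded continuous function below w already has integral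
  above c with respect to M. Convergence for this one function suffices.\<close>

lemma lsc_along_nn_integral:
  fixes w :: "'b::metric_space \<Rightarrow> ennreal" and N :: "'t \<Rightarrow> 'b measure"
  assumes lsc: "\<And>c. open {x. c < w x}"
    and N: "eventually (\<lambda>t. finite_measure (N t) \<and> sets (N t) = sets borel) F"
    and M: "finite_measure M" "sets M = sets borel"
    and lim: "\<And>h :: 'b \<Rightarrow> real. continuous_on UNIV h \<Longrightarrow> ((\<lambda>t. \<integral>x. h x \<partial>N t) \<longlongrightarrow> (\<integral>x. h x \<partial>M)) F"
  shows "lsc_along F (\<lambda>t. \<integral>\<^sup>+x. w x \<partial>N t) (\<integral>\<^sup>+x. w x \<partial>M)"
  unfolding lsc_along_def
proof (intro allI impI)
  obtain h :: "nat \<Rightarrow> 'b \<Rightarrow> real" where h: "\<And>n. continuous_on UNIV (h n)" "\<And>n x. 0 \<le> h n x" "\<And>n x. h n x \<le> real n"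
    "\<And>x. incseq (\<lambda>n. h n x)" "\<And>x. (SUP n. ennreal (h n x)) = w x"
    using lsc_increasing_approximation[OF lsc] by blast
  have int: "(\<integral>\<^sup>+x. ennreal (h n x) \<partial>L) = ennreal (\<integral>x. h n x \<partial>L)"
    if L: "finite_measure L" "sets L = sets borel" for L n
  proof -
    interpret finite_measure L by fact
    have m: "h n \<in> borel_measurable L"
      using borel_measurable_continuous_onI[OF h(1)] by (simp add: measurable_cong_sets[OF L(2) refl])
    have "integrable L (h n)"
      by (rule integrable_const_bound[of _ "real n"]) (use h m in auto)
    then show ?thesis using h(2) by (intro nn_integral_eq_integral) auto
  qed
  fix c assume "c < (\<integral>\<^sup>+x. w x \<partial>M)"
  also have "(\<integral>\<^sup>+x. w x \<partial>M) = (\<integral>\<^sup>+x. (SUP n. ennreal (h n x)) \<partial>M)" by (simp add: h(5))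
  also have "\<dots> = (SUP n. \<integral>\<^sup>+x. ennreal (h n x) \<partial>M)"
  proof (rule nn_integral_monotone_convergence_SUP)
    show "incseq (\<lambda>n x. ennreal (h n x))"
      using h(4) by (auto simp: incseq_def le_fun_def intro!: ennreal_leI)
    show "(\<lambda>x. ennreal (h n x)) \<in> borel_measurable M" for n
      using borel_measurable_continuous_onI[OF h(1)[of n]] by (simp add: measurable_cong_sets[OF M(2) refl])
  qed
  finally obtain n where n: "c < ennreal (\<integral>x. h n x \<partial>M)" by (auto simp: less_SUP_iff int[OF M])
  have "eventually (\<lambda>t. c < ennreal (\<integral>x. h n x \<partial>N t)) F"
    using order_tendstoD(1)[OF tendsto_ennrealI[OF lim[OF h(1)]] n] .
  with N show "eventually (\<lambda>t. c < (\<integral>\<^sup>+x. w x \<partial>N t)) F"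
  proof eventually_elim
    case (elim t)
    have "ennreal (h n x) \<le> w x" for x
      unfolding h(5)[symmetric] by (rule SUP_upper) simp
    then have "(\<integral>\<^sup>+x. ennreal (h n x) \<partial>N t) \<le> (\<integral>\<^sup>+x. w x \<partial>N t)" by (intro nn_integral_mono)
    with elim show ?case using int[of "N t" n] by (auto intro: order.strict_trans2)
  qed
qed

subsection \<open>Integrals of functions bounded below\<close>

text \<open>On a compact space the open sets where \<psi> exceeds -n form an increasing cover. The
  last clause records that a nonzero shift occurs only there, which later makes the shifts summable
  over the plates.\<close>

lemma Psi_lower_bound:
  fixes \<psi> :: "'b::topological_space \<Rightarrow> ereal"
  assumes "\<psi> \<in> Psi"
  shows "\<exists>c\<ge>0. (\<forall>x. ereal (- c) \<le> \<psi> x) \<and> (compact (UNIV :: 'b set) \<or> c = 0)"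
proof (cases "compact (UNIV :: 'b set)")
  case False
  then show ?thesis using assms by (intro exI[of _ 0]) (simp add: Psi_def flip: zero_ereal_def)
next
  case True
  have op: "open {x. ereal (- real n) < \<psi> x}" for n using assms by (simp add: Psi_def)
  have "UNIV \<subseteq> (\<Union>n\<in>UNIV. {x. ereal (- real n) < \<psi> x})"
  proof
    fix x
    have "\<psi> x \<noteq> -\<infinity>" using assms by (simp add: Psi_def)
    then show "x \<in> (\<Union>n\<in>UNIV. {x. ereal (- real n) < \<psi> x})"
    proof (cases "\<psi> x")
      case (real r)
      obtain n :: nat where "- r < real n" using reals_Archimedean2 by blast
      then show ?thesis using real by (auto intro!: exI[of _ n])
    qed auto
  qed
  then obtain D where D: "finite D" "UNIV \<subseteq> (\<Union>n\<in>D. {x. ereal (- real n) < \<psi> x})"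
    using compactE_image[OF True, of UNIV "\<lambda>n. {x. ereal (- real n) < \<psi> x}"] op by metis
  define N where "N = Max (insert 0 D)"
  have "ereal (- real N) \<le> \<psi> x" for x
  proof -
    obtain n where n: "n \<in> D" "ereal (- real n) < \<psi> x" using D(2) by blast
    have "n \<le> N" using n(1) D(1) by (simp add: N_def)
    then have "ereal (- real N) \<le> ereal (- real n)" by simp
    then show ?thesis using n(2) by (meson order.strict_implies_order order_trans)
  qed
  then show ?thesis using True by (intro exI[of _ "real N"]) simp
qed

lemma Psi_measurable:
  assumes "\<psi> \<in> Psi"
  shows "\<psi> \<in> borel_measurable borel"
  by (rule borel_measurableI_greater) (use assms in \<open>simp add: Psi_def\<close>)

text \<open>The shifted function is nonnegative, so \<open>e2ennreal\<close> truncates nothing and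
  its superlevel set is that of \<psi> at the level lowered by c.\<close>

lemma Psi_shift_lsc:
  assumes \<psi>: "\<psi> \<in> Psi" and b: "\<And>x. ereal (- c) \<le> \<psi> x"
  shows "open {x. k < e2ennreal (\<psi> x + ereal c)}"
proof -
  have "k < e2ennreal (\<psi> x + ereal c) \<longleftrightarrow> enn2ereal k - ereal c < \<psi> x" for x
  proof -
    have "0 \<le> \<psi> x + ereal c" using b[of x] by (cases "\<psi> x") auto
    then have "k < e2ennreal (\<psi> x + ereal c) \<longleftrightarrow> enn2ereal k < \<psi> x + ereal c"
      by (metis enn2ereal_e2ennreal less_ennreal.rep_eq)
    also have "\<dots> \<longleftrightarrow> enn2ereal k - ereal c < \<psi> x"
      by (cases "\<psi> x"; cases "enn2ereal k") auto
    finally show ?thesis .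
  qed
  then show ?thesis using \<psi> by (simp add: Psi_def)
qed

text \<open>Pointwise, \<psi> + c plus the negative part of \<psi> equals the positive part of
  \<psi> plus c. Integrate this and cancel: the negative part is at most c and the measure is
  finite, so only the positive part can have an infinite integral.\<close>

lemma pairing_shift:
  assumes M: "finite_measure M" and \<psi>: "\<psi> \<in> borel_measurable M" and c: "0 \<le> c"
    and b: "\<And>x. ereal (- c) \<le> \<psi> x"
  shows "pairing \<psi> M = enn2ereal (\<integral>\<^sup>+x. e2ennreal (\<psi> x + ereal c) \<partial>M) - ereal (c * measure M (space M))"
proof -
  interpret finite_measure M by fact
  let ?W = "\<integral>\<^sup>+x. e2ennreal (\<psi> x + ereal c) \<partial>M" and ?P = "\<integral>\<^sup>+x. e2ennreal (\<psi> x) \<partial>M"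
    and ?N = "\<integral>\<^sup>+x. e2ennreal (- \<psi> x) \<partial>M"
  have pt: "e2ennreal (\<psi> x + ereal c) + e2ennreal (- \<psi> x) = e2ennreal (\<psi> x) + ennreal c" for x
  proof (cases "\<psi> x")
    case (real r)
    then have "- c \<le> r" using b[of x] by simp
    then show ?thesis
      using real c by (cases "0 \<le> r") (auto simp: e2ennreal_ereal ennreal_neg simp flip: ennreal_plus)
  qed (use b[of x] in auto)
  have m: "(\<lambda>x. e2ennreal (\<psi> x + ereal c)) \<in> borel_measurable M" "(\<lambda>x. e2ennreal (- \<psi> x)) \<in> borel_measurable M"
    "(\<lambda>x. e2ennreal (\<psi> x)) \<in> borel_measurable M"
    using \<psi> by measurable
  have "?W + ?N = (\<integral>\<^sup>+x. e2ennreal (\<psi> x + ereal c) + e2ennreal (- \<psi> x) \<partial>M)"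
    using m by (intro nn_integral_add[symmetric])
  also have "\<dots> = (\<integral>\<^sup>+x. e2ennreal (\<psi> x) + ennreal c \<partial>M)" by (simp add: pt)
  also have "\<dots> = ?P + ennreal (c * measure M (space M))"
    using m c by (simp add: nn_integral_add emeasure_eq_measure ennreal_mult)
  finally have eq: "?W + ?N = ?P + ennreal (c * measure M (space M))" .
  have "e2ennreal (- \<psi> x) \<le> ennreal c" for x
    using b[of x] by (cases "\<psi> x") (auto simp: e2ennreal_ereal e2ennreal_neg intro!: ennreal_leI)
  then have "?N \<le> (\<integral>\<^sup>+x. ennreal c \<partial>M)" by (intro nn_integral_mono)
  also have "\<dots> < top" by (simp add: emeasure_eq_measure ennreal_mult_less_top)
  finally have "?N < top" .
  then obtain n where n: "?N = ennreal n" "0 \<le> n" by (cases ?N) auto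
  have k: "0 \<le> c * measure M (space M)" using c by simp
  show ?thesis
  proof (cases ?P)
    case (real p)
    then have "?W < top" using eq n k by (cases ?W) (auto simp flip: ennreal_plus)
    then obtain w where w: "?W = ennreal w" "0 \<le> w" by (cases ?W) auto
    have "w + n = p + c * measure M (space M)"
      using eq real n w k by (simp flip: ennreal_plus)
    then show ?thesis unfolding pairing_def using real n w by (simp add: enn2ereal_ennreal)
  next
    case top
    then have "?W = top" using eq n by (cases ?W) (auto simp flip: ennreal_plus)
    then show ?thesis unfolding pairing_def using top n by (simp add: enn2ereal_ennreal)
  qed
qed

text \<open>The alternative in the second claim is there because \<open>real_of_ereal\<close> and
  \<open>enn2real\<close> send infinite values to 0.\<close>

lemma pairing_shift_finite:
  assumes M: "finite_measure M" and \<psi>: "\<psi> \<in> borel_measurable M" and c: "0 \<le> c"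
    and b: "\<And>x. ereal (- c) \<le> \<psi> x"
  shows "\<bar>pairing \<psi> M\<bar> \<noteq> \<infinity> \<longleftrightarrow> (\<integral>\<^sup>+x. e2ennreal (\<psi> x + ereal c) \<partial>M) < top"
    and "real_of_ereal (pairing \<psi> M) =
      enn2real (\<integral>\<^sup>+x. e2ennreal (\<psi> x + ereal c) \<partial>M) - c * measure M (space M)
      \<or> \<bar>pairing \<psi> M\<bar> = \<infinity>"
  unfolding pairing_shift[OF assms]
  by (cases "\<integral>\<^sup>+x. e2ennreal (\<psi> x + ereal c) \<partial>M"; simp add: enn2ereal_ennreal)+

lemma pairing_integrable:
  assumes h: "integrable M h" and eq: "AE x in M. \<psi> x = ereal (h x)"
  shows "pairing \<psi> M = ereal (\<integral>x. h x \<partial>M)"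
proof -
  have "(\<integral>\<^sup>+x. e2ennreal (\<psi> x) \<partial>M) = (\<integral>\<^sup>+x. ennreal (h x) \<partial>M)"
    by (rule nn_integral_cong_AE) (use eq in \<open>eventually_elim, simp add: e2ennreal_ereal\<close>)
  moreover have "(\<integral>\<^sup>+x. e2ennreal (- \<psi> x) \<partial>M) = (\<integral>\<^sup>+x. ennreal (- h x) \<partial>M)"
    by (rule nn_integral_cong_AE) (use eq in \<open>eventually_elim, simp add: e2ennreal_ereal\<close>)
  moreover obtain p where "(\<integral>\<^sup>+x. ennreal (h x) \<partial>M) = ennreal p" "0 \<le> p"
    using integrableD(2)[OF h] by (cases "\<integral>\<^sup>+x. ennreal (h x) \<partial>M") auto
  moreover obtain n where "(\<integral>\<^sup>+x. ennreal (- h x) \<partial>M) = ennreal n" "0 \<le> n"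
    using integrableD(3)[OF h] by (cases "\<integral>\<^sup>+x. ennreal (- h x) \<partial>M") auto
  ultimately show ?thesis
    unfolding pairing_def real_lebesgue_integral_def[OF h] by (simp add: enn2ereal_ennreal)
qed

lemma pairing_finite_parts:
  assumes "\<bar>pairing \<psi> M\<bar> \<noteq> \<infinity>"
  shows "(\<integral>\<^sup>+x. e2ennreal (\<psi> x) \<partial>M) < top" "(\<integral>\<^sup>+x. e2ennreal (- \<psi> x) \<partial>M) < top"
  using assms unfolding pairing_def
  by (cases "\<integral>\<^sup>+x. e2ennreal (\<psi> x) \<partial>M"; cases "\<integral>\<^sup>+x. e2ennreal (- \<psi> x) \<partial>M"; simp add: enn2ereal_ennreal)+

subsection \<open>Sets of inner capacity zero\<close>

lemma radon_sigma_finite: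
  fixes \<nu> :: "'a::t2_space measure"
  assumes sc: "\<exists>\<K> :: 'a set set. countable \<K> \<and> (\<forall>K\<in>\<K>. compact K) \<and> \<Union>\<K> = UNIV" and \<nu>: "radon \<nu>"
  shows "sigma_finite_measure \<nu>"
proof
  from sc obtain \<K> :: "'a set set" where \<K>: "countable \<K>" "\<forall>K\<in>\<K>. compact K" "\<Union>\<K> = UNIV"
    by (elim exE conjE)
  note K = \<K>(1) bspec[OF \<K>(2)] \<K>(3)
  have "\<K> \<subseteq> sets \<nu>" using K(2) by (auto simp: radon_sets[OF \<nu>] intro!: borel_closed compact_imp_closed)
  moreover have "emeasure \<nu> K \<noteq> \<infinity>" if "K \<in> \<K>" for K
    using radon_compact_finite[OF \<nu> K(2)[OF that]] by simp
  ultimately show "\<exists>A. countable A \<and> A \<subseteq> sets \<nu> \<and> \<Union>A = space \<nu> \<and> (\<forall>a\<in>A. emeasure \<nu> a \<noteq> \<infinity>)"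
    using K by (intro exI[of _ \<K>]) (simp add: radon_space[OF \<nu>])
qed

lemma pairing_null: "emeasure M (space M) = 0 \<Longrightarrow> pairing \<psi> M = 0"
proof -
  assume z: "emeasure M (space M) = 0"
  have "(\<integral>\<^sup>+x. h x \<partial>M) = 0" for h
  proof -
    have "AE x in M. False" by (rule AE_I[of _ _ "space M"]) (use z in auto)
    then have "(\<integral>\<^sup>+x. h x \<partial>M) = (\<integral>\<^sup>+x. 0 \<partial>M)" by (intro nn_integral_cong_AE) auto
    then show ?thesis by simp
  qed
  then show ?thesis by (simp add: pairing_def)
qed

text \<open>The measure is regarded as a signed one whose negative part is the null measure, for
  which all mutual energies vanish.\<close>

lemma positive_definite_energy_nonneg:
  fixes \<kappa> :: "'a::{metric_space,second_countable_topology} \<times> 'a \<Rightarrow> ereal"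
  assumes pd: "pd_kernel \<kappa>" and \<nu>: "radon \<nu>" and fin: "\<bar>mutual_energy \<kappa> \<nu> \<nu>\<bar> \<noteq> \<infinity>"
  shows "0 \<le> mutual_energy \<kappa> \<nu> \<nu>"
proof -
  let ?z = "null_measure borel :: 'a measure"
  have fz: "finite_measure ?z" by (rule finite_measureI) simp
  interpret z: finite_measure ?z by (rule fz)
  have rz: "radon ?z"
    by (rule radon_if_compactly_concentrated[OF fz, of "{}"]) auto
  have sr: "signed_radon (\<nu>, ?z)"
    using \<nu> rz by (auto simp: signed_radon_def intro!: bexI[of _ UNIV])
  have 1: "mutual_energy \<kappa> ?z ?z = 0" "mutual_energy \<kappa> \<nu> ?z = 0"
  proof -
    have "emeasure (?z \<Otimes>\<^sub>M ?z) (space ?z \<times> space ?z) = 0"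
      by (subst z.emeasure_pair_measure_Times) auto
    then show "mutual_energy \<kappa> ?z ?z = 0"
      unfolding mutual_energy_def by (intro pairing_null) (simp add: space_pair_measure)
    have "emeasure (\<nu> \<Otimes>\<^sub>M ?z) (space \<nu> \<times> space ?z) = 0"
      by (subst z.emeasure_pair_measure_Times) auto
    then show "mutual_energy \<kappa> \<nu> ?z = 0"
      unfolding mutual_energy_def by (intro pairing_null) (simp add: space_pair_measure)
  qed
  have "positive_definite \<kappa>" using pd by (simp add: pd_kernel_def)
  from this[unfolded positive_definite_def, rule_format, OF sr disjI1]
  have "0 \<le> mutual_energy \<kappa> \<nu> \<nu> + mutual_energy \<kappa> ?z ?z - 2 * mutual_energy \<kappa> \<nu> ?z"
    using fin 1(1) by simp
  then show ?thesis using 1 by simp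
qed

text \<open>If E had positive measure, a normalized restriction of \<nu> would be a unit measure of
  finite energy carried by E. The infimum in the definition of the capacity would then be a
  nonnegative real number, and its inverse cannot be 0.\<close>

lemma null_if_zero_capacity:
  fixes \<kappa> :: "'a::{metric_space,second_countable_topology} \<times> 'a \<Rightarrow> ereal"
  assumes sc: "\<exists>\<K> :: 'a set set. countable \<K> \<and> (\<forall>K\<in>\<K>. compact K) \<and> \<Union>\<K> = UNIV"
    and pd: "pd_kernel \<kappa>" and \<nu>: "radon \<nu>" and fin: "\<bar>mutual_energy \<kappa> \<nu> \<nu>\<bar> \<noteq> \<infinity>"
    and E: "E \<in> sets borel" and cap: "inner_capacity \<kappa> E = 0"
  shows "emeasure \<nu> E = 0"
proof (rule ccontr)
  assume E0: "emeasure \<nu> E \<noteq> 0"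
  interpret sigma_finite_measure \<nu> by (rule radon_sigma_finite[OF sc \<nu>])
  note s = radon_sets[OF \<nu>] and sp = radon_space[OF \<nu>]
  from sc obtain \<K> :: "'a set set" where \<K>: "countable \<K>" "\<forall>K\<in>\<K>. compact K" "\<Union>\<K> = UNIV"
    by (elim exE conjE)
  note K = \<K>(1) bspec[OF \<K>(2)] \<K>(3)
  \<comment> \<open>E itself may have infinite measure; a member of the compact cover cuts out a
    part of finite positive measure.\<close>
  have "\<exists>K\<in>\<K>. emeasure \<nu> (E \<inter> K) \<noteq> 0"
  proof (rule ccontr)
    assume "\<not> ?thesis"
    then have "E \<inter> K \<in> null_sets \<nu>" if "K \<in> \<K>" for K
      using E compact_imp_closed[OF K(2)[OF that]] that by (auto simp: null_sets_def s)
    then have "(\<Union>K\<in>\<K>. E \<inter> K) \<in> null_sets \<nu>" by (intro null_sets_UN' K(1))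
    moreover have "(\<Union>K\<in>\<K>. E \<inter> K) = E" using K(3) by blast
    ultimately show False using E0 by auto
  qed
  then obtain K where KK: "K \<in> \<K>" "emeasure \<nu> (E \<inter> K) \<noteq> 0" by (rule bexE)
  have cK: "compact K" by (rule K(2)[OF KK(1)])
  define B where "B = E \<inter> K"
  have B: "B \<in> sets \<nu>" using E compact_imp_closed[OF cK] by (simp add: B_def s)
  have "emeasure \<nu> B \<le> emeasure \<nu> K"
    using compact_imp_closed[OF cK] by (intro emeasure_mono) (auto simp: B_def s)
  also have "\<dots> < \<infinity>" by (rule radon_compact_finite[OF \<nu> cK])
  finally obtain b where b: "emeasure \<nu> B = ennreal b" "0 \<le> b" by (cases "emeasure \<nu> B") auto
  have b0: "0 < b" using KK(2) b by (cases "b = 0") (auto simp: B_def)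
  \<comment> \<open>The density of the restriction to B, normalized to total mass 1.\<close>
  define d where "d x = ennreal (1 / b) * indicator B x" for x :: 'a
  have dm: "d \<in> borel_measurable \<nu>" unfolding d_def using B by measurable
  define \<eta> where "\<eta> = density \<nu> d"
  have e\<eta>: "emeasure \<eta> S = ennreal (1 / b) * emeasure \<nu> (B \<inter> S)" if "S \<in> sets borel" for S
  proof -
    have S: "S \<in> sets \<nu>" using that by (simp add: s)
    have "emeasure \<eta> S = (\<integral>\<^sup>+x. d x * indicator S x \<partial>\<nu>)"
      unfolding \<eta>_def by (rule emeasure_density[OF dm S])
    also have "\<dots> = (\<integral>\<^sup>+x. ennreal (1 / b) * indicator (B \<inter> S) x \<partial>\<nu>)"
      by (intro nn_integral_cong) (auto simp: d_def indicator_def)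
    also have "\<dots> = ennreal (1 / b) * emeasure \<nu> (B \<inter> S)"
      using B S by (intro nn_integral_cmult_indicator) auto
    finally show ?thesis .
  qed
  have s\<eta>: "sets \<eta> = sets borel" "space \<eta> = UNIV" by (simp_all add: \<eta>_def s sp)
  have one: "ennreal (1 / b) * ennreal b = 1" using b0 by (simp flip: ennreal_mult)
  have f\<eta>: "finite_measure \<eta>"
    using e\<eta>[of UNIV] b one by (intro finite_measureI) (simp add: s\<eta>)
  have r\<eta>: "radon \<eta>"
  proof (rule radon_if_compactly_concentrated[OF f\<eta> s\<eta>(1) cK])
    have "B \<inter> - K = {}" by (auto simp: B_def)
    then show "emeasure \<eta> (- K) = 0" using e\<eta>[of "- K"] compact_imp_closed[OF cK] by simp
  qed
  have "carried_by \<eta> E"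
    unfolding carried_by_def
  proof (intro allI impI)
    fix C :: "'a set" assume C: "compact C"
    have CE: "C - E \<in> sets borel" using E compact_imp_closed[OF C] by simp
    have "B \<inter> (C - E) = {}" by (auto simp: B_def)
    then have "C - E \<in> null_sets \<eta>" using e\<eta>[OF CE] CE by (simp add: null_sets_def s\<eta>)
    then show "C - E \<in> null_sets (completion \<eta>)" by (rule null_sets_completionI)
  qed
  then have on: "\<eta> \<in> radon_on E" using r\<eta> by (simp add: radon_on_def)
  interpret \<eta>: finite_measure \<eta> by (rule f\<eta>)
  have pm: "\<eta> \<Otimes>\<^sub>M \<eta> = density (\<nu> \<Otimes>\<^sub>M \<nu>) (\<lambda>(x, y). d x * d y)"
    unfolding \<eta>_def
    by (rule pair_measure_density[OF dm dm]) (use \<eta>.sigma_finite_measure_axioms in \<open>simp_all add: \<eta>_def sigma_finite_measure_axioms\<close>)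
  have km: "\<kappa> \<in> borel_measurable (\<nu> \<Otimes>\<^sub>M \<nu>)"
  proof -
    have "sets (\<nu> \<Otimes>\<^sub>M \<nu>) = sets borel"
      using sets_pair_measure_cong[OF s s] by (simp only: borel_prod)
    moreover have "\<kappa> \<in> Psi" using pd by (simp add: pd_kernel_def)
    ultimately show ?thesis
      using Psi_measurable[of \<kappa>] measurable_cong_sets[of "\<nu> \<Otimes>\<^sub>M \<nu>" borel borel "borel :: ereal measure"] by simp
  qed
  \<comment> \<open>The product density is at most the square of 1 / b, so the integrals of the
    positive and of the negative part of the kernel stay finite separately.\<close>
  have part: "(\<integral>\<^sup>+p. h p \<partial>(\<eta> \<Otimes>\<^sub>M \<eta>)) < top"
    if h: "h \<in> borel_measurable (\<nu> \<Otimes>\<^sub>M \<nu>)" "(\<integral>\<^sup>+p. h p \<partial>(\<nu> \<Otimes>\<^sub>M \<nu>)) < top" for h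
  proof -
    have "(\<lambda>(x, y). d x * d y) \<in> borel_measurable (\<nu> \<Otimes>\<^sub>M \<nu>)"
      using dm by measurable
    then have "(\<integral>\<^sup>+p. h p \<partial>(\<eta> \<Otimes>\<^sub>M \<eta>)) = (\<integral>\<^sup>+p. (case p of (x, y) \<Rightarrow> d x * d y) * h p \<partial>(\<nu> \<Otimes>\<^sub>M \<nu>))"
      unfolding pm using h(1) by (rule nn_integral_density)
    also have "\<dots> \<le> (\<integral>\<^sup>+p. ennreal (1 / b * (1 / b)) * h p \<partial>(\<nu> \<Otimes>\<^sub>M \<nu>))"
      using b0 by (intro nn_integral_mono mult_right_mono) (auto simp: d_def indicator_def ennreal_mult[symmetric] split: prod.split)
    also have "\<dots> = ennreal (1 / b * (1 / b)) * (\<integral>\<^sup>+p. h p \<partial>(\<nu> \<Otimes>\<^sub>M \<nu>))"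
      by (rule nn_integral_cmult[OF h(1)])
    also have "\<dots> < top" using h(2) by (simp add: ennreal_mult_less_top)
    finally show ?thesis .
  qed
  have fin\<eta>: "\<bar>mutual_energy \<kappa> \<eta> \<eta>\<bar> \<noteq> \<infinity>"
  proof -
    have "(\<integral>\<^sup>+p. e2ennreal (\<kappa> p) \<partial>(\<eta> \<Otimes>\<^sub>M \<eta>)) < top" "(\<integral>\<^sup>+p. e2ennreal (- \<kappa> p) \<partial>(\<eta> \<Otimes>\<^sub>M \<eta>)) < top"
      using pairing_finite_parts[OF fin[unfolded mutual_energy_def]] km by (auto intro!: part)
    then show ?thesis
      unfolding mutual_energy_def pairing_def
      by (cases "\<integral>\<^sup>+p. e2ennreal (\<kappa> p) \<partial>(\<eta> \<Otimes>\<^sub>M \<eta>)"; cases "\<integral>\<^sup>+p. e2ennreal (- \<kappa> p) \<partial>(\<eta> \<Otimes>\<^sub>M \<eta>)") (auto simp: enn2ereal_ennreal)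
  qed
  let ?S = "{\<nu> \<in> finite_energy_on \<kappa> E. emeasure (completion \<nu>) E = 1}"
  have "emeasure (completion \<eta>) E = 1"
  proof -
    have "B \<inter> E = B" by (auto simp: B_def)
    then show ?thesis using e\<eta>[OF E] E b one by (simp add: s\<eta>)
  qed
  then have "\<eta> \<in> ?S" using on fin\<eta> by (simp add: finite_energy_on_def)
  then have "(INF \<nu>\<in>?S. mutual_energy \<kappa> \<nu> \<nu>) \<le> mutual_energy \<kappa> \<eta> \<eta>" by (rule INF_lower)
  then have 1: "(INF \<nu>\<in>?S. mutual_energy \<kappa> \<nu> \<nu>) \<noteq> \<infinity>" using fin\<eta> by auto
  \<comment> \<open>Positive definiteness enters here: in \<open>ereal\<close> the inverse of
    -\<infinity> is 0 too, so the infimum has to be bounded from below.\<close>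
  have 2: "0 \<le> (INF \<nu>\<in>?S. mutual_energy \<kappa> \<nu> \<nu>)"
  proof (rule INF_greatest)
    fix \<mu> assume "\<mu> \<in> ?S"
    then show "0 \<le> mutual_energy \<kappa> \<mu> \<mu>"
      using positive_definite_energy_nonneg[OF pd, of \<mu>] by (simp add: finite_energy_on_def radon_on_def)
  qed
  have "inverse (INF \<nu>\<in>?S. mutual_energy \<kappa> \<nu> \<nu>) = 0" using cap by (simp add: inner_capacity_def)
  then show False using 1 2 by (cases "INF \<nu>\<in>?S. mutual_energy \<kappa> \<nu> \<nu>") (auto split: if_splits)
qed

lemma carried_by_null:
  fixes \<nu> :: "'a::t2_space measure"
  assumes sc: "\<exists>\<K> :: 'a set set. countable \<K> \<and> (\<forall>K\<in>\<K>. compact K) \<and> \<Union>\<K> = UNIV"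
    and \<nu>: "radon \<nu>" and A: "A \<in> sets borel"
  shows "carried_by \<nu> A \<longleftrightarrow> emeasure \<nu> (- A) = 0"
proof
  from sc obtain \<K> :: "'a set set" where \<K>: "countable \<K>" "\<forall>K\<in>\<K>. compact K" "\<Union>\<K> = UNIV"
    by (elim exE conjE)
  note K = \<K>(1) bspec[OF \<K>(2)] \<K>(3)
  have B: "C - A \<in> sets \<nu>" if "compact C" for C
    using compact_imp_closed[OF that] A by (simp add: radon_sets[OF \<nu>])
  assume c: "carried_by \<nu> A"
  have "K - A \<in> null_sets \<nu>" if "K \<in> \<K>" for K
  proof -
    have "K - A \<in> null_sets (completion \<nu>)" using c K(2)[OF that] by (simp add: carried_by_def)
    then show ?thesis using null_sets_completion_iff[OF B[OF K(2)[OF that]]] by simp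
  qed
  then have "(\<Union>K\<in>\<K>. K - A) \<in> null_sets \<nu>" by (intro null_sets_UN' K(1))
  moreover have "(\<Union>K\<in>\<K>. K - A) = \<Union>\<K> - A" by auto
  ultimately show "emeasure \<nu> (- A) = 0" by (simp add: K(3) null_sets_def Compl_eq_Diff_UNIV)
next
  assume z: "emeasure \<nu> (- A) = 0"
  show "carried_by \<nu> A"
    unfolding carried_by_def
  proof (intro allI impI)
    fix C :: "'a set" assume C: "compact C"
    have "- A \<in> null_sets \<nu>" using z A by (simp add: null_sets_def radon_sets[OF \<nu>])
    moreover have "C - A \<in> sets \<nu>" using compact_imp_closed[OF C] A by (simp add: radon_sets[OF \<nu>])
    ultimately have "C - A \<in> null_sets \<nu>" by (rule null_sets_subset) auto
    then show "C - A \<in> null_sets (completion \<nu>)" by (rule null_sets_completionI)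
  qed
qed

subsection \<open>The constrained Gauss problem\<close>

lemma null_complement_swap:
  fixes \<nu> :: "'a::t2_space measure"
  assumes \<nu>: "radon \<nu>" and B: "B \<in> sets borel" "C \<in> sets borel"
    and z: "emeasure \<nu> (sym_diff B C) = 0" "emeasure \<nu> (- B) = 0"
  shows "emeasure \<nu> (- C) = 0"
proof -
  have "emeasure \<nu> (- C) \<le> emeasure \<nu> (sym_diff B C \<union> - B)"
    using B by (intro emeasure_mono) (auto simp: radon_sets[OF \<nu>])
  also have "\<dots> \<le> emeasure \<nu> (sym_diff B C) + emeasure \<nu> (- B)"
    using B by (intro emeasure_subadditive) (auto simp: radon_sets[OF \<nu>])
  finally show ?thesis using z by simp
qed

text \<open>Dominated convergence for series along an arbitrary filter. The Weierstrass test is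
  applied to the class \<open>Y\<close> of all families dominated by M, so a single finite J makes
  the tails small for all t and for the limit simultaneously.\<close>

lemma tendsto_infsum_dominated:
  fixes u :: "'t \<Rightarrow> 'p \<Rightarrow> real"
  assumes M: "M summable_on P" and u: "eventually (\<lambda>t. \<forall>p\<in>P. \<bar>u t p\<bar> \<le> M p) F"
    and l: "\<And>p. p \<in> P \<Longrightarrow> \<bar>l p\<bar> \<le> M p" and lim: "\<And>p. p \<in> P \<Longrightarrow> ((\<lambda>t. u t p) \<longlongrightarrow> l p) F"
  shows "((\<lambda>t. \<Sum>\<^sub>\<infinity>p\<in>P. u t p) \<longlongrightarrow> (\<Sum>\<^sub>\<infinity>p\<in>P. l p)) F"
proof (rule tendsto_uniform_approx)
  fix e :: real assume e: "0 < e"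
  define Y where "Y = {y :: 'p \<Rightarrow> real. \<forall>p\<in>P. \<bar>y p\<bar> \<le> M p}"
  have "uniform_limit Y (\<lambda>J y. \<Sum>p\<in>J. y p) (\<lambda>y. \<Sum>\<^sub>\<infinity>p\<in>P. y p) (finite_subsets_at_top P)"
    by (rule Weierstrass_m_test_general[OF _ M]) (simp add: Y_def)
  from uniform_limitD[OF this e]
  obtain J where J0: "finite J" "J \<subseteq> P"
    "\<forall>J'. finite J' \<and> J \<subseteq> J' \<and> J' \<subseteq> P \<longrightarrow> (\<forall>y\<in>Y. dist (\<Sum>p\<in>J'. y p) (\<Sum>\<^sub>\<infinity>p\<in>P. y p) < e)"
    unfolding eventually_finite_subsets_at_top by (elim exE conjE)
  then have J: "finite J" "J \<subseteq> P" "\<And>y. y \<in> Y \<Longrightarrow> dist (\<Sum>p\<in>J. y p) (\<Sum>\<^sub>\<infinity>p\<in>P. y p) < e" by simp_all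
  show "\<exists>q l'. (q \<longlongrightarrow> l') F \<and> \<bar>(\<Sum>\<^sub>\<infinity>p\<in>P. l p) - l'\<bar> \<le> e \<and>
      eventually (\<lambda>t. \<bar>(\<Sum>\<^sub>\<infinity>p\<in>P. u t p) - q t\<bar> \<le> e) F"
  proof (intro exI conjI)
    show "((\<lambda>t. \<Sum>p\<in>J. u t p) \<longlongrightarrow> (\<Sum>p\<in>J. l p)) F"
      by (intro tendsto_sum lim) (use J in auto)
    have "l \<in> Y" using l by (simp add: Y_def)
    then show "\<bar>(\<Sum>\<^sub>\<infinity>p\<in>P. l p) - (\<Sum>p\<in>J. l p)\<bar> \<le> e"
      using J(3)[of l] by (simp add: dist_real_def abs_minus_commute)
    show "eventually (\<lambda>t. \<bar>(\<Sum>\<^sub>\<infinity>p\<in>P. u t p) - (\<Sum>p\<in>J. u t p)\<bar> \<le> e) F"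
      using u
    proof eventually_elim
      case (elim t)
      then have "u t \<in> Y" by (simp add: Y_def)
      then show ?case using J(3)[of "u t"] by (simp add: dist_real_def abs_minus_commute)
    qed
  qed
qed

lemma summable_on_products:
  fixes m :: "'i \<Rightarrow> real"
  assumes m: "m summable_on I" "\<And>i. i \<in> I \<Longrightarrow> 0 \<le> m i"
  shows "(\<lambda>p. m (fst p) * m (snd p)) summable_on I \<times> I"
proof -
  have s: "(\<lambda>x. \<bar>m x\<bar>) summable_on I" using summable_on_iff_abs_summable_on_real[THEN iffD1, OF m(1)] by simp
  have "(\<lambda>p. norm (m (fst p) * m (snd p))) summable_on I \<times> I"
    unfolding Infinite_Sum.abs_summable_on_Sigma_iff
    using s by (simp add: abs_mult summable_on_cmult_right infsum_cmult_right' summable_on_cmult_left)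
  then show ?thesis by (rule summable_on_iff_abs_summable_on_real[THEN iffD2])
qed

lemma summable_if_dominated:
  fixes u :: "'p \<Rightarrow> real"
  assumes "M summable_on P" "\<And>p. p \<in> P \<Longrightarrow> \<bar>u p\<bar> \<le> M p"
  shows "u summable_on P" "\<bar>\<Sum>\<^sub>\<infinity>p\<in>P. u p\<bar> \<le> (\<Sum>\<^sub>\<infinity>p\<in>P. M p)"
proof -
  have a: "(\<lambda>p. norm (u p)) summable_on P"
    by (rule summable_on_comparison_test[OF assms(1)]) (use assms(2) in auto)
  then show "u summable_on P" by (rule summable_on_iff_abs_summable_on_real[THEN iffD2])
  have "norm (\<Sum>\<^sub>\<infinity>p\<in>P. u p) \<le> (\<Sum>\<^sub>\<infinity>p\<in>P. norm (u p))" by (rule norm_infsum_bound[OF a])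
  also have "\<dots> \<le> (\<Sum>\<^sub>\<infinity>p\<in>P. M p)"
    by (rule infsum_mono[OF a assms(1)]) (use assms(2) in simp)
  finally show "\<bar>\<Sum>\<^sub>\<infinity>p\<in>P. u p\<bar> \<le> (\<Sum>\<^sub>\<infinity>p\<in>P. M p)" by simp
qed

text \<open>For real families \<open>summable_on\<close> is already absolute convergence, so
  subtracting a summable family changes nothing.\<close>

lemma summable_diff_abs_iff:
  fixes u v w :: "'p \<Rightarrow> real"
  assumes "\<And>p. p \<in> P \<Longrightarrow> w p = u p - v p" "v summable_on P"
  shows "(\<lambda>p. \<bar>w p\<bar>) summable_on P \<longleftrightarrow> u summable_on P"
    and "u summable_on P \<Longrightarrow> (\<Sum>\<^sub>\<infinity>p\<in>P. w p) = (\<Sum>\<^sub>\<infinity>p\<in>P. u p) - (\<Sum>\<^sub>\<infinity>p\<in>P. v p)"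
proof -
  have 1: "(\<lambda>p. \<bar>w p\<bar>) summable_on P \<longleftrightarrow> w summable_on P"
    using summable_on_iff_abs_summable_on_real[of w P] by simp
  have 2: "w summable_on P \<longleftrightarrow> (\<lambda>p. u p + - v p) summable_on P"
    by (rule summable_on_cong) (simp add: assms)
  have mv: "(\<lambda>p. - v p) summable_on P" using assms(2) by (simp add: summable_on_uminus)
  have "(\<lambda>p. u p + - v p) summable_on P" if "u summable_on P"
    by (rule summable_on_add[OF that mv])
  moreover have "u summable_on P" if "(\<lambda>p. u p + - v p) summable_on P"
    using summable_on_add[OF that assms(2)] by simp
  ultimately show "(\<lambda>p. \<bar>w p\<bar>) summable_on P \<longleftrightarrow> u summable_on P" using 1 2 by blast
  show "(\<Sum>\<^sub>\<infinity>p\<in>P. w p) = (\<Sum>\<^sub>\<infinity>p\<in>P. u p) - (\<Sum>\<^sub>\<infinity>p\<in>P. v p)" if u: "u summable_on P"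
  proof -
    have "(\<Sum>\<^sub>\<infinity>p\<in>P. w p) = (\<Sum>\<^sub>\<infinity>p\<in>P. u p + - v p)" by (rule infsum_cong) (simp add: assms)
    also have "\<dots> = (\<Sum>\<^sub>\<infinity>p\<in>P. u p) + (\<Sum>\<^sub>\<infinity>p\<in>P. - v p)" by (rule infsum_add[OF u mv])
    finally show ?thesis by (simp add: infsum_uminus)
  qed
qed

text \<open>Otherwise each point of S has a neighbourhood that the family eventually avoids, and
  finitely many of these cover S.\<close>

lemma compactin_cluster_point:
  assumes S: "compactin X S" and F: "F \<noteq> bot" and ev: "eventually (\<lambda>t. \<nu> t \<in> S) F"
  shows "\<exists>\<mu>\<in>S. \<forall>U. openin X U \<and> \<mu> \<in> U \<longrightarrow> (\<exists>\<^sub>F t in F. \<nu> t \<in> U)"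
proof (rule ccontr)
  assume "\<not> ?thesis"
  then have "\<forall>\<mu>\<in>S. \<exists>U. openin X U \<and> \<mu> \<in> U \<and> eventually (\<lambda>t. \<nu> t \<notin> U) F"
    by (simp add: frequently_def)
  then obtain U where U: "\<And>\<mu>. \<mu> \<in> S \<Longrightarrow> openin X (U \<mu>)" "\<And>\<mu>. \<mu> \<in> S \<Longrightarrow> \<mu> \<in> U \<mu>"
    "\<And>\<mu>. \<mu> \<in> S \<Longrightarrow> eventually (\<lambda>t. \<nu> t \<notin> U \<mu>) F" by metis
  have "\<forall>V\<in>U ` S. openin X V" "S \<subseteq> \<Union>(U ` S)" using U by auto
  with compactinD[OF S, of "U ` S"]
  obtain \<F> where \<F>: "finite \<F>" "\<F> \<subseteq> U ` S" "S \<subseteq> \<Union>\<F>" by auto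
  have "eventually (\<lambda>t. \<forall>V\<in>\<F>. \<nu> t \<notin> V) F"
    using \<F>(1)
  proof (rule eventually_ball_finite)
    show "\<forall>V\<in>\<F>. eventually (\<lambda>t. \<nu> t \<notin> V) F"
      using \<F>(2) U(3) by auto
  qed
  with ev have "eventually (\<lambda>t. False) F"
    by eventually_elim (use \<F>(3) in auto)
  then show False using F by (simp add: trivial_limit_def)
qed

text \<open>The filter version of passing to a convergent subnet: F is joined with the inverse image
  of the neighbourhood filter of the point. That the join is nontrivial is precisely the
  clustering.\<close>

lemma cluster_point_refinement:
  fixes \<nu> :: "'t \<Rightarrow> 'x"
  assumes "\<And>U. openin X U \<Longrightarrow> \<mu> \<in> U \<Longrightarrow> \<exists>\<^sub>F t in F. \<nu> t \<in> U" and \<mu>: "\<mu> \<in> topspace X"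
  shows "\<exists>F'. F' \<noteq> bot \<and> F' \<le> F \<and> (\<forall>U. openin X U \<longrightarrow> \<mu> \<in> U \<longrightarrow> eventually (\<lambda>t. \<nu> t \<in> U) F')"
proof (intro exI conjI allI impI)
  let ?F' = "inf F (filtercomap \<nu> (nhdsin X \<mu>))"
  show "?F' \<le> F" by simp
  show "eventually (\<lambda>t. \<nu> t \<in> U) ?F'" if "openin X U" "\<mu> \<in> U" for U
  proof -
    have "eventually (\<lambda>\<eta>. \<eta> \<in> U) (nhdsin X \<mu>)" using that by (auto simp: eventually_nhdsin)
    then have "eventually (\<lambda>t. \<nu> t \<in> U) (filtercomap \<nu> (nhdsin X \<mu>))" by (rule eventually_filtercomapI)
    then show ?thesis by (rule filter_leD[rotated]) simp
  qed
  show "?F' \<noteq> bot"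
  proof
    assume "?F' = bot"
    then have "eventually (\<lambda>t. False) ?F'" by simp
    then obtain P Q where PQ: "eventually P F" "eventually Q (filtercomap \<nu> (nhdsin X \<mu>))" "\<And>t. P t \<Longrightarrow> Q t \<Longrightarrow> False"
      unfolding eventually_inf by blast
    from PQ(2) obtain R where R: "eventually R (nhdsin X \<mu>)" "\<And>t. R (\<nu> t) \<Longrightarrow> Q t"
      unfolding eventually_filtercomap by blast
    from R(1) obtain U where U: "openin X U" "\<mu> \<in> U" "\<And>\<eta>. \<eta> \<in> U \<Longrightarrow> R \<eta>"
      using \<mu> by (auto simp: eventually_nhdsin)
    have "\<exists>\<^sub>F t in F. P t \<and> \<nu> t \<in> U" using frequently_eventually_conj[OF assms(1)[OF U(1,2)] PQ(1)] .
    then obtain t where "P t" "\<nu> t \<in> U" using frequently_ex by blast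
    then show False using PQ(3) R(2) U(3) by blast
  qed
qed

lemma finite_uniform_bound:
  assumes "finite P" "\<And>p. p \<in> P \<Longrightarrow> \<exists>b::real. \<forall>x\<in>S p. h p x \<le> b"
  shows "\<exists>b\<ge>0. \<forall>p\<in>P. \<forall>x\<in>S p. h p x \<le> b"
proof -
  obtain b where b: "\<And>p x. p \<in> P \<Longrightarrow> x \<in> S p \<Longrightarrow> h p x \<le> b p" using assms(2) by metis
  define B where "B = Max (insert 0 (b ` P))"
  have "0 \<le> B" "\<And>p. p \<in> P \<Longrightarrow> b p \<le> B" using assms(1) by (auto simp: B_def)
  then show ?thesis using b by (intro exI[of _ B]) (auto intro: order_trans)
qed

locale gauss_problem =
  fixes \<kappa> :: "'a::{metric_space,second_countable_topology} \<times> 'a \<Rightarrow> ereal"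
    and Ipos Ineg I0 :: "'i set"
    and A Ac :: "'i \<Rightarrow> 'a set"
    and a :: "'i \<Rightarrow> real"
    and g :: "'i \<Rightarrow> 'a \<Rightarrow> real"
    and f :: "'i \<Rightarrow> 'a \<Rightarrow> ereal"
    and \<xi> :: "'i \<Rightarrow> 'a measure"
  assumes lc: "locally compact (UNIV :: 'a set)"
    and sc: "\<exists>\<K> :: 'a set set. countable \<K> \<and> (\<forall>K\<in>\<K>. compact K) \<and> \<Union>\<K> = UNIV"
    and pd: "pd_kernel \<kappa>"
    and offdiag: "off_diagonal_continuous \<kappa>"
    and vanish: "vanishes_at_infinity \<kappa>"
    and cond: "generalized_condenser Ipos Ineg A"
    and fin: "finite Ipos \<or> finite Ineg"
    and near: "\<And>i. i \<in> Ipos \<union> Ineg \<Longrightarrow> compact (Ac i) \<and> inner_capacity \<kappa> (sym_diff (A i) (Ac i)) = 0"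
    and locfin: "\<And>K. compact K \<Longrightarrow> finite {i \<in> Ipos \<union> Ineg. Ac i \<inter> K \<noteq> {}}"
    and disj: "(\<Union>i\<in>Ipos. Ac i) \<inter> (\<Union>i\<in>Ineg. Ac i) = {}"
    and apos: "\<And>i. i \<in> Ipos \<union> Ineg \<Longrightarrow> 0 < a i"
    and gcont: "\<And>i. i \<in> Ipos \<union> Ineg \<Longrightarrow> continuous_on UNIV (g i) \<and> (\<forall>x. 0 < g i x)"
    and fPsi: "\<And>i. i \<in> Ipos \<union> Ineg \<Longrightarrow> f i \<in> Psi"
    and asum: "(\<Sum>\<^sub>\<infinity>i\<in>Ipos \<union> Ineg. ennreal (a i) * inverse (INF x\<in>A i. ennreal (g i x))) < \<infinity>"
    and I0: "I0 \<subseteq> Ipos \<union> Ineg"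
    and constr: "is_constraint A a g I0 \<xi>"
    and nonempty: "admissible \<kappa> Ipos Ineg A a g f I0 \<xi> \<noteq> {}"
begin

section \<open>A priori mass bounds and concentration on the compact sets
  \<open>Ac i\<close>\<close>

definition I :: "'i set" where "I = Ipos \<union> Ineg"

definition adm :: "('i \<Rightarrow> 'a measure) set" where "adm = admissible \<kappa> Ipos Ineg A a g f I0 \<xi>"

definition G :: "('i \<Rightarrow> 'a measure) \<Rightarrow> real" where "G = gauss_functional \<kappa> Ipos Ineg f"

text \<open>The quotient of a i by the infimum of g i is formed in \<open>ennreal\<close>, where it
  is infinite if the infimum is 0. Finiteness of the given sum excludes this, so
  \<open>enn2real\<close> loses nothing for indices in \<open>I\<close>.\<close>

definition mass :: "'i \<Rightarrow> real" where
  "mass i = enn2real (ennreal (a i) * inverse (INF x\<in>A i. ennreal (g i x)))"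

lemma mass_nonneg: "0 \<le> mass i"
  by (simp add: mass_def)

lemma ennreal_mass:
  assumes "i \<in> I"
  shows "ennreal (mass i) = ennreal (a i) * inverse (INF x\<in>A i. ennreal (g i x))" (is "_ = ?u i")
proof -
  have "(\<Sum>\<^sub>\<infinity>i\<in>{i}. ?u i) \<le> (\<Sum>\<^sub>\<infinity>i\<in>I. ?u i)"
    by (rule infsum_mono_neutral) (use assms in \<open>auto intro!: nonneg_summable_on_complete\<close>)
  then have "?u i \<le> (\<Sum>\<^sub>\<infinity>i\<in>I. ?u i)" by simp
  also have "\<dots> < top" using asum by (simp add: I_def)
  finally show ?thesis by (simp add: mass_def)
qed

lemma mass_summable: "mass summable_on I"
proof (rule nonneg_bdd_above_summable_on)
  let ?u = "\<lambda>i. ennreal (a i) * inverse (INF x\<in>A i. ennreal (g i x))"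
  obtain T where T: "(\<Sum>\<^sub>\<infinity>i\<in>I. ?u i) = ennreal T" "0 \<le> T"
    using asum by (cases "\<Sum>\<^sub>\<infinity>i\<in>I. ?u i") (auto simp: I_def)
  show "bdd_above (sum mass ` {F. F \<subseteq> I \<and> finite F})"
  proof (rule bdd_aboveI)
    fix x assume "x \<in> sum mass ` {F. F \<subseteq> I \<and> finite F}"
    then obtain J where J: "finite J" "J \<subseteq> I" "x = sum mass J" by blast
    have "ennreal x = (\<Sum>i\<in>J. ennreal (mass i))" by (simp add: J(3) sum_ennreal mass_nonneg)
    also have "\<dots> = (\<Sum>i\<in>J. ?u i)" by (rule sum.cong[OF refl ennreal_mass]) (use J in auto)
    also have "\<dots> = (\<Sum>\<^sub>\<infinity>i\<in>J. ?u i)" using J by simp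
    also have "\<dots> \<le> (\<Sum>\<^sub>\<infinity>i\<in>I. ?u i)"
      by (rule infsum_mono_neutral) (use J in \<open>auto intro!: nonneg_summable_on_complete\<close>)
    finally show "x \<le> T" using T by simp
  qed
qed (rule mass_nonneg)

text \<open>The infimum of g i over A i times the total mass is at most the integral of g i, which
  is a i. Dividing by the infimum requires it to be positive and finite.\<close>

lemma mass_bound:
  assumes i: "i \<in> I" and \<nu>: "radon \<nu>" and z: "emeasure \<nu> (- A i) = 0"
    and p: "pairing (\<lambda>x. ereal (g i x)) \<nu> = ereal (a i)"
  shows "emeasure \<nu> UNIV \<le> ennreal (mass i)"
proof -
  let ?q = "INF x\<in>A i. ennreal (g i x)"
  have gi: "continuous_on UNIV (g i)" "\<And>x. 0 < g i x" using gcont i by (auto simp: I_def)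
  have Ai: "A i \<in> sets borel" "A i \<noteq> {}" using cond i by (auto simp: generalized_condenser_def I_def)
  have z2: "(\<integral>\<^sup>+x. e2ennreal (- ereal (g i x)) \<partial>\<nu>) = 0"
    using gi(2) by (simp add: e2ennreal_neg less_imp_le ennreal_neg e2ennreal_ereal)
  have "enn2ereal (\<integral>\<^sup>+x. ennreal (g i x) \<partial>\<nu>) = ereal (a i)"
    using p z2 by (simp add: pairing_def e2ennreal_ereal zero_ennreal.rep_eq)
  then have "e2ennreal (enn2ereal (\<integral>\<^sup>+x. ennreal (g i x) \<partial>\<nu>)) = e2ennreal (ereal (a i))" by (rule arg_cong)
  then have int: "(\<integral>\<^sup>+x. ennreal (g i x) \<partial>\<nu>) = ennreal (a i)" by (simp add: e2ennreal_ereal)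
  have "AE x in \<nu>. x \<in> A i"
    using z Ai(1) by (intro AE_I[of _ _ "- A i"]) (auto simp: radon_sets[OF \<nu>])
  then have "AE x in \<nu>. ?q \<le> ennreal (g i x)"
    by eventually_elim (rule INF_lower)
  then have "(\<integral>\<^sup>+x. ?q \<partial>\<nu>) \<le> (\<integral>\<^sup>+x. ennreal (g i x) \<partial>\<nu>)" by (rule nn_integral_mono_AE)
  then have 1: "?q * emeasure \<nu> UNIV \<le> ennreal (a i)" by (simp add: int radon_space[OF \<nu>])
  \<comment> \<open>A zero infimum would make the i-th term of the given finite sum
    infinite.\<close>
  have "?q \<noteq> 0"
  proof
    assume "?q = 0"
    then have "ennreal (mass i) = top"
      using ennreal_mass[OF i] apos[of i] i by (simp add: I_def ennreal_mult_top)
    then show False by simp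
  qed
  moreover have "?q < top"
  proof -
    obtain x where "x \<in> A i" using Ai(2) by blast
    then have "?q \<le> ennreal (g i x)" by (rule INF_lower)
    then show ?thesis by (rule le_less_trans) simp
  qed
  ultimately have "emeasure \<nu> UNIV = inverse ?q * (?q * emeasure \<nu> UNIV)"
    by (simp add: mult.assoc[symmetric] ennreal_inverse_mult mult.commute[of "inverse ?q"] divide_ennreal_def[symmetric] ennreal_divide_self)
  also have "\<dots> \<le> inverse ?q * ennreal (a i)" using 1 by (intro mult_left_mono) auto
  also have "\<dots> = ennreal (mass i)" using ennreal_mass[OF i] by (simp add: mult.commute)
  finally show ?thesis .
qed

lemma compact_Ac: "i \<in> I \<Longrightarrow> compact (Ac i)"
  using near by (simp add: I_def)

lemma A_borel: "i \<in> I \<Longrightarrow> A i \<in> sets borel"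
  using cond by (simp add: generalized_condenser_def I_def)

lemma finite_energy_null_diff:
  assumes i: "i \<in> I" and \<nu>: "radon \<nu>" and fin: "\<bar>mutual_energy \<kappa> \<nu> \<nu>\<bar> \<noteq> \<infinity>"
  shows "emeasure \<nu> (sym_diff (A i) (Ac i)) = 0"
proof (rule null_if_zero_capacity[OF sc pd \<nu> fin])
  show "sym_diff (A i) (Ac i) \<in> sets borel"
    using A_borel[OF i] compact_imp_closed[OF compact_Ac[OF i]] by simp
  show "inner_capacity \<kappa> (sym_diff (A i) (Ac i)) = 0" using near i by (simp add: I_def)
qed

lemma admD:
  assumes "\<mu> \<in> adm"
  shows "\<mu> \<in> PiE I (\<lambda>i. radon_on (A i))"
    "finite_series (energy_term \<kappa> Ipos \<mu>) (I \<times> I)"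
    "\<And>i. i \<in> I \<Longrightarrow> pairing (\<lambda>x. ereal (g i x)) (\<mu> i) = ereal (a i)"
    "\<And>i. i \<in> I0 \<Longrightarrow> \<mu> i \<le> \<xi> i"
    "finite_series (\<lambda>i. pairing (f i) (\<mu> i)) I"
  using assms unfolding adm_def admissible_def finite_energy_vectors_def vector_measures_def I_def by blast+

lemma admI:
  assumes "\<mu> \<in> PiE I (\<lambda>i. radon_on (A i))"
    "finite_series (energy_term \<kappa> Ipos \<mu>) (I \<times> I)"
    "\<And>i. i \<in> I \<Longrightarrow> pairing (\<lambda>x. ereal (g i x)) (\<mu> i) = ereal (a i)"
    "\<And>i. i \<in> I0 \<Longrightarrow> \<mu> i \<le> \<xi> i"
    "finite_series (\<lambda>i. pairing (f i) (\<mu> i)) I"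
  shows "\<mu> \<in> adm"
  using assms unfolding adm_def admissible_def finite_energy_vectors_def vector_measures_def I_def by blast

definition same :: "'i \<times> 'i \<Rightarrow> bool" where
  "same p \<longleftrightarrow> (fst p \<in> Ipos \<longleftrightarrow> snd p \<in> Ipos)"

lemma energy_term_same:
  "energy_term \<kappa> Ipos \<mu> p = (if same p then 1 else - 1) * mutual_energy \<kappa> (\<mu> (fst p)) (\<mu> (snd p))"
  by (cases p) (auto simp: energy_term_def charge_sign_def same_def one_ereal_def)

definition conc :: "('i \<Rightarrow> 'a measure) set" where
  "conc = {\<mu>. \<forall>i\<in>I. \<mu> i \<in> concentrated (Ac i) (mass i)}"

text \<open>Finiteness of the energy series includes its diagonal terms, so each component has
  finite energy of its own and does not charge the difference between A i and Ac i.\<close>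

lemma adm_conc:
  assumes \<mu>: "\<mu> \<in> adm"
  shows "\<mu> \<in> conc"
  unfolding conc_def
proof (intro CollectI ballI)
  fix i assume i: "i \<in> I"
  have on: "\<mu> i \<in> radon_on (A i)" using admD(1)[OF \<mu>] i by (rule PiE_mem)
  then have r: "radon (\<mu> i)" and "carried_by (\<mu> i) (A i)" by (auto simp: radon_on_def)
  then have zA: "emeasure (\<mu> i) (- A i) = 0"
    using carried_by_null[OF sc r A_borel[OF i]] by simp
  have "\<bar>energy_term \<kappa> Ipos \<mu> (i, i)\<bar> \<noteq> \<infinity>"
    using admD(2)[OF \<mu>] i by (simp add: finite_series_def)
  then have fin: "\<bar>mutual_energy \<kappa> (\<mu> i) (\<mu> i)\<bar> \<noteq> \<infinity>"
    by (simp add: energy_term_same same_def)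
  have "emeasure (\<mu> i) (- Ac i) = 0"
    by (rule null_complement_swap[OF r A_borel[OF i] _ finite_energy_null_diff[OF i r fin] zA]) (use compact_imp_closed[OF compact_Ac[OF i]] in simp)
  moreover have "emeasure (\<mu> i) UNIV \<le> ennreal (mass i)"
    by (rule mass_bound[OF i r zA admD(3)[OF \<mu> i]])
  ultimately show "\<mu> i \<in> concentrated (Ac i) (mass i)" using r by (simp add: concentrated_def)
qed


text \<open>\<open>kernel_real\<close> is meaningful only off the diagonal, where the kernel is finite.\<close>

definition kernel_real :: "'a \<times> 'a \<Rightarrow> real" where "kernel_real p = real_of_ereal (\<kappa> p)"

section \<open>Bounds for the kernel between plates of opposite sign\<close>

lemma kernel_Psi: "\<kappa> \<in> Psi" and kernel_sym: "\<kappa> (x, y) = \<kappa> (y, x)"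
  using pd by (auto simp: pd_kernel_def)

lemma kernel_measurable: "\<kappa> \<in> borel_measurable borel"
  by (rule Psi_measurable[OF kernel_Psi])

lemma kernel_real_measurable: "kernel_real \<in> borel_measurable borel"
  unfolding kernel_real_def[abs_def] using kernel_measurable by measurable

lemma kernel_real_off_diagonal:
  assumes "S \<inter> T = {}"
  shows "continuous_on (S \<times> T) kernel_real" "\<And>p. p \<in> S \<times> T \<Longrightarrow> \<kappa> p = ereal (kernel_real p)"
proof -
  have sub: "S \<times> T \<subseteq> {(x, y). x \<noteq> y}" using assms by auto
  have fin: "\<bar>\<kappa> p\<bar> \<noteq> \<infinity>" if "p \<in> S \<times> T" for p
  proof -
    have "fst p \<noteq> snd p" using that sub by auto
    then show ?thesis using offdiag by (cases p) (simp add: off_diagonal_continuous_def)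
  qed
  have "continuous_on (S \<times> T) \<kappa>"
    using offdiag sub unfolding off_diagonal_continuous_def by (metis continuous_on_subset)
  then show "continuous_on (S \<times> T) kernel_real"
    using continuous_on_iff_real[of "S \<times> T" \<kappa>] fin by (simp add: kernel_real_def[abs_def] comp_def)
  show "\<kappa> p = ereal (kernel_real p)" if "p \<in> S \<times> T" for p
    using fin[OF that] by (simp add: kernel_real_def ereal_real)
qed

lemma Ac_disjoint:
  assumes "i \<in> I" "j \<in> I" "\<not> same (i, j)"
  shows "Ac i \<inter> Ac j = {}"
  using assms disj by (auto simp: same_def I_def)

text \<open>The plates in X have a compact union K. Off some compact L the kernel is below 1
  uniformly on K, and by local finiteness only finitely many plates of Y meet L. For these finitely
  many pairs the kernel is continuous on a compact product; the added 1 covers all other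
  points.\<close>

lemma kernel_bound_finite_side:
  assumes X: "finite X" "X \<subseteq> I" and Y: "Y \<subseteq> I" and d: "\<And>i j. i \<in> X \<Longrightarrow> j \<in> Y \<Longrightarrow> Ac i \<inter> Ac j = {}"
  shows "\<exists>b\<ge>0. \<forall>i\<in>X. \<forall>j\<in>Y. \<forall>p\<in>Ac i \<times> Ac j. \<bar>kernel_real p\<bar> \<le> b"
proof -
  define K where "K = (\<Union>i\<in>X. Ac i)"
  have K: "compact K" unfolding K_def using X compact_Ac by (intro compact_UN) auto
  obtain L where L: "compact L" "\<And>x y. y \<notin> L \<Longrightarrow> x \<in> K \<Longrightarrow> \<bar>\<kappa> (x, y)\<bar> < ereal 1"
    using vanish[unfolded vanishes_at_infinity_def, rule_format, OF K, of 1] by auto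
  define Y' where "Y' = {j \<in> Y. Ac j \<inter> L \<noteq> {}}"
  have "finite Y'"
    using locfin[OF L(1)] Y by (elim finite_subset[rotated]) (auto simp: Y'_def I_def)
  then have fin: "finite (X \<times> Y')" using X by simp
  have bq: "\<exists>b. \<forall>p\<in>Ac (fst q) \<times> Ac (snd q). \<bar>kernel_real p\<bar> \<le> b" if q: "q \<in> X \<times> Y'" for q
  proof -
    have "Ac (fst q) \<inter> Ac (snd q) = {}" using q by (intro d) (auto simp: Y'_def)
    moreover have "compact (Ac (fst q) \<times> Ac (snd q))"
      using q X Y by (intro compact_Times compact_Ac) (auto simp: Y'_def)
    ultimately show ?thesis
      using compact_continuous_bound kernel_real_off_diagonal(1) by blast
  qed
  have "\<exists>b\<ge>0. \<forall>q\<in>X \<times> Y'. \<forall>p\<in>Ac (fst q) \<times> Ac (snd q). \<bar>kernel_real p\<bar> \<le> b"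
    by (rule finite_uniform_bound[OF fin]) (rule bq)
  then obtain b where b: "0 \<le> b" "\<forall>q\<in>X \<times> Y'. \<forall>p\<in>Ac (fst q) \<times> Ac (snd q). \<bar>kernel_real p\<bar> \<le> b"
    by (elim exE conjE)
  show ?thesis
  proof (intro exI[of _ "b + 1"] conjI ballI)
    show "0 \<le> b + 1" using b by simp
    fix i j p assume ij: "i \<in> X" "j \<in> Y" "p \<in> Ac i \<times> Ac j"
    show "\<bar>kernel_real p\<bar> \<le> b + 1"
    proof (cases "j \<in> Y'")
      case True
      then have "(i, j) \<in> X \<times> Y'" using ij by simp
      from bspec[OF bspec[OF b(2) this]] ij have "\<bar>kernel_real p\<bar> \<le> b" by simp
      then show ?thesis by simp
    next
      case False
      then have "snd p \<notin> L" "fst p \<in> K" using ij by (auto simp: Y'_def K_def)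
      then have "\<bar>\<kappa> p\<bar> < ereal 1" using L(2)[of "snd p" "fst p"] by simp
      then have "\<bar>kernel_real p\<bar> < 1" unfolding kernel_real_def by (cases "\<kappa> p") auto
      then show ?thesis using b(1) by simp
    qed
  qed
qed

text \<open>The finite family of plates plays the role of X, whichever sign it has; symmetry of the
  kernel handles pairs listed in the other order.\<close>

lemma kernel_bound:
  "\<exists>D\<ge>0. \<forall>i\<in>I. \<forall>j\<in>I. \<not> same (i, j) \<longrightarrow> (\<forall>p\<in>Ac i \<times> Ac j. \<bar>kernel_real p\<bar> \<le> D)"
proof -
  obtain X Y where XY: "finite X" "X \<subseteq> I" "Y \<subseteq> I" "\<And>i j. i \<in> X \<Longrightarrow> j \<in> Y \<Longrightarrow> Ac i \<inter> Ac j = {}"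
    and same: "\<And>i j. i \<in> I \<Longrightarrow> j \<in> I \<Longrightarrow> \<not> same (i, j) \<Longrightarrow> i \<in> X \<and> j \<in> Y \<or> i \<in> Y \<and> j \<in> X"
  proof (cases "finite Ipos")
    case True
    show ?thesis by (rule that[of Ipos Ineg]) (use True disj in \<open>auto simp: I_def same_def\<close>)
  next
    case False
    then have "finite Ineg" using fin by simp
    then show ?thesis by (intro that[of Ineg Ipos]) (use disj in \<open>auto simp: I_def same_def\<close>)
  qed
  have "\<exists>b\<ge>0. \<forall>i\<in>X. \<forall>j\<in>Y. \<forall>p\<in>Ac i \<times> Ac j. \<bar>kernel_real p\<bar> \<le> b"
    by (rule kernel_bound_finite_side[OF XY(1-3)]) (rule XY(4))
  then obtain D where D': "0 \<le> D" "\<forall>i\<in>X. \<forall>j\<in>Y. \<forall>p\<in>Ac i \<times> Ac j. \<bar>kernel_real p\<bar> \<le> D"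
    by (elim exE conjE)
  note D = D'(1) bspec[OF bspec[OF bspec[OF D'(2)]]]
  show ?thesis
  proof (intro exI[of _ D] conjI ballI impI)
    fix i j p assume ij: "i \<in> I" "j \<in> I" "\<not> same (i, j)" "p \<in> Ac i \<times> Ac j"
    have "kernel_real (snd p, fst p) = kernel_real p" using kernel_sym[of "snd p" "fst p"] by (simp add: kernel_real_def)
    moreover have "(snd p, fst p) \<in> Ac j \<times> Ac i" using ij(4) by auto
    ultimately show "\<bar>kernel_real p\<bar> \<le> D"
      using same[OF ij(1-3)] D(2)[of i j p] D(2)[of j i "(snd p, fst p)"] ij(4) by auto
  qed (rule D)
qed

definition cross_bound :: real where
  "cross_bound = (SOME D. D \<ge> 0 \<and> (\<forall>i\<in>I. \<forall>j\<in>I. \<not> same (i, j) \<longrightarrow> (\<forall>p\<in>Ac i \<times> Ac j. \<bar>kernel_real p\<bar> \<le> D)))"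

lemma cross_bound: "0 \<le> cross_bound" "i \<in> I \<Longrightarrow> j \<in> I \<Longrightarrow> \<not> same (i, j) \<Longrightarrow> p \<in> Ac i \<times> Ac j \<Longrightarrow> \<bar>kernel_real p\<bar> \<le> cross_bound"
  using someI_ex[OF kernel_bound] unfolding cross_bound_def[symmetric] by auto

section \<open>Making the kernel and the fields nonnegative by shifts\<close>

definition kernel_shift :: real where
  "kernel_shift = (SOME c. c \<ge> 0 \<and> (\<forall>p. ereal (- c) \<le> \<kappa> p) \<and> (compact (UNIV :: ('a \<times> 'a) set) \<or> c = 0))"

lemma kernel_shift: "0 \<le> kernel_shift" "ereal (- kernel_shift) \<le> \<kappa> p"
proof -
  have "0 \<le> kernel_shift \<and> (\<forall>p. ereal (- kernel_shift) \<le> \<kappa> p) \<and> (compact (UNIV :: ('a \<times> 'a) set) \<or> kernel_shift = 0)"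
    unfolding kernel_shift_def by (rule someI_ex[OF Psi_lower_bound[OF kernel_Psi]])
  then show "0 \<le> kernel_shift" "ereal (- kernel_shift) \<le> \<kappa> p" by blast+
qed

definition field_shift :: "'i \<Rightarrow> real" where
  "field_shift i = (SOME c. c \<ge> 0 \<and> (\<forall>x. ereal (- c) \<le> f i x) \<and> (compact (UNIV :: 'a set) \<or> c = 0))"

lemma field_shift:
  assumes "i \<in> I"
  shows "0 \<le> field_shift i" "ereal (- field_shift i) \<le> f i x" "compact (UNIV :: 'a set) \<or> field_shift i = 0"
  using someI_ex[OF Psi_lower_bound[of "f i"]] fPsi assms unfolding field_shift_def[symmetric] by (auto simp: I_def)

lemma finite_index_if_compact:
  assumes "compact (UNIV :: 'a set)"
  shows "finite I"
proof -
  have "finite {i \<in> Ipos \<union> Ineg. A i \<inter> UNIV \<noteq> {}}"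
    using cond assms unfolding generalized_condenser_def by (elim conjE allE[of _ UNIV]) simp
  moreover have "{i \<in> Ipos \<union> Ineg. A i \<inter> UNIV \<noteq> {}} = I"
    using cond by (auto simp: generalized_condenser_def I_def)
  ultimately show ?thesis by simp
qed

text \<open>The shifts depend on i without any uniform bound. They vanish unless the space is
  compact, and then local finiteness leaves only finitely many plates.\<close>

lemma field_shift_summable: "(\<lambda>i. field_shift i * mass i) summable_on I"
proof (cases "compact (UNIV :: 'a set)")
  case True
  then show ?thesis using finite_index_if_compact by simp
next
  case False
  then have "field_shift i * mass i = 0" if "i \<in> I" for i using field_shift(3)[OF that] by simp
  then have "(\<lambda>i. field_shift i * mass i) summable_on I \<longleftrightarrow> (\<lambda>i. 0 :: real) summable_on I"
    by (intro summable_on_cong)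
  then show ?thesis by simp
qed

abbreviation plate_pair :: "('i \<Rightarrow> 'a measure) \<Rightarrow> 'i \<times> 'i \<Rightarrow> ('a \<times> 'a) measure" where
  "plate_pair \<mu> p \<equiv> \<mu> (fst p) \<Otimes>\<^sub>M \<mu> (snd p)"

text \<open>
  Each energy term and each field term is split into a main part, which is the integral of a
  nonnegative l.s.c. function and hence vaguely l.s.c., and a rest, which is dominated by a fixed
  convergent series and hence vaguely continuous. For plates of opposite sign the main part is zero.
\<close>

definition kernel_int :: "('i \<Rightarrow> 'a measure) \<Rightarrow> 'i \<times> 'i \<Rightarrow> ennreal" where
  "kernel_int \<mu> p = (\<integral>\<^sup>+q. e2ennreal (\<kappa> q + ereal kernel_shift) \<partial>plate_pair \<mu> p)"

definition field_int :: "('i \<Rightarrow> 'a measure) \<Rightarrow> 'i \<Rightarrow> ennreal" where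
  "field_int \<mu> i = (\<integral>\<^sup>+x. e2ennreal (f i x + ereal (field_shift i)) \<partial>\<mu> i)"

definition energy_main :: "('i \<Rightarrow> 'a measure) \<Rightarrow> 'i \<times> 'i \<Rightarrow> real" where
  "energy_main \<mu> p = (if same p then enn2real (kernel_int \<mu> p) else 0)"

definition energy_rest :: "('i \<Rightarrow> 'a measure) \<Rightarrow> 'i \<times> 'i \<Rightarrow> real" where
  "energy_rest \<mu> p = (if same p then kernel_shift * (measure (\<mu> (fst p)) UNIV * measure (\<mu> (snd p)) UNIV)
     else (\<integral>q. kernel_real q \<partial>plate_pair \<mu> p))"

definition field_main :: "('i \<Rightarrow> 'a measure) \<Rightarrow> 'i \<Rightarrow> real" where
  "field_main \<mu> i = enn2real (field_int \<mu> i)"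

definition field_rest :: "('i \<Rightarrow> 'a measure) \<Rightarrow> 'i \<Rightarrow> real" where
  "field_rest \<mu> i = field_shift i * measure (\<mu> i) UNIV"

definition rest :: "('i \<Rightarrow> 'a measure) \<Rightarrow> real" where
  "rest \<mu> = (\<Sum>\<^sub>\<infinity>p\<in>I \<times> I. energy_rest \<mu> p) + 2 * (\<Sum>\<^sub>\<infinity>i\<in>I. field_rest \<mu> i)"

section \<open>Finiteness and value of the Gauss functional in terms of main parts and rests\<close>

lemma concD: "\<mu> \<in> conc \<Longrightarrow> i \<in> I \<Longrightarrow> \<mu> i \<in> concentrated (Ac i) (mass i)"
  by (simp add: conc_def)

lemma conc_pair:
  assumes "\<mu> \<in> conc" "p \<in> I \<times> I"
  shows "finite_measure (plate_pair \<mu> p)" "sets (plate_pair \<mu> p) = sets borel"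
    "space (plate_pair \<mu> p) = UNIV"
    "AE q in plate_pair \<mu> p. q \<in> Ac (fst p) \<times> Ac (snd p)"
    "measure (plate_pair \<mu> p) UNIV = measure (\<mu> (fst p)) UNIV * measure (\<mu> (snd p)) UNIV"
    "measure (plate_pair \<mu> p) UNIV \<le> mass (fst p) * mass (snd p)"
  using concentrated_pair[OF concD concD compact_Ac compact_Ac mass_nonneg mass_nonneg,
      OF assms(1) _ assms(1), of "fst p" "snd p"] assms(2)
  by auto

lemma cross_integrable:
  assumes \<mu>: "\<mu> \<in> conc" and p: "p \<in> I \<times> I" and ns: "\<not> same p"
  shows "integrable (plate_pair \<mu> p) kernel_real"
    and "\<bar>\<integral>q. kernel_real q \<partial>plate_pair \<mu> p\<bar> \<le> cross_bound * (mass (fst p) * mass (snd p))"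
    and "mutual_energy \<kappa> (\<mu> (fst p)) (\<mu> (snd p)) = ereal (\<integral>q. kernel_real q \<partial>plate_pair \<mu> p)"
proof -
  have i: "fst p \<in> I" "snd p \<in> I" using p by auto
  have d: "Ac (fst p) \<inter> Ac (snd p) = {}" using Ac_disjoint[OF i] ns by simp
  note c = conc_pair[OF \<mu> p]
  show int: "integrable (plate_pair \<mu> p) kernel_real"
    using integrable_pair_concentrated[OF concD[OF \<mu> i(1)] concD[OF \<mu> i(2)] compact_Ac[OF i(1)]
        compact_Ac[OF i(2)] mass_nonneg mass_nonneg kernel_real_measurable kernel_real_off_diagonal(1)[OF d]] .
  have "AE q in plate_pair \<mu> p. \<bar>kernel_real q - 0\<bar> \<le> cross_bound"
    using c(4) by eventually_elim (use cross_bound(2)[OF i] ns in simp)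
  from integral_diff_bound[of _ kernel_real "\<lambda>_. 0" cross_bound, OF c(1) int _ this]
  have "\<bar>\<integral>q. kernel_real q \<partial>plate_pair \<mu> p\<bar> \<le> cross_bound * measure (plate_pair \<mu> p) UNIV"
    by (simp add: c(3))
  also have "\<dots> \<le> cross_bound * (mass (fst p) * mass (snd p))" by (intro mult_left_mono c(6) cross_bound(1))
  finally show "\<bar>\<integral>q. kernel_real q \<partial>plate_pair \<mu> p\<bar> \<le> cross_bound * (mass (fst p) * mass (snd p))" .
  show "mutual_energy \<kappa> (\<mu> (fst p)) (\<mu> (snd p)) = ereal (\<integral>q. kernel_real q \<partial>plate_pair \<mu> p)"
    unfolding mutual_energy_def
  proof (rule pairing_integrable[OF int])
    show "AE q in plate_pair \<mu> p. \<kappa> q = ereal (kernel_real q)"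
      using c(4) by eventually_elim (rule kernel_real_off_diagonal(2)[OF d])
  qed
qed

text \<open>The sum of the two constants covers both kinds of pairs. The bound does not depend on
  \<mu>, and it is a product family, summable because the masses are.\<close>

lemma energy_rest_bound:
  assumes \<mu>: "\<mu> \<in> conc" and p: "p \<in> I \<times> I"
  shows "\<bar>energy_rest \<mu> p\<bar> \<le> (kernel_shift + cross_bound) * (mass (fst p) * mass (snd p))"
proof (cases "same p")
  case True
  have "\<bar>energy_rest \<mu> p\<bar> = kernel_shift * measure (plate_pair \<mu> p) UNIV"
    using True kernel_shift(1) by (simp add: energy_rest_def conc_pair(5)[OF \<mu> p] abs_mult)
  also have "\<dots> \<le> kernel_shift * (mass (fst p) * mass (snd p))" by (intro mult_left_mono conc_pair(6)[OF \<mu> p] kernel_shift(1))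
  finally show ?thesis using cross_bound(1) mass_nonneg by (simp add: distrib_right add_increasing2)
next
  case False
  then show ?thesis
    using cross_integrable(2)[OF \<mu> p False] kernel_shift(1) mass_nonneg
    by (simp add: energy_rest_def distrib_right add_increasing)
qed

text \<open>The rest carries a minus sign in both cases: for equal signs it is the correction for
  the shift, for opposite signs it is the whole interaction, which enters the energy
  negatively.\<close>

lemma energy_term_value:
  assumes \<mu>: "\<mu> \<in> conc" and p: "p \<in> I \<times> I"
  shows "\<bar>energy_term \<kappa> Ipos \<mu> p\<bar> \<noteq> \<infinity> \<longleftrightarrow> (same p \<longrightarrow> kernel_int \<mu> p < top)"
    and "(same p \<longrightarrow> kernel_int \<mu> p < top) \<Longrightarrow>
      real_of_ereal (energy_term \<kappa> Ipos \<mu> p) = energy_main \<mu> p - energy_rest \<mu> p"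
proof -
  note c = conc_pair[OF \<mu> p]
  have km: "\<kappa> \<in> borel_measurable (plate_pair \<mu> p)"
    using kernel_measurable measurable_cong_sets[OF c(2), of borel "borel :: ereal measure"] by simp
  note sh = pairing_shift_finite[OF c(1) km kernel_shift(1) kernel_shift(2)]
  show 1: "\<bar>energy_term \<kappa> Ipos \<mu> p\<bar> \<noteq> \<infinity> \<longleftrightarrow> (same p \<longrightarrow> kernel_int \<mu> p < top)"
    using sh(1) cross_integrable(3)[OF \<mu> p]
    by (cases "same p") (simp_all add: energy_term_same mutual_energy_def kernel_int_def)
  show "real_of_ereal (energy_term \<kappa> Ipos \<mu> p) = energy_main \<mu> p - energy_rest \<mu> p"
    if "same p \<longrightarrow> kernel_int \<mu> p < top"
    using sh cross_integrable(3)[OF \<mu> p] that c(3,5)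
    by (cases "same p") (auto simp: energy_term_same mutual_energy_def kernel_int_def energy_main_def energy_rest_def)
qed

lemma field_value:
  assumes \<mu>: "\<mu> \<in> conc" and i: "i \<in> I"
  shows "\<bar>pairing (f i) (\<mu> i)\<bar> \<noteq> \<infinity> \<longleftrightarrow> field_int \<mu> i < top"
    and "field_int \<mu> i < top \<Longrightarrow> real_of_ereal (pairing (f i) (\<mu> i)) = field_main \<mu> i - field_rest \<mu> i"
proof -
  note c = concentratedD[OF concD[OF \<mu> i] compact_Ac[OF i]]
  have fm: "f i \<in> borel_measurable (\<mu> i)"
    using Psi_measurable[of "f i"] fPsi i by (intro radon_measurable[OF c(1)]) (simp add: I_def)
  note sh = pairing_shift_finite[OF c(3) fm field_shift(1)[OF i] field_shift(2)[OF i]]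
  show "\<bar>pairing (f i) (\<mu> i)\<bar> \<noteq> \<infinity> \<longleftrightarrow> field_int \<mu> i < top"
    using sh(1) by (simp add: field_int_def)
  show "real_of_ereal (pairing (f i) (\<mu> i)) = field_main \<mu> i - field_rest \<mu> i" if "field_int \<mu> i < top"
    using sh that by (auto simp: field_int_def field_main_def field_rest_def c(6))
qed

lemma field_rest_bound:
  assumes \<mu>: "\<mu> \<in> conc" and i: "i \<in> I"
  shows "\<bar>field_rest \<mu> i\<bar> \<le> field_shift i * mass i"
  using concentrated_measure_le[OF concD[OF \<mu> i] compact_Ac[OF i] mass_nonneg] field_shift(1)[OF i]
  by (simp add: field_rest_def abs_mult mult_left_mono)

lemma energy_rest_dominant:
  "(\<lambda>p. (kernel_shift + cross_bound) * (mass (fst p) * mass (snd p))) summable_on I \<times> I"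
  by (intro summable_on_cmult_right summable_on_products mass_summable mass_nonneg)

lemma rest_summable:
  assumes \<mu>: "\<mu> \<in> conc"
  shows "energy_rest \<mu> summable_on I \<times> I" "field_rest \<mu> summable_on I"
proof -
  show "energy_rest \<mu> summable_on I \<times> I"
    by (rule summable_if_dominated(1)[OF energy_rest_dominant]) (rule energy_rest_bound[OF \<mu>])
  show "field_rest \<mu> summable_on I"
    by (rule summable_if_dominated(1)[OF field_shift_summable]) (rule field_rest_bound[OF \<mu>])
qed

lemma rest_bounded: "\<exists>B. \<forall>\<mu>\<in>conc. \<bar>rest \<mu>\<bar> \<le> B"
proof -
  let ?B = "(\<Sum>\<^sub>\<infinity>p\<in>I \<times> I. (kernel_shift + cross_bound) * (mass (fst p) * mass (snd p))) + 2 * (\<Sum>\<^sub>\<infinity>i\<in>I. field_shift i * mass i)"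
  have "\<bar>rest \<mu>\<bar> \<le> ?B" if "\<mu> \<in> conc" for \<mu>
    using summable_if_dominated(2)[OF energy_rest_dominant energy_rest_bound[OF that]]
      summable_if_dominated(2)[OF field_shift_summable field_rest_bound[OF that]]
    by (simp add: rest_def)
  then show ?thesis by blast
qed

text \<open>The rests are always summable on \<open>conc\<close>, so finiteness of the energy is a
  matter of the nonnegative main parts alone.\<close>

lemma energy_series:
  assumes \<mu>: "\<mu> \<in> conc"
  shows "finite_series (energy_term \<kappa> Ipos \<mu>) (I \<times> I) \<longleftrightarrow>
      (\<forall>p\<in>I \<times> I. same p \<longrightarrow> kernel_int \<mu> p < top) \<and> energy_main \<mu> summable_on I \<times> I"
    and "finite_series (energy_term \<kappa> Ipos \<mu>) (I \<times> I) \<Longrightarrow>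
      vector_energy \<kappa> Ipos Ineg \<mu> = (\<Sum>\<^sub>\<infinity>p\<in>I \<times> I. energy_main \<mu> p) - (\<Sum>\<^sub>\<infinity>p\<in>I \<times> I. energy_rest \<mu> p)"
proof -
  have m: "(\<forall>p\<in>I \<times> I. same p \<longrightarrow> kernel_int \<mu> p < top) \<Longrightarrow> p \<in> I \<times> I \<Longrightarrow>
      real_of_ereal (energy_term \<kappa> Ipos \<mu> p) = energy_main \<mu> p - energy_rest \<mu> p" for p
    using energy_term_value(2)[OF \<mu>, of p] bspec[of "I \<times> I" _ p] by blast
  have t: "(\<forall>p\<in>I \<times> I. \<bar>energy_term \<kappa> Ipos \<mu> p\<bar> \<noteq> \<infinity>) \<longleftrightarrow> (\<forall>p\<in>I \<times> I. same p \<longrightarrow> kernel_int \<mu> p < top)"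
    using energy_term_value(1)[OF \<mu>] by (intro ball_cong refl)
  show 1: "finite_series (energy_term \<kappa> Ipos \<mu>) (I \<times> I) \<longleftrightarrow>
      (\<forall>p\<in>I \<times> I. same p \<longrightarrow> kernel_int \<mu> p < top) \<and> energy_main \<mu> summable_on I \<times> I"
    unfolding finite_series_def t
    using summable_diff_abs_iff(1)[OF m rest_summable(1)[OF \<mu>]] by (intro conj_cong refl) simp
  show "vector_energy \<kappa> Ipos Ineg \<mu> = (\<Sum>\<^sub>\<infinity>p\<in>I \<times> I. energy_main \<mu> p) - (\<Sum>\<^sub>\<infinity>p\<in>I \<times> I. energy_rest \<mu> p)"
    if "finite_series (energy_term \<kappa> Ipos \<mu>) (I \<times> I)"
    using that summable_diff_abs_iff(2)[OF m rest_summable(1)[OF \<mu>]]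
    unfolding 1 vector_energy_def I_def[symmetric] by simp
qed

lemma field_series:
  assumes \<mu>: "\<mu> \<in> conc"
  shows "finite_series (\<lambda>i. pairing (f i) (\<mu> i)) I \<longleftrightarrow>
      (\<forall>i\<in>I. field_int \<mu> i < top) \<and> field_main \<mu> summable_on I"
    and "finite_series (\<lambda>i. pairing (f i) (\<mu> i)) I \<Longrightarrow>
      vector_pairing I f \<mu> = (\<Sum>\<^sub>\<infinity>i\<in>I. field_main \<mu> i) - (\<Sum>\<^sub>\<infinity>i\<in>I. field_rest \<mu> i)"
proof -
  have m: "(\<forall>i\<in>I. field_int \<mu> i < top) \<Longrightarrow> i \<in> I \<Longrightarrow>
      real_of_ereal (pairing (f i) (\<mu> i)) = field_main \<mu> i - field_rest \<mu> i" for i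
    using field_value(2)[OF \<mu>] by simp
  have t: "(\<forall>i\<in>I. \<bar>pairing (f i) (\<mu> i)\<bar> \<noteq> \<infinity>) \<longleftrightarrow> (\<forall>i\<in>I. field_int \<mu> i < top)"
    using field_value(1)[OF \<mu>] by (intro ball_cong refl)
  show 1: "finite_series (\<lambda>i. pairing (f i) (\<mu> i)) I \<longleftrightarrow>
      (\<forall>i\<in>I. field_int \<mu> i < top) \<and> field_main \<mu> summable_on I"
    unfolding finite_series_def t
    using summable_diff_abs_iff(1)[OF m rest_summable(2)[OF \<mu>]] by (intro conj_cong refl) simp
  show "vector_pairing I f \<mu> = (\<Sum>\<^sub>\<infinity>i\<in>I. field_main \<mu> i) - (\<Sum>\<^sub>\<infinity>i\<in>I. field_rest \<mu> i)"
    if "finite_series (\<lambda>i. pairing (f i) (\<mu> i)) I"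
    using that summable_diff_abs_iff(2)[OF m rest_summable(2)[OF \<mu>]]
    unfolding 1 vector_pairing_def by simp
qed

lemma G_value:
  assumes \<mu>: "\<mu> \<in> conc" and "finite_series (energy_term \<kappa> Ipos \<mu>) (I \<times> I)"
    "finite_series (\<lambda>i. pairing (f i) (\<mu> i)) I"
  shows "G \<mu> = (\<Sum>\<^sub>\<infinity>p\<in>I \<times> I. energy_main \<mu> p) + 2 * (\<Sum>\<^sub>\<infinity>i\<in>I. field_main \<mu> i) - rest \<mu>"
  using energy_series(2)[OF assms(1,2)] field_series(2)[OF assms(1,3)]
  by (simp add: G_def gauss_functional_def rest_def flip: I_def)


section \<open>Solutions, finiteness of the infimum, and bounds for partial sums\<close>

definition sol :: "('i \<Rightarrow> 'a measure) set" where "sol = solutions \<kappa> Ipos Ineg A a g f I0 \<xi>"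

definition ginf :: ereal where "ginf = gauss_inf \<kappa> Ipos Ineg A a g f I0 \<xi>"

lemma ginf_lower: "\<mu> \<in> adm \<Longrightarrow> ginf \<le> ereal (G \<mu>)"
  unfolding ginf_def gauss_inf_def adm_def G_def by (rule INF_lower)

lemma mem_sol_iff: "\<mu> \<in> sol \<longleftrightarrow> \<mu> \<in> adm \<and> ereal (G \<mu>) = ginf"
  by (simp add: sol_def solutions_def adm_def G_def ginf_def)

lemma field_int_finite: "\<mu> \<in> adm \<Longrightarrow> i \<in> I \<Longrightarrow> field_int \<mu> i < top"
  and field_main_summable: "\<mu> \<in> adm \<Longrightarrow> field_main \<mu> summable_on I"
  and kernel_int_finite: "\<mu> \<in> adm \<Longrightarrow> p \<in> I \<times> I \<Longrightarrow> same p \<Longrightarrow> kernel_int \<mu> p < top"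
  and energy_main_summable: "\<mu> \<in> adm \<Longrightarrow> energy_main \<mu> summable_on I \<times> I"
  using energy_series(1)[OF adm_conc] field_series(1)[OF adm_conc] admD(2,5) by blast+

lemma G_adm:
  "\<mu> \<in> adm \<Longrightarrow> G \<mu> = (\<Sum>\<^sub>\<infinity>p\<in>I \<times> I. energy_main \<mu> p) + 2 * (\<Sum>\<^sub>\<infinity>i\<in>I. field_main \<mu> i) - rest \<mu>"
  by (rule G_value[OF adm_conc admD(2) admD(5)])

lemma energy_main_nonneg: "0 \<le> energy_main \<mu> p" and field_main_nonneg: "0 \<le> field_main \<mu> i"
  by (simp_all add: energy_main_def field_main_def)

text \<open>\<open>G + rest\<close> is a sum of nonnegative main parts and \<open>rest\<close> is
  bounded on \<open>conc\<close>; an admissible vector bounds the infimum from above.\<close>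

lemma ginf_finite: "\<exists>r. ginf = ereal r"
proof -
  obtain \<mu> where "\<mu> \<in> adm" using nonempty unfolding adm_def by blast
  then have 1: "ginf \<noteq> \<infinity>" using ginf_lower[of \<mu>] by auto
  obtain B where B: "\<And>\<mu>. \<mu> \<in> conc \<Longrightarrow> \<bar>rest \<mu>\<bar> \<le> B" using rest_bounded by blast
  have "ereal (- B) \<le> ginf"
    unfolding ginf_def gauss_inf_def
  proof (rule INF_greatest)
    fix \<mu> assume "\<mu> \<in> admissible \<kappa> Ipos Ineg A a g f I0 \<xi>"
    then have \<mu>: "\<mu> \<in> adm" by (simp add: adm_def)
    have "0 \<le> (\<Sum>\<^sub>\<infinity>p\<in>I \<times> I. energy_main \<mu> p)" "0 \<le> (\<Sum>\<^sub>\<infinity>i\<in>I. field_main \<mu> i)"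
      by (auto intro!: infsum_nonneg energy_main_nonneg field_main_nonneg)
    then have "- B \<le> G \<mu>" using B[OF adm_conc[OF \<mu>]] G_adm[OF \<mu>] by linarith
    then show "ereal (- B) \<le> ereal (gauss_functional \<kappa> Ipos Ineg f \<mu>)" by (simp add: G_def)
  qed
  then have 2: "ginf \<noteq> -\<infinity>" by auto
  from 1 2 show ?thesis by (cases ginf) auto
qed

text \<open>The factor 2 of the field is written as a repeated summand, so that semicontinuity
  follows from its stability under sums. Values are taken in \<open>ennreal\<close> because for a
  limit they are not yet known to be finite.\<close>

definition partial_main :: "('i \<Rightarrow> 'a measure) \<Rightarrow> ('i \<times> 'i) set \<Rightarrow> 'i set \<Rightarrow> ennreal" where
  "partial_main \<mu> J J' = (\<Sum>p\<in>J. kernel_int \<mu> p) + ((\<Sum>i\<in>J'. field_int \<mu> i) + (\<Sum>i\<in>J'. field_int \<mu> i))"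

text \<open>All main parts are nonnegative, so dropping all but finitely many only decreases their
  total, which is \<open>G + rest\<close>. J contains pairs of equal sign only, since otherwise
  \<open>kernel_int\<close> is not the main part.\<close>

lemma partial_sums_le_G:
  assumes \<mu>: "\<mu> \<in> adm" and J: "finite J" "J \<subseteq> I \<times> I" "\<And>p. p \<in> J \<Longrightarrow> same p" and J': "finite J'" "J' \<subseteq> I"
  shows "partial_main \<mu> J J' \<le> ennreal (G \<mu> + rest \<mu>)"
proof -
  have k: "kernel_int \<mu> p = ennreal (energy_main \<mu> p)" if "p \<in> J" for p
    using kernel_int_finite[OF \<mu>, of p] J that by (auto simp: energy_main_def)
  have v: "field_int \<mu> i = ennreal (field_main \<mu> i)" if "i \<in> J'" for i
    using field_int_finite[OF \<mu>, of i] J' that by (auto simp: field_main_def)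
  have "(\<Sum>p\<in>J. kernel_int \<mu> p) = ennreal (\<Sum>p\<in>J. energy_main \<mu> p)"
    using k by (simp add: sum_ennreal energy_main_nonneg)
  moreover have "(\<Sum>i\<in>J'. field_int \<mu> i) = ennreal (\<Sum>i\<in>J'. field_main \<mu> i)"
    using v by (simp add: sum_ennreal field_main_nonneg)
  moreover have "(\<Sum>p\<in>J. energy_main \<mu> p) \<le> (\<Sum>\<^sub>\<infinity>p\<in>I \<times> I. energy_main \<mu> p)"
    by (rule finite_sum_le_infsum[OF energy_main_summable[OF \<mu>] J(1,2)]) (rule energy_main_nonneg)
  moreover have "(\<Sum>i\<in>J'. field_main \<mu> i) \<le> (\<Sum>\<^sub>\<infinity>i\<in>I. field_main \<mu> i)"
    by (rule finite_sum_le_infsum[OF field_main_summable[OF \<mu>] J']) (rule field_main_nonneg)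
  moreover have "0 \<le> (\<Sum>p\<in>J. energy_main \<mu> p)" "0 \<le> (\<Sum>i\<in>J'. field_main \<mu> i)"
    by (auto intro!: sum_nonneg energy_main_nonneg field_main_nonneg)
  ultimately show ?thesis
    using G_adm[OF \<mu>] by (simp add: partial_main_def flip: ennreal_plus)
qed

text \<open>The bound on finite partial sums passes to the limit by semicontinuity of each term and
  continuity of \<open>rest\<close>. Suprema over finite index sets then give finite energy, finite
  field integrals and a Gauss functional not above the infimum; the remaining side conditions are
  closed under the convergence at hand.\<close>

lemma limit_is_solution:
  fixes \<nu> :: "'t \<Rightarrow> 'i \<Rightarrow> 'a measure"
  assumes F: "F \<noteq> bot" and ev: "eventually (\<lambda>t. \<nu> t \<in> adm) F"
    and Glim: "((\<lambda>t. ereal (G (\<nu> t))) \<longlongrightarrow> ginf) F"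
    and \<mu>: "\<mu> \<in> PiE I (\<lambda>_. Collect radon)"
    and lim: "\<And>i \<phi>. i \<in> I \<Longrightarrow> \<phi> \<in> test_functions \<Longrightarrow> ((\<lambda>t. \<integral>x. \<phi> x \<partial>\<nu> t i) \<longlongrightarrow> (\<integral>x. \<phi> x \<partial>\<mu> i)) F"
  shows "\<mu> \<in> sol"
proof -
  have evc: "eventually (\<lambda>t. \<nu> t \<in> conc) F" using ev by eventually_elim (rule adm_conc)
  have evi: "eventually (\<lambda>t. \<nu> t i \<in> concentrated (Ac i) (mass i)) F" if "i \<in> I" for i
    using evc by eventually_elim (rule concD[OF _ that])
  have r: "radon (\<mu> i)" if "i \<in> I" for i using PiE_mem[OF \<mu> that] by simp
  note vl = vague_limit_concentrated[OF lc compact_Ac mass_nonneg F evi r lim]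
  have \<mu>c: "\<mu> \<in> conc" unfolding conc_def using vl(1) by blast
  have conv: "((\<lambda>t. \<integral>x. \<phi> x \<partial>\<nu> t i) \<longlongrightarrow> (\<integral>x. \<phi> x \<partial>\<mu> i)) F"
    if "i \<in> I" "continuous_on UNIV \<phi>" for i and \<phi> :: "'a \<Rightarrow> real"
    using vl(2) that by blast
  have mass_lim: "((\<lambda>t. measure (\<nu> t i) UNIV) \<longlongrightarrow> measure (\<mu> i) UNIV) F" if i: "i \<in> I" for i
  proof -
    have "eventually (\<lambda>t. (\<integral>x. (1::real) \<partial>\<nu> t i) = measure (\<nu> t i) UNIV) F"
      using evi[OF i] by eventually_elim (use concentratedD(6)[OF _ compact_Ac[OF i]] in simp)
    moreover have "(\<integral>x. (1::real) \<partial>\<mu> i) = measure (\<mu> i) UNIV" by (simp add: radon_space[OF r[OF i]])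
    ultimately show ?thesis using conv[OF i, of "\<lambda>_. 1"] by (simp add: tendsto_cong)
  qed
  have pair_lim: "((\<lambda>t. \<integral>q. h q \<partial>plate_pair (\<nu> t) p) \<longlongrightarrow> (\<integral>q. h q \<partial>plate_pair \<mu> p)) F"
    if p: "p \<in> I \<times> I" and h: "h \<in> borel_measurable borel" "continuous_on (Ac (fst p) \<times> Ac (snd p)) h"
    for p and h :: "'a \<times> 'a \<Rightarrow> real"
  proof -
    have i: "fst p \<in> I" "snd p \<in> I" using p by auto
    show ?thesis
      by (rule tendsto_integral_pair[OF compact_Ac[OF i(1)] compact_Ac[OF i(2)] mass_nonneg mass_nonneg evi[OF i(1)] evi[OF i(2)] concD[OF \<mu>c i(1)] concD[OF \<mu>c i(2)] conv[OF i(1)] conv[OF i(2)] h])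
  qed
  \<comment> \<open>The dominating families depend only on membership in \<open>conc\<close>, so
    they are the same for all t and for the limit.\<close>
  have rest_lim: "((\<lambda>t. rest (\<nu> t)) \<longlongrightarrow> rest \<mu>) F"
    unfolding rest_def
  proof (intro tendsto_add tendsto_mult tendsto_const)
    show "((\<lambda>t. \<Sum>\<^sub>\<infinity>p\<in>I \<times> I. energy_rest (\<nu> t) p) \<longlongrightarrow> (\<Sum>\<^sub>\<infinity>p\<in>I \<times> I. energy_rest \<mu> p)) F"
    proof (rule tendsto_infsum_dominated[OF energy_rest_dominant])
      show "eventually (\<lambda>t. \<forall>p\<in>I \<times> I. \<bar>energy_rest (\<nu> t) p\<bar> \<le> (kernel_shift + cross_bound) * (mass (fst p) * mass (snd p))) F"
        using evc by eventually_elim (intro ballI energy_rest_bound)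
      show "\<bar>energy_rest \<mu> p\<bar> \<le> (kernel_shift + cross_bound) * (mass (fst p) * mass (snd p))" if "p \<in> I \<times> I" for p
        by (rule energy_rest_bound[OF \<mu>c that])
      show "((\<lambda>t. energy_rest (\<nu> t) p) \<longlongrightarrow> energy_rest \<mu> p) F" if p: "p \<in> I \<times> I" for p
      proof (cases "same p")
        case True
        have "fst p \<in> I" "snd p \<in> I" using p by auto
        then show ?thesis using True by (simp add: energy_rest_def tendsto_mult mass_lim)
      next
        case False
        have "Ac (fst p) \<inter> Ac (snd p) = {}" using Ac_disjoint[of "fst p" "snd p"] p False by auto
        from pair_lim[OF p kernel_real_measurable kernel_real_off_diagonal(1)[OF this]]
        show ?thesis using False by (simp add: energy_rest_def)
      qed
    qed
    show "((\<lambda>t. \<Sum>\<^sub>\<infinity>i\<in>I. field_rest (\<nu> t) i) \<longlongrightarrow> (\<Sum>\<^sub>\<infinity>i\<in>I. field_rest \<mu> i)) F"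
    proof (rule tendsto_infsum_dominated[OF field_shift_summable])
      show "eventually (\<lambda>t. \<forall>i\<in>I. \<bar>field_rest (\<nu> t) i\<bar> \<le> field_shift i * mass i) F"
        using evc by eventually_elim (intro ballI field_rest_bound)
      show "\<bar>field_rest \<mu> i\<bar> \<le> field_shift i * mass i" if "i \<in> I" for i
        by (rule field_rest_bound[OF \<mu>c that])
      show "((\<lambda>t. field_rest (\<nu> t) i) \<longlongrightarrow> field_rest \<mu> i) F" if "i \<in> I" for i
        unfolding field_rest_def by (intro tendsto_mult tendsto_const mass_lim that)
    qed
  qed
  have kernel_lsc: "lsc_along F (\<lambda>t. kernel_int (\<nu> t) p) (kernel_int \<mu> p)" if p: "p \<in> I \<times> I" for p
    unfolding kernel_int_def
  proof (rule lsc_along_nn_integral)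
    show "open {q. c < e2ennreal (\<kappa> q + ereal kernel_shift)}" for c
      by (rule Psi_shift_lsc[OF kernel_Psi kernel_shift(2)])
    show "eventually (\<lambda>t. finite_measure (plate_pair (\<nu> t) p) \<and> sets (plate_pair (\<nu> t) p) = sets borel) F"
      using evc by eventually_elim (intro conjI conc_pair(1,2)[OF _ p])
    show "finite_measure (plate_pair \<mu> p)" "sets (plate_pair \<mu> p) = sets borel"
      by (rule conc_pair[OF \<mu>c p])+
    show "((\<lambda>t. \<integral>q. h q \<partial>plate_pair (\<nu> t) p) \<longlongrightarrow> (\<integral>q. h q \<partial>plate_pair \<mu> p)) F"
      if "continuous_on UNIV h" for h :: "'a \<times> 'a \<Rightarrow> real"
      using continuous_on_subset[OF that subset_UNIV] by (intro pair_lim[OF p borel_measurable_continuous_onI[OF that]])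
  qed
  have field_lsc: "lsc_along F (\<lambda>t. field_int (\<nu> t) i) (field_int \<mu> i)" if i: "i \<in> I" for i
    unfolding field_int_def
  proof (rule lsc_along_nn_integral)
    show "open {x. c < e2ennreal (f i x + ereal (field_shift i))}" for c
      by (rule Psi_shift_lsc[OF _ field_shift(2)[OF i]]) (use fPsi i in \<open>simp add: I_def\<close>)
    show "eventually (\<lambda>t. finite_measure (\<nu> t i) \<and> sets (\<nu> t i) = sets borel) F"
      using evi[OF i] by eventually_elim (intro conjI concentratedD(3,5)[OF _ compact_Ac[OF i]])
    show "finite_measure (\<mu> i)" "sets (\<mu> i) = sets borel"
      by (rule concentratedD[OF concD[OF \<mu>c i] compact_Ac[OF i]])+
  qed (rule conv[OF i])
  obtain g0 where g0: "ginf = ereal g0" using ginf_finite by blast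
  have Glim': "((\<lambda>t. G (\<nu> t)) \<longlongrightarrow> g0) F" using Glim unfolding g0 by simp
  \<comment> \<open>The limit of the total of all main parts along the filter.\<close>
  define B where "B = g0 + rest \<mu>"
  have Blim: "((\<lambda>t. G (\<nu> t) + rest (\<nu> t)) \<longlongrightarrow> B) F"
    unfolding B_def by (intro tendsto_add Glim' rest_lim)
  have le: "partial_main \<mu> J J' \<le> ennreal B"
    if J: "finite J" "J \<subseteq> I \<times> I" "\<And>p. p \<in> J \<Longrightarrow> same p" and J': "finite J'" "J' \<subseteq> I" for J J'
  proof (rule lsc_along_le[OF _ F _ Blim])
    show "lsc_along F (\<lambda>t. partial_main (\<nu> t) J J') (partial_main \<mu> J J')"
      unfolding partial_main_def
      using J J' by (intro lsc_along_add lsc_along_sum kernel_lsc field_lsc) auto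
    show "eventually (\<lambda>t. partial_main (\<nu> t) J J' \<le> ennreal (G (\<nu> t) + rest (\<nu> t))) F"
      using ev by eventually_elim (rule partial_sums_le_G[OF _ J J'])
  qed
  \<comment> \<open>Singleton index sets already show that no single term of the limit is infinite;
    only after this may the sums be read as real numbers.\<close>
  have kfin: "kernel_int \<mu> p < top" if "p \<in> I \<times> I" "same p" for p
    using le[of "{p}" "{}"] that by (auto simp: partial_main_def intro: le_less_trans)
  have ffin: "field_int \<mu> i < top" if "i \<in> I" for i
  proof -
    have "field_int \<mu> i \<le> field_int \<mu> i + field_int \<mu> i" by (simp add: add_increasing2)
    also have "\<dots> \<le> ennreal B" using le[of "{}" "{i}"] that by (simp add: partial_main_def)
    also have "\<dots> < top" by simp
    finally show ?thesis .
  qed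
  have real_le: "(\<Sum>p\<in>J. energy_main \<mu> p) + 2 * (\<Sum>i\<in>J'. field_main \<mu> i) \<le> B"
    if J: "finite J" "J \<subseteq> I \<times> I" and J': "finite J'" "J' \<subseteq> I" for J J'
  proof -
    let ?J = "{p \<in> J. same p}"
    have e1: "(\<Sum>p\<in>J. energy_main \<mu> p) = (\<Sum>p\<in>?J. energy_main \<mu> p)"
      using J(1) by (intro sum.mono_neutral_right) (auto simp: energy_main_def)
    have e2: "ennreal (\<Sum>p\<in>?J. energy_main \<mu> p) = (\<Sum>p\<in>?J. kernel_int \<mu> p)"
    proof -
      have "(\<Sum>p\<in>?J. kernel_int \<mu> p) = (\<Sum>p\<in>?J. ennreal (energy_main \<mu> p))"
        by (rule sum.cong[OF refl]) (use kfin J in \<open>auto simp: energy_main_def\<close>)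
      then show ?thesis by (simp add: sum_ennreal energy_main_nonneg)
    qed
    have e3: "ennreal (\<Sum>i\<in>J'. field_main \<mu> i) = (\<Sum>i\<in>J'. field_int \<mu> i)"
    proof -
      have "(\<Sum>i\<in>J'. field_int \<mu> i) = (\<Sum>i\<in>J'. ennreal (field_main \<mu> i))"
        by (rule sum.cong[OF refl]) (use ffin J' in \<open>auto simp: field_main_def\<close>)
      then show ?thesis by (simp add: sum_ennreal field_main_nonneg)
    qed
    have n: "0 \<le> (\<Sum>p\<in>?J. energy_main \<mu> p)" "0 \<le> (\<Sum>i\<in>J'. field_main \<mu> i)"
      by (auto intro!: sum_nonneg energy_main_nonneg field_main_nonneg)
    have b: "partial_main \<mu> ?J J' \<le> ennreal B"
      using J J' by (intro le) auto
    \<comment> \<open>Needed because \<open>ennreal\<close> sends negative numbers to 0, so an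
      inequality there returns to the reals only for nonnegative B.\<close>
    have B0: "0 \<le> B"
    proof (rule tendsto_lowerbound[OF Blim _ F])
      show "eventually (\<lambda>t. 0 \<le> G (\<nu> t) + rest (\<nu> t)) F"
        using ev
      proof eventually_elim
        case (elim t)
        have "0 \<le> (\<Sum>\<^sub>\<infinity>p\<in>I \<times> I. energy_main (\<nu> t) p)" "0 \<le> (\<Sum>\<^sub>\<infinity>i\<in>I. field_main (\<nu> t) i)"
          by (auto intro!: infsum_nonneg energy_main_nonneg field_main_nonneg)
        then show ?case using G_adm[OF elim] by linarith
      qed
    qed
    have "ennreal ((\<Sum>p\<in>?J. energy_main \<mu> p) + ((\<Sum>i\<in>J'. field_main \<mu> i) + (\<Sum>i\<in>J'. field_main \<mu> i)))
        = partial_main \<mu> ?J J'"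
      unfolding partial_main_def e2[symmetric] e3[symmetric] using n by (simp only: ennreal_plus add_nonneg_nonneg)
    then have "ennreal ((\<Sum>p\<in>?J. energy_main \<mu> p) + ((\<Sum>i\<in>J'. field_main \<mu> i) + (\<Sum>i\<in>J'. field_main \<mu> i))) \<le> ennreal B"
      using b by (simp only:)
    then have "(\<Sum>p\<in>?J. energy_main \<mu> p) + ((\<Sum>i\<in>J'. field_main \<mu> i) + (\<Sum>i\<in>J'. field_main \<mu> i)) \<le> B"
      by (simp only: ennreal_le_iff[OF B0])
    then show ?thesis unfolding e1 by linarith
  qed
  have main_le: "(\<Sum>p\<in>J. energy_main \<mu> p) \<le> B" if "finite J" "J \<subseteq> I \<times> I" for J
    using real_le[OF that, of "{}"] by simp
  have es: "energy_main \<mu> summable_on I \<times> I"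
    by (rule nonneg_bdd_above_summable_on[OF energy_main_nonneg]) (auto intro!: bdd_aboveI[of _ B] main_le)
  have field_le: "(\<Sum>i\<in>J'. field_main \<mu> i) \<le> B / 2" if "finite J'" "J' \<subseteq> I" for J'
    using real_le[of "{}", OF _ _ that] by simp
  have fs: "field_main \<mu> summable_on I"
    by (rule nonneg_bdd_above_summable_on[OF field_main_nonneg]) (auto intro!: bdd_aboveI[of _ "B / 2"] field_le)
  have "(\<Sum>\<^sub>\<infinity>p\<in>I \<times> I. energy_main \<mu> p) \<le> B - 2 * (\<Sum>i\<in>J'. field_main \<mu> i)" if "finite J'" "J' \<subseteq> I" for J'
    by (rule infsum_le_finite_sums[OF es]) (use real_le that in \<open>simp add: algebra_simps\<close>)
  then have "(\<Sum>i\<in>J'. field_main \<mu> i) \<le> (B - (\<Sum>\<^sub>\<infinity>p\<in>I \<times> I. energy_main \<mu> p)) / 2" if "finite J'" "J' \<subseteq> I" for J'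
    using that by (simp add: field_simps)
  \<comment> \<open>The supremum is taken in two stages: first over J with J' fixed, then over
    J'.\<close>
  then have total: "(\<Sum>\<^sub>\<infinity>i\<in>I. field_main \<mu> i) \<le> (B - (\<Sum>\<^sub>\<infinity>p\<in>I \<times> I. energy_main \<mu> p)) / 2"
    by (intro infsum_le_finite_sums[OF fs])
  have fe: "finite_series (energy_term \<kappa> Ipos \<mu>) (I \<times> I)"
    using energy_series(1)[OF \<mu>c] kfin es by blast
  have ff: "finite_series (\<lambda>i. pairing (f i) (\<mu> i)) I"
    using field_series(1)[OF \<mu>c] ffin fs by blast
  have "\<mu> \<in> adm"
  proof (rule admI[OF _ fe _ _ ff])
    \<comment> \<open>The vague limit is known only to live on \<open>Ac i\<close>. Its finite
      energy, established just before, is what allows the return to A i.\<close>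
    show "\<mu> \<in> PiE I (\<lambda>i. radon_on (A i))"
    proof (rule PiE_I)
      fix i assume i: "i \<in> I"
      have "\<bar>energy_term \<kappa> Ipos \<mu> (i, i)\<bar> \<noteq> \<infinity>" using fe i by (simp add: finite_series_def)
      then have "\<bar>mutual_energy \<kappa> (\<mu> i) (\<mu> i)\<bar> \<noteq> \<infinity>" by (simp add: energy_term_same same_def)
      from finite_energy_null_diff[OF i r[OF i] this]
      have "emeasure (\<mu> i) (sym_diff (Ac i) (A i)) = 0" by (simp add: Un_commute)
      moreover have "emeasure (\<mu> i) (- Ac i) = 0"
        by (rule concentratedD(2)[OF concD[OF \<mu>c i] compact_Ac[OF i]])
      ultimately have "emeasure (\<mu> i) (- A i) = 0"
        using compact_imp_closed[OF compact_Ac[OF i]] A_borel[OF i]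
        by (intro null_complement_swap[OF r[OF i], of "Ac i" "A i"]) auto
      then show "\<mu> i \<in> radon_on (A i)"
        using carried_by_null[OF sc r[OF i] A_borel[OF i]] r[OF i] by (simp add: radon_on_def)
    next
      show "\<mu> i = undefined" if "i \<notin> I" for i by (rule PiE_arb[OF \<mu> that])
    qed
    \<comment> \<open>g i need not have compact support; convergence against all continuous
      functions keeps the normalization exact in the limit.\<close>
    show "pairing (\<lambda>x. ereal (g i x)) (\<mu> i) = ereal (a i)" if i: "i \<in> I" for i
    proof -
      have gc: "continuous_on UNIV (g i)" using gcont i by (simp add: I_def)
      have val: "pairing (\<lambda>x. ereal (g i x)) \<eta> = ereal (\<integral>x. g i x \<partial>\<eta>)" if "\<eta> \<in> concentrated (Ac i) (mass i)" for \<eta>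
      proof (rule pairing_integrable)
        show "integrable \<eta> (g i)"
          by (rule integrable_on_compact[OF concentratedD(1)[OF that compact_Ac[OF i]] compact_Ac[OF i] concentratedD(2)[OF that compact_Ac[OF i]] gc])
      qed simp
      have "eventually (\<lambda>t. (\<integral>x. g i x \<partial>\<nu> t i) = a i) F"
        using ev
      proof eventually_elim
        case (elim t)
        show ?case using val[OF concD[OF adm_conc[OF elim] i]] admD(3)[OF elim i] by simp
      qed
      then have "((\<lambda>t. \<integral>x. g i x \<partial>\<nu> t i) \<longlongrightarrow> a i) F" by (rule tendsto_eventually)
      then have "(\<integral>x. g i x \<partial>\<mu> i) = a i" using tendsto_unique[OF F conv[OF i gc]] by blast
      then show ?thesis using val[OF concD[OF \<mu>c i]] by simp
    qed
    \<comment> \<open>The order is tested on nonnegative test functions, and each of them gives an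
      inequality that survives vague limits.\<close>
    show "\<mu> i \<le> \<xi> i" if i0: "i \<in> I0" for i
    proof -
      have i: "i \<in> I" using I0 i0 by (auto simp: I_def)
      have rx: "radon (\<xi> i)" using constr i0 by (simp add: is_constraint_def radon_on_def)
      show ?thesis
      proof (rule radon_le_if_integrals_le[OF lc r[OF i] rx])
        fix \<phi> :: "'a \<Rightarrow> real" assume \<phi>: "\<phi> \<in> test_functions" "\<And>x. 0 \<le> \<phi> x"
        show "(\<integral>x. \<phi> x \<partial>\<mu> i) \<le> (\<integral>x. \<phi> x \<partial>\<xi> i)"
        proof (rule tendsto_upperbound[OF lim[OF i \<phi>(1)] _ F])
          show "eventually (\<lambda>t. (\<integral>x. \<phi> x \<partial>\<nu> t i) \<le> (\<integral>x. \<phi> x \<partial>\<xi> i)) F"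
            using ev
          proof eventually_elim
            case (elim t)
            have rt: "radon (\<nu> t i)"
              by (rule concentratedD(1)[OF concD[OF adm_conc[OF elim] i] compact_Ac[OF i]])
            have "(\<integral>\<^sup>+x. ennreal (\<phi> x) \<partial>\<nu> t i) \<le> (\<integral>\<^sup>+x. ennreal (\<phi> x) \<partial>\<xi> i)"
              by (rule nn_integral_mono_measure[OF _ admD(4)[OF elim i0]]) (simp add: radon_sets[OF rt] radon_sets[OF rx])
            then show ?case
              using nn_integral_eq_integral[OF integrable_test_function[OF rt \<phi>(1)]]
                nn_integral_eq_integral[OF integrable_test_function[OF rx \<phi>(1)]] \<phi>(2)
              by (simp add: integral_nonneg)
          qed
        qed
      qed
    qed
  qed
  \<comment> \<open>By \<open>total\<close> the main parts add up to at most
    \<open>g0 + rest \<mu>\<close>, and \<open>rest \<mu>\<close> cancels in the formula for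
    G.\<close>
  moreover have "G \<mu> \<le> g0"
    using G_value[OF \<mu>c fe ff] total by (simp add: B_def field_simps)
  ultimately show ?thesis
    using ginf_lower[of \<mu>] unfolding mem_sol_iff g0 by simp
qed

text \<open>Along a refined filter the cluster point becomes a limit, while admissibility and
  convergence of G are inherited. Coordinate projections then reduce neighbourhoods in the product
  to convergence of single integrals.\<close>

lemma cluster_point_is_solution:
  fixes \<nu> :: "'t \<Rightarrow> 'i \<Rightarrow> 'a measure"
  assumes ev: "eventually (\<lambda>t. \<nu> t \<in> adm) F" and Glim: "((\<lambda>t. ereal (G (\<nu> t))) \<longlongrightarrow> ginf) F"
    and \<mu>: "\<mu> \<in> topspace (vague_product I)"
    and cl: "\<And>U. openin (vague_product I) U \<Longrightarrow> \<mu> \<in> U \<Longrightarrow> \<exists>\<^sub>F t in F. \<nu> t \<in> U"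
  shows "\<mu> \<in> sol"
proof -
  have "\<exists>F'. F' \<noteq> bot \<and> F' \<le> F \<and>
      (\<forall>U. openin (vague_product I) U \<longrightarrow> \<mu> \<in> U \<longrightarrow> eventually (\<lambda>t. \<nu> t \<in> U) F')"
    by (rule cluster_point_refinement[OF _ \<mu>]) (rule cl)
  then obtain F' where F': "F' \<noteq> bot" "F' \<le> F"
    "\<forall>U. openin (vague_product I) U \<longrightarrow> \<mu> \<in> U \<longrightarrow> eventually (\<lambda>t. \<nu> t \<in> U) F'"
    by (elim exE conjE)
  have \<mu>': "\<mu> \<in> PiE I (\<lambda>_. Collect radon)"
    using \<mu> by (simp add: vague_product_def topspace_vague_topology)
  show ?thesis
  proof (rule limit_is_solution[OF F'(1) filter_leD[OF F'(2) ev] tendsto_mono[OF F'(2) Glim] \<mu>'])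
    fix i and \<phi> :: "'a \<Rightarrow> real" assume i: "i \<in> I" and \<phi>: "\<phi> \<in> test_functions"
    show "((\<lambda>t. \<integral>x. \<phi> x \<partial>\<nu> t i) \<longlongrightarrow> (\<integral>x. \<phi> x \<partial>\<mu> i)) F'"
    proof (rule topological_tendstoI)
      fix S :: "real set" assume S: "open S" "(\<integral>x. \<phi> x \<partial>\<mu> i) \<in> S"
      \<comment> \<open>A subbasic vague neighbourhood; its preimage under the i-th projection is
        open in the product.\<close>
      define W where "W = {\<eta>. radon \<eta> \<and> (\<integral>x. \<phi> x \<partial>\<eta>) \<in> S}"
      have "openin vague_topology W"
        unfolding vague_topology_def W_def by (rule topology_generated_by_Basis) (use \<phi> S(1) in blast)
      moreover have "continuous_map (vague_product I) vague_topology (\<lambda>\<eta>. \<eta> i)"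
        unfolding vague_product_def by (rule continuous_map_product_projection[OF i])
      ultimately have "openin (vague_product I) {\<eta> \<in> topspace (vague_product I). \<eta> i \<in> W}"
        by (rule openin_continuous_map_preimage[rotated])
      moreover have "\<mu> \<in> {\<eta> \<in> topspace (vague_product I). \<eta> i \<in> W}"
        using \<mu> S(2) PiE_mem[OF \<mu>' i] by (simp add: W_def)
      ultimately have "eventually (\<lambda>t. \<nu> t \<in> {\<eta> \<in> topspace (vague_product I). \<eta> i \<in> W}) F'"
        using F'(3) by blast
      then show "eventually (\<lambda>t. (\<integral>x. \<phi> x \<partial>\<nu> t i) \<in> S) F'"
        by eventually_elim (simp add: W_def)
    qed
  qed
qed

section \<open>Existence, compactness and description of the solutions\<close>

definition admissible_box :: "('i \<Rightarrow> 'a measure) set" where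
  "admissible_box = PiE I (\<lambda>i. concentrated (Ac i) (mass i))"

lemma compactin_admissible_box: "compactin (vague_product I) admissible_box"
  unfolding vague_product_def admissible_box_def compactin_PiE
  using compactin_vague_concentrated[OF lc compact_Ac mass_nonneg] by blast

lemma adm_subset_admissible_box: "adm \<subseteq> admissible_box"
proof
  fix \<mu> assume \<mu>: "\<mu> \<in> adm"
  show "\<mu> \<in> admissible_box"
    unfolding admissible_box_def
  proof (rule PiE_I)
    show "\<mu> i \<in> concentrated (Ac i) (mass i)" if "i \<in> I" for i by (rule concD[OF adm_conc[OF \<mu>] that])
    show "\<mu> i = undefined" if "i \<notin> I" for i by (rule PiE_arb[OF admD(1)[OF \<mu>] that])
  qed
qed

text \<open>A nonempty set of extended reals contains a decreasing sequence tending to its infimum.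
  The corresponding vectors form a minimizing sequence in the compact box, and any cluster point of
  it is a solution.\<close>

lemma sol_nonempty: "sol \<noteq> {}"
proof -
  let ?V = "(\<lambda>\<mu>. ereal (G \<mu>)) ` adm"
  have ne: "?V \<noteq> {}" using nonempty by (simp add: adm_def)
  have inf: "Inf ?V = ginf" by (simp add: ginf_def gauss_inf_def adm_def G_def)
  obtain v :: "nat \<Rightarrow> ereal" where v: "decseq v" "range v \<subseteq> ?V" "Inf ?V = (INF n. v n)"
    using Inf_countable_INF[OF ne] by (elim exE conjE)
  have "\<exists>\<mu>. \<mu> \<in> adm \<and> v n = ereal (G \<mu>)" for n using v(2) by auto
  then obtain \<nu> where \<nu>: "\<And>n. \<nu> n \<in> adm" "\<And>n. v n = ereal (G (\<nu> n))" by metis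
  have lim: "(\<lambda>n. ereal (G (\<nu> n))) \<longlonglongrightarrow> ginf"
  proof -
    have "v = (\<lambda>n. ereal (G (\<nu> n)))" using \<nu>(2) by (rule ext)
    then show ?thesis using LIMSEQ_INF[OF v(1)] v(3) by (simp add: inf)
  qed
  have ev: "eventually (\<lambda>n. \<nu> n \<in> admissible_box) sequentially"
    by (intro always_eventually allI subsetD[OF adm_subset_admissible_box] \<nu>(1))
  from compactin_cluster_point[OF compactin_admissible_box sequentially_bot ev]
  obtain \<mu> where \<mu>: "\<mu> \<in> admissible_box" "\<forall>U. openin (vague_product I) U \<and> \<mu> \<in> U \<longrightarrow> (\<exists>\<^sub>F n in sequentially. \<nu> n \<in> U)"
    by (elim bexE)
  have "\<mu> \<in> topspace (vague_product I)" using compactin_subset_topspace[OF compactin_admissible_box] \<mu>(1) by blast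
  from cluster_point_is_solution[OF always_eventually lim this] \<mu>(2) \<nu>(1) have "\<mu> \<in> sol" by simp
  then show ?thesis by blast
qed

text \<open>The set is closed in the compact box, by the same argument that treats minimizing
  nets.\<close>

lemma compactin_sol: "compactin (vague_product I) sol"
proof -
  have sub: "sol \<subseteq> admissible_box" using adm_subset_admissible_box mem_sol_iff by blast
  have "closedin (subtopology (vague_product I) admissible_box) sol"
    unfolding closure_of_subset_eq[symmetric]
  proof (intro conjI subsetI)
    show "\<mu> \<in> topspace (subtopology (vague_product I) admissible_box)" if "\<mu> \<in> sol" for \<mu>
      using sub that compactin_subset_topspace[OF compactin_admissible_box] by auto
    fix \<mu> assume m: "\<mu> \<in> subtopology (vague_product I) admissible_box closure_of sol"
    have \<mu>: "\<mu> \<in> topspace (vague_product I)" "\<mu> \<in> admissible_box"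
      using m by (auto simp: in_closure_of)
    have meets: "\<exists>\<eta>\<in>sol. \<eta> \<in> U" if U: "openin (vague_product I) U" "\<mu> \<in> U" for U
    proof -
      have "openin (subtopology (vague_product I) admissible_box) (U \<inter> admissible_box)"
        using U(1) by (rule openin_subtopology_Int)
      then show ?thesis using m U(2) \<mu>(2) unfolding in_closure_of by blast
    qed
    show "\<mu> \<in> sol"
    \<comment> \<open>A point of the closure is a cluster point of the identity along the principal
      filter of \<open>sol\<close>, on which G is constantly equal to the infimum.\<close>
    proof (rule cluster_point_is_solution[where \<nu> = "\<lambda>\<eta>. \<eta>" and F = "principal sol", OF _ _ \<mu>(1)])
      show "eventually (\<lambda>\<eta>. \<eta> \<in> adm) (principal sol)" by (simp add: eventually_principal mem_sol_iff)
      show "((\<lambda>\<eta>. ereal (G \<eta>)) \<longlongrightarrow> ginf) (principal sol)"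
        by (rule tendsto_eventually) (simp add: eventually_principal mem_sol_iff)
      show "\<exists>\<^sub>F \<eta> in principal sol. \<eta> \<in> U" if "openin (vague_product I) U" "\<mu> \<in> U" for U
        using meets[OF that] by (auto simp: frequently_def eventually_principal)
    qed
  qed
  then have "compactin (subtopology (vague_product I) admissible_box) sol"
    using compactin_admissible_box by (intro closedin_compact_space) (auto simp: compactin_subspace)
  then show ?thesis by (simp add: compactin_subtopology)
qed

text \<open>A solution is the limit of the constant net that it forms; conversely a cluster point of
  a minimizing net is one along its filter of tails. The index type \<open>'t\<close> stays
  arbitrary throughout.\<close>

lemma sol_eq_cluster_points:
  "sol = (\<Union>(T :: 't set, le, \<nu>) \<in> minimizing_nets \<kappa> Ipos Ineg A a g f I0 \<xi>. vague_cluster_points I T le \<nu>)"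
proof (intro equalityI subsetI)
  fix \<mu> assume \<mu>: "\<mu> \<in> sol"
  \<comment> \<open>A single point with the total relation is a directed set in any type, so the
    constant net exists whatever \<open>'t\<close> is.\<close>
  define T :: "'t set" where "T = {undefined}"
  define le :: "'t \<Rightarrow> 't \<Rightarrow> bool" where "le = (\<lambda>_ _. True)"
  have dir: "directed_set T le"
    by (auto simp: directed_set_def T_def le_def reflp_on_def transp_on_def)
  have "(T, le, \<lambda>_. \<mu>) \<in> minimizing_nets \<kappa> Ipos Ineg A a g f I0 \<xi>"
    using \<mu> dir by (simp add: minimizing_nets_def mem_sol_iff flip: adm_def G_def ginf_def)
  moreover have "\<mu> \<in> vague_cluster_points I T le (\<lambda>_. \<mu>)"
  proof -
    have "\<mu> \<in> admissible_box" using \<mu> adm_subset_admissible_box mem_sol_iff by blast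
    then have "\<mu> \<in> topspace (vague_product I)" using compactin_subset_topspace[OF compactin_admissible_box] by blast
    then show ?thesis
      by (simp add: vague_cluster_points_def frequently_tails[OF dir]) (simp add: T_def le_def)
  qed
  ultimately show "\<mu> \<in> (\<Union>(T :: 't set, le, \<nu>) \<in> minimizing_nets \<kappa> Ipos Ineg A a g f I0 \<xi>. vague_cluster_points I T le \<nu>)"
    by blast
next
  fix \<mu> assume "\<mu> \<in> (\<Union>(T :: 't set, le, \<nu>) \<in> minimizing_nets \<kappa> Ipos Ineg A a g f I0 \<xi>. vague_cluster_points I T le \<nu>)"
  then obtain T :: "'t set" and le \<nu> where
    net: "(T, le, \<nu>) \<in> minimizing_nets \<kappa> Ipos Ineg A a g f I0 \<xi>" and cl: "\<mu> \<in> vague_cluster_points I T le \<nu>"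
    by blast
  have dir: "directed_set T le" and ad: "\<And>t. t \<in> T \<Longrightarrow> \<nu> t \<in> adm"
    and lim: "((\<lambda>t. ereal (G (\<nu> t))) \<longlongrightarrow> ginf) (tails T le)"
    using net by (auto simp: minimizing_nets_def adm_def G_def ginf_def)
  show "\<mu> \<in> sol"
  proof (rule cluster_point_is_solution[OF _ lim])
    have "T \<noteq> {}" using dir by (simp add: directed_set_def)
    then show "eventually (\<lambda>t. \<nu> t \<in> adm) (tails T le)"
      using ad by (auto simp: eventually_tails[OF dir])
    show "\<mu> \<in> topspace (vague_product I)" using cl by (simp add: vague_cluster_points_def)
    show "\<exists>\<^sub>F t in tails T le. \<nu> t \<in> U" if "openin (vague_product I) U" "\<mu> \<in> U" for U
      using cl that by (simp add: vague_cluster_points_def)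
  qed
qed

end

theorem theorem6p3:
  fixes \<kappa> :: "'a::{metric_space,second_countable_topology} \<times> 'a \<Rightarrow> ereal"
    and Ipos Ineg I0 :: "'i set"
    and A Ac :: "'i \<Rightarrow> 'a set"
    and a :: "'i \<Rightarrow> real"
    and g :: "'i \<Rightarrow> 'a \<Rightarrow> real"
    and f :: "'i \<Rightarrow> 'a \<Rightarrow> ereal"
    and \<xi> :: "'i \<Rightarrow> 'a measure"
  assumes "locally compact (UNIV :: 'a set)"
    and "\<exists>\<K> :: 'a set set. countable \<K> \<and> (\<forall>K\<in>\<K>. compact K) \<and> \<Union>\<K> = UNIV"
    and "pd_kernel \<kappa>"
    and "off_diagonal_continuous \<kappa>"
    and "vanishes_at_infinity \<kappa>"
    and "generalized_condenser Ipos Ineg A"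
    and "finite Ipos \<or> finite Ineg"
    and "\<And>i. i \<in> Ipos \<union> Ineg \<Longrightarrow> compact (Ac i) \<and> inner_capacity \<kappa> (sym_diff (A i) (Ac i)) = 0"
    and "\<And>K. compact K \<Longrightarrow> finite {i \<in> Ipos \<union> Ineg. Ac i \<inter> K \<noteq> {}}"
    and "(\<Union>i\<in>Ipos. Ac i) \<inter> (\<Union>i\<in>Ineg. Ac i) = {}"
    and "\<And>i. i \<in> Ipos \<union> Ineg \<Longrightarrow> 0 < a i"
    and "\<And>i. i \<in> Ipos \<union> Ineg \<Longrightarrow> continuous_on UNIV (g i) \<and> (\<forall>x. 0 < g i x)"
    and "\<And>i. i \<in> Ipos \<union> Ineg \<Longrightarrow> f i \<in> Psi"
    and "(\<Sum>\<^sub>\<infinity>i\<in>Ipos \<union> Ineg. ennreal (a i) * inverse (INF x\<in>A i. ennreal (g i x))) < \<infinity>"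
    and "I0 \<subseteq> Ipos \<union> Ineg"
    and "is_constraint A a g I0 \<xi>"
    and "admissible \<kappa> Ipos Ineg A a g f I0 \<xi> \<noteq> {}"
  shows "solutions \<kappa> Ipos Ineg A a g f I0 \<xi> \<noteq> {}
    \<and> compactin (vague_product (Ipos \<union> Ineg)) (solutions \<kappa> Ipos Ineg A a g f I0 \<xi>)
    \<and> solutions \<kappa> Ipos Ineg A a g f I0 \<xi> =
        (\<Union>(T :: 't set, le, \<nu>) \<in> minimizing_nets \<kappa> Ipos Ineg A a g f I0 \<xi>.
           vague_cluster_points (Ipos \<union> Ineg) T le \<nu>)"
proof -
  interpret gauss_problem \<kappa> Ipos Ineg I0 A Ac a g f \<xi>
    by unfold_locales (fact assms)+
  show ?thesis
    using sol_nonempty compactin_sol sol_eq_cluster_points unfolding sol_def I_def by blast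
qed

end
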